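(* Let $N\ge 1$ be an integer, $\alpha\in(0,N)$, $p,q>0$, $m>s>1$, $s<N$, $q\ge\alpha-1$ and $\min\{p,q\}>m-1$. Let $g:[0,\infty)\to(0,\infty)$ be a non-increasing function of class $C^1(0,\infty)\cap C[0,\infty)$ such that $\lim_{t\to 0^+}\frac{t g'(t)}{g(t)}=0$ and $\frac{t g'(t)}{g(t)}+m-1\ge 0$ for all $t>0$. Then the following statements are equivalent: (i) The inequality $\mathcal L_g u-\Delta_s u\ge(|x|^{-\alpha}*u^p)u^q$ in $\mathbb R^N\setminus\overline B_1$ has a positive solution. (ii) The equation $\mathcal L_g u-\Delta_s u=(|x|^{-\alpha}*u^p)u^q$ in $\mathbb R^N\setminus\overline B_1$ has a positive $C^1$-solution. (iii) The exponents $p$ and $q$ satisfy $$ \min\{p,q\}>\frac{(s-1)(N-\alpha)}{N-s}\qquad\text{and}\qquad p+q>\frac{(s-1)(2N-\alpha)}{N-s}. $$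
   Context: $B_R$ is the open ball of radius $R$ centred at the origin in $\mathbb R^N$. $\Delta_s u=\operatorname{div}(|\nabla u|^{s-2}\nabla u)$ and $\mathcal L_g u=-\operatorname{div}\big(|\nabla u|^{m-2}g(|\nabla u|)\nabla u\big)$. The convolution is taken over $\mathbb R^N\setminus B_1$: $(|x|^{-\alpha}*u^p)(x)=\int_{\mathbb R^N\setminus B_1}\frac{u^p(y)}{|x-y|^{\alpha}}\,dy$ for $x\in\mathbb R^N\setminus\overline B_1$. A positive solution of the inequality in (i) is a function $u\in C(\mathbb R^N\setminus\overline B_1)\cap W^{1,m}_{loc}(\mathbb R^N\setminus\overline B_1)$ with $u>0$, with $\int_{\mathbb R^N\setminus B_1}\frac{u^p(y)}{1+|y|^\alpha}\,dy<\infty$, and such that for every $\phi\in C_c^\infty(\mathbb R^N\setminus\overline B_1)$, $\phi\ge0$, $$ \int_{\mathbb R^N\setminus B_1}\Big(|\nabla u|^{m-2}g(|\nabla u|)+|\nabla u|^{s-2}\Big)\nabla u\cdot\nabla\phi\,dx\ \ge\ \int_{\mathbb R^N\setminus B_1}(|x|^{-\alpha}*u^p)u^q\phi\,dx . $$ A positive $C^1$-solution of the equation in (ii) is a positive function $u\in C^1(\mathbb R^N\setminus\overline B_1)$ satisfying the same integrability condition and the same integral relation with equality in place of $\ge$, for every $\phi\in C_c^\infty(\mathbb R^N\setminus\overline B_1)$. *)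

theory Defs
  imports "HOL-Analysis.Analysis"
begin

definition grad :: "('a::euclidean_space \<Rightarrow> real) \<Rightarrow> 'a \<Rightarrow> 'a" where
  "grad f x = (THE D. GDERIV f x :> D)"

definition C1_on :: "'a::euclidean_space set \<Rightarrow> ('a \<Rightarrow> real) \<Rightarrow> bool" where
  "C1_on \<Omega> f \<longleftrightarrow> (\<forall>x\<in>\<Omega>. f differentiable (at x)) \<and> continuous_on \<Omega> (grad f)"

primrec Ck :: "nat \<Rightarrow> ('a::euclidean_space \<Rightarrow> real) \<Rightarrow> bool" where
  "Ck 0 f \<longleftrightarrow> continuous_on UNIV f"
| "Ck (Suc k) f \<longleftrightarrow>
     (\<forall>x. f differentiable (at x)) \<and> (\<forall>b\<in>Basis. Ck k (\<lambda>x. grad f x \<bullet> b))"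

(* C_c^infinity(Omega); its elements are identified with their extensions by zero to the
   whole space. *)
definition test_functions :: "'a::euclidean_space set \<Rightarrow> ('a \<Rightarrow> real) set" where
  "test_functions \<Omega> =
     {\<phi>. (\<forall>k. Ck k \<phi>) \<and> compact (closure (support_on UNIV \<phi>))
          \<and> closure (support_on UNIV \<phi>) \<subseteq> \<Omega>}"

definition L_loc :: "real \<Rightarrow> 'a::euclidean_space set \<Rightarrow> ('a \<Rightarrow> 'b::euclidean_space) \<Rightarrow> bool" where
  "L_loc r \<Omega> f \<longleftrightarrow>
     set_borel_measurable lebesgue \<Omega> f \<and>
     (\<forall>K. compact K \<and> K \<subseteq> \<Omega> \<longrightarrow> set_integrable lebesgue K (\<lambda>x. norm (f x) powr r))"

definition has_weak_gradient ::
  "('a::euclidean_space \<Rightarrow> real) \<Rightarrow> ('a \<Rightarrow> 'a) \<Rightarrow> 'a set \<Rightarrow> bool" where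
  "has_weak_gradient u Du \<Omega> \<longleftrightarrow>
     L_loc 1 \<Omega> u \<and> L_loc 1 \<Omega> Du \<and>
     (\<forall>\<phi>\<in>test_functions \<Omega>.
        (LINT x:\<Omega>|lebesgue. u x *\<^sub>R grad \<phi> x) = - (LINT x:\<Omega>|lebesgue. \<phi> x *\<^sub>R Du x))"

(* u lies in W^{1,m}_loc(Omega) and Du represents its weak gradient, which is determined
   almost everywhere on Omega. *)
definition W1_loc ::
  "real \<Rightarrow> 'a::euclidean_space set \<Rightarrow> ('a \<Rightarrow> real) \<Rightarrow> ('a \<Rightarrow> 'a) \<Rightarrow> bool" where
  "W1_loc m \<Omega> u Du \<longleftrightarrow> has_weak_gradient u Du \<Omega> \<and> L_loc m \<Omega> u \<and> L_loc m \<Omega> Du"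

abbreviation exterior :: "'a::euclidean_space set" where
  "exterior \<equiv> - cball 0 1"

(* Functions on the exterior domain are total functions whose values on cball 0 1 are
   irrelevant: the complement of ball 0 1 differs from the exterior domain by the unit sphere
   only, which is Lebesgue null (and all integrals are with respect to lebesgue, not lborel). *)
definition conv :: "real \<Rightarrow> real \<Rightarrow> ('a::euclidean_space \<Rightarrow> real) \<Rightarrow> 'a \<Rightarrow> real" where
  "conv \<alpha> p u x = (LINT y:(- ball 0 1)|lebesgue. u y powr p / norm (x - y) powr \<alpha>)"

definition conv_integrable :: "real \<Rightarrow> real \<Rightarrow> ('a::euclidean_space \<Rightarrow> real) \<Rightarrow> bool" where
  "conv_integrable \<alpha> p u \<longleftrightarrow>
     set_integrable lebesgue (- ball 0 1) (\<lambda>y. u y powr p / (1 + norm y powr \<alpha>))"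

(* The two sides of the integral relation, with Du in the role of the gradient of u. At zeros of
   Du the integrand of weak_lhs is 0, the continuous extension, also for exponents below 2.
   In the solution notions below, with 0 < alpha < dimension, m > s > 1 and g continuous,
   positive and non-increasing on [0,infinity), conv alpha p u is finite and locally bounded on
   the exterior domain (this is what conv_integrable is for) and g(|Du|) <= g(0), so all
   integrands are integrable and the default value 0 of the Bochner integral never intervenes. *)
definition weak_lhs ::
  "real \<Rightarrow> real \<Rightarrow> (real \<Rightarrow> real) \<Rightarrow> ('a::euclidean_space \<Rightarrow> 'a) \<Rightarrow> ('a \<Rightarrow> real) \<Rightarrow> real" where
  "weak_lhs m s g Du \<phi> =
     (LINT x:(- ball 0 1)|lebesgue.
        ((norm (Du x) powr (m - 2) * g (norm (Du x)) + norm (Du x) powr (s - 2)) *\<^sub>R Du x)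
          \<bullet> grad \<phi> x)"

definition weak_rhs ::
  "real \<Rightarrow> real \<Rightarrow> real \<Rightarrow> ('a::euclidean_space \<Rightarrow> real) \<Rightarrow> ('a \<Rightarrow> real) \<Rightarrow> real" where
  "weak_rhs \<alpha> p q u \<phi> =
     (LINT x:(- ball 0 1)|lebesgue. conv \<alpha> p u x * u x powr q * \<phi> x)"

definition positive_solution_ineq ::
  "real \<Rightarrow> real \<Rightarrow> real \<Rightarrow> real \<Rightarrow> real \<Rightarrow> (real \<Rightarrow> real) \<Rightarrow> ('a::euclidean_space \<Rightarrow> real) \<Rightarrow> bool" where
  "positive_solution_ineq \<alpha> p q m s g u \<longleftrightarrow>
     (\<forall>x\<in>exterior. u x > 0) \<and> continuous_on exterior u \<and> conv_integrable \<alpha> p u \<and>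
     (\<exists>Du. W1_loc m exterior u Du \<and>
        (\<forall>\<phi>\<in>test_functions exterior.
           (\<forall>x. \<phi> x \<ge> 0) \<longrightarrow> weak_lhs m s g Du \<phi> \<ge> weak_rhs \<alpha> p q u \<phi>))"

definition positive_C1_solution_eq ::
  "real \<Rightarrow> real \<Rightarrow> real \<Rightarrow> real \<Rightarrow> real \<Rightarrow> (real \<Rightarrow> real) \<Rightarrow> ('a::euclidean_space \<Rightarrow> real) \<Rightarrow> bool" where
  "positive_C1_solution_eq \<alpha> p q m s g u \<longleftrightarrow>
     (\<forall>x\<in>exterior. u x > 0) \<and> C1_on exterior u \<and> conv_integrable \<alpha> p u \<and>
     (\<forall>\<phi>\<in>test_functions exterior. weak_lhs m s g (grad u) \<phi> = weak_rhs \<alpha> p q u \<phi>)"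

end

theory Submission
  imports Defs
begin

text \<open>
  Write $\gamma = (N-s)/(s-1)$ and $a(t) = t^{m-1} g(t) + t^{s-1}$, an increasing bijection of
  $[0,\infty)$ comparable to $t^{s-1}$ for small $t$; the fundamental decay rate is
  $|x|^{-\gamma}$.

  Necessity rests on a comparison principle for weak supersolutions. Comparison with radial functions
  of prescribed flux gives $u \ge c|x|^{-\gamma}$, and integrability of the potential then forces
  $\gamma p > N - \alpha$. If one of the other two conditions fails, then the right-hand side is at
  least $c|x|^{-N}$, and comparison improves the bound by a factor $(\log |x|)^{1/(s-1)}$. On a ball
  of radius $|x|/2$ this starts an iteration: a lower bound $K$ on a ball produces a lower bound
  $\theta K$ with $\theta > 1$ on the concentric ball of half the radius, because $q > m - 1$. So $u$
  is infinite at the centre, a contradiction.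

  For sufficiency, radial solutions are the fixed points of a monotone integral operator $T$ on
  decreasing profiles. The conditions on $p$ and $q$ say that the right-hand side built from
  $\kappa |x|^{-\gamma}$ has finite mass, and then $T w \le w$ for $w = \kappa r^{-\gamma}$ with
  $\kappa$ small, since $p + q > s - 1$.
\<close>

section \<open>Gradients, smooth functions and mollification\<close>

text \<open>The solution in (i) has only a weak gradient, so the positive part of
  \<open>z - u\<close> is not an admissible test function. Mollifying \<open>u\<close> and squaring
  the positive part keeps all test functions of class C^1. On the other side, comparison functions
  need no second derivatives: they are prescribed through the flux
  \<open>- |x|^(-N) H(|x|) x\<close>, whose negative divergence is \<open>|x|^(1-N) H'(|x|)\<close>,
  and the profile is recovered by integrating the inverse of \<open>a\<close>. The choice
  \<open>H = 1\<close> gives the fundamental decay, \<open>H = ln\<close> the logarithmic gain in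
  the borderline case, and the accumulated right-hand side gives the solution itself. In the
  existence part zero would be a fixed point if the flux consisted of the accumulated mass alone; a
  positive constant flux entering at the unit sphere excludes it. The density there is estimated
  with an exponent \<open>a' \<le> \<gamma> * p\<close> that is kept below \<open>N\<close>, because
  the convolution estimate for two powers requires both exponents below \<open>N\<close>.\<close>

lemma GDERIV_unique:
  fixes f :: "'a::euclidean_space \<Rightarrow> real"
  assumes "GDERIV f x :> D" "GDERIV f x :> E"
  shows "D = E"
proof -
  have "(\<lambda>h. h \<bullet> D) = (\<lambda>h. h \<bullet> E)"
    using assms has_derivative_unique unfolding gderiv_def by blast
  then show ?thesis
    by (metis inner_commute vector_eq_rdot)
qed

lemma grad_eq:
  fixes f :: "'a::euclidean_space \<Rightarrow> real"
  assumes "GDERIV f x :> D"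
  shows "grad f x = D"
  unfolding grad_def using assms GDERIV_unique by (blast intro: the_equality)

lemma differentiable_imp_GDERIV:
  fixes f :: "'a::euclidean_space \<Rightarrow> real"
  assumes "f differentiable (at x)"
  shows "GDERIV f x :> grad f x"
proof -
  obtain f' where f': "(f has_derivative f') (at x)"
    using assms differentiable_def by blast
  interpret f': bounded_linear f' using f' by (rule has_derivative_bounded_linear)
  have "f' h = h \<bullet> (\<Sum>b\<in>Basis. f' b *\<^sub>R b)" for h
  proof -
    have "f' h = f' (\<Sum>b\<in>Basis. (h \<bullet> b) *\<^sub>R b)" by (simp add: euclidean_representation)
    also have "\<dots> = (\<Sum>b\<in>Basis. (h \<bullet> b) * f' b)" by (simp add: f'.sum f'.scaleR)
    finally show ?thesis by (simp add: inner_sum_right mult.commute)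
  qed
  then have "GDERIV f x :> (\<Sum>b\<in>Basis. f' b *\<^sub>R b)"
    using f' unfolding gderiv_def by (metis (no_types, lifting) ext)
  then show ?thesis using grad_eq by metis
qed

lemma GDERIV_imp_differentiable: "GDERIV f x :> D \<Longrightarrow> f differentiable (at x)"
  unfolding gderiv_def differentiable_def by blast

lemma GDERIV_transform:
  fixes f :: "'a::euclidean_space \<Rightarrow> real"
  assumes "GDERIV f x :> D" "open S" "x \<in> S" "\<And>y. y \<in> S \<Longrightarrow> f y = g y"
  shows "GDERIV g x :> D"
  using assms has_derivative_transform_within_open unfolding gderiv_def by blast

lemma GDERIV_continuous: "GDERIV f x :> D \<Longrightarrow> isCont f x"
  unfolding gderiv_def by (rule has_derivative_continuous)

text \<open>Inductions on \<open>k\<close> can then work with an explicit derivative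
  \<open>D\<close> instead of the definite description behind \<open>grad\<close>.\<close>

lemma Ck_SucI:
  assumes "\<And>x. GDERIV f x :> D x" "\<And>b. b \<in> Basis \<Longrightarrow> Ck k (\<lambda>x. D x \<bullet> b)"
  shows "Ck (Suc k) f"
proof -
  have "grad f = D" using assms(1) grad_eq by blast
  then show ?thesis using assms GDERIV_imp_differentiable[OF assms(1)] by simp
qed

lemma Ck_SucD: "Ck (Suc k) f \<Longrightarrow> GDERIV f x :> grad f x"
  by (simp add: differentiable_imp_GDERIV)

lemma Ck_lower: "Ck (Suc k) f \<Longrightarrow> Ck k f"
proof (induction k arbitrary: f)
  case 0
  then show ?case
    by (auto intro!: continuous_at_imp_continuous_on differentiable_imp_continuous_within)
next
  case (Suc k)
  then show ?case by auto
qed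

lemma Ck_const: "Ck k (\<lambda>x. c)"
proof (induction k arbitrary: c)
  case (Suc k)
  show ?case by (rule Ck_SucI[where D="\<lambda>x. 0"]) (auto simp: GDERIV_const Suc.IH)
qed simp

lemma GDERIV_inner: "GDERIV (\<lambda>x. x \<bullet> v) x :> v"
  unfolding gderiv_def by (auto intro!: derivative_eq_intros)

lemma Ck_inner: "Ck k (\<lambda>x. x \<bullet> v)"
proof (cases k)
  case (Suc j)
  then show ?thesis using Ck_SucI[OF GDERIV_inner, of j v] by (simp add: Ck_const)
qed (auto intro!: continuous_intros)

lemma Ck_add: "Ck k f \<Longrightarrow> Ck k g \<Longrightarrow> Ck k (\<lambda>x. f x + g x)"
proof (induction k arbitrary: f g)
  case (Suc k)
  show ?case
    by (rule Ck_SucI[where D="\<lambda>x. grad f x + grad g x"])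
      (use Suc in \<open>auto simp: inner_add_left intro!: GDERIV_add Ck_SucD\<close>)
qed (auto intro!: continuous_intros)

lemma Ck_mult: "Ck k f \<Longrightarrow> Ck k g \<Longrightarrow> Ck k (\<lambda>x. f x * g x)"
proof (induction k arbitrary: f g)
  case (Suc k)
  show ?case
  proof (rule Ck_SucI[where D="\<lambda>x. f x *\<^sub>R grad g x + g x *\<^sub>R grad f x"])
    show "GDERIV (\<lambda>x. f x * g x) x :> f x *\<^sub>R grad g x + g x *\<^sub>R grad f x" for x
      using Suc.prems by (intro GDERIV_mult Ck_SucD)
    show "Ck k (\<lambda>x. (f x *\<^sub>R grad g x + g x *\<^sub>R grad f x) \<bullet> b)" if "b \<in> Basis" for b
      using Suc.IH Ck_lower[OF Suc.prems(1)] Ck_lower[OF Suc.prems(2)] Suc.prems that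
      by (auto simp: inner_add_left intro!: Ck_add)
  qed
qed (auto intro!: continuous_intros)

text \<open>Derivatives of the functions \<open>exp_cut k\<close> are linear combinations of functions of the same
  family; this makes \<open>exp_cut 0 (\<delta>\<^sup>2 - x \<bullet> x)\<close> a smooth bump.\<close>

definition exp_cut :: "nat \<Rightarrow> real \<Rightarrow> real" where
  "exp_cut k t = (if t > 0 then exp (- (1/t)) / t ^ k else 0)"

lemma exp_cut_nonneg: "exp_cut k t \<ge> 0"
  by (simp add: exp_cut_def)

text \<open>The term of index \<open>k + 2\<close> in the series of \<open>exp (1/t)\<close> bounds
  the exponential from below. The two surplus powers leave \<open>t^2\<close>, which makes the
  difference quotient at 0 tend to 0.\<close>

lemma exp_cut_le: "\<bar>exp_cut k t\<bar> \<le> fact (k + 2) * t\<^sup>2"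
proof (cases "t > 0")
  case True
  have "(1/t) ^ (k+2) / fact (k+2) \<le> exp (1/t)"
  proof -
    have "(\<Sum>n<k+3. (1/t)^n /\<^sub>R fact n) \<le> exp (1/t)"
      unfolding exp_def using summable_exp_generic[of "1/t"] True
      by (intro sum_le_suminf) (auto simp: scaleR_conv_of_real)
    moreover have "(1/t) ^ (k+2) /\<^sub>R fact (k+2) \<le> (\<Sum>n<k+3. (1/t)^n /\<^sub>R fact n)"
      by (rule member_le_sum) (use True in auto)
    ultimately show ?thesis by (simp add: divide_inverse mult.commute)
  qed
  then have "exp (-(1/t)) \<le> fact (k+2) * t^(k+2)"
    using True by (simp add: exp_minus field_simps power_divide del: fact_Suc)
  then show ?thesis
    using True by (simp add: exp_cut_def field_simps power_add power2_eq_square del: fact_Suc)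
qed (simp add: exp_cut_def)

lemma DERIV_exp_cut:
  "DERIV (exp_cut k) t :> exp_cut (k+2) t - real k * exp_cut (k+1) t"
proof -
  consider "t > 0" | "t < 0" | "t = 0" by linarith
  then show ?thesis
  proof cases
    case 1
    have "DERIV (\<lambda>t. exp (- (1/t)) / t ^ k) t :> exp_cut (k+2) t - real k * exp_cut (k+1) t"
      using 1 by (cases k) (auto intro!: derivative_eq_intros simp: exp_cut_def divide_simps
          power2_eq_square algebra_simps power_add, metis One_nat_def power_eq_if)
    then show ?thesis
      by (rule has_field_derivative_transform_within_open[of _ _ _ "{0<..}"])
        (use 1 in \<open>auto simp: exp_cut_def\<close>)
  next
    case 2
    have "DERIV (\<lambda>t. 0) t :> exp_cut (k+2) t - real k * exp_cut (k+1) t"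
      using 2 by (auto simp: exp_cut_def)
    then show ?thesis
      by (rule has_field_derivative_transform_within_open[of _ _ _ "{..<0}"])
        (use 2 in \<open>auto simp: exp_cut_def\<close>)
  next
    case 3
    let ?C = "fact (k + 2) :: real"
    have "(\<lambda>h. exp_cut k h / h) \<midarrow>0\<rightarrow> 0"
    proof (rule Lim_null_comparison)
      show "\<forall>\<^sub>F h in at 0. norm (exp_cut k h / h) \<le> ?C * \<bar>h\<bar>"
        unfolding eventually_at_filter
      proof (intro always_eventually allI impI)
        fix h :: real assume "h \<noteq> 0"
        then show "norm (exp_cut k h / h) \<le> ?C * \<bar>h\<bar>"
          using exp_cut_le[of k h] unfolding real_norm_def abs_divide
          by (subst divide_le_eq) (auto simp: power2_eq_square abs_mult_self_eq mult.assoc simp del: fact_Suc)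
      qed
      show "((\<lambda>h. ?C * \<bar>h\<bar>) \<longlongrightarrow> 0) (at 0)"
        by (rule tendsto_eq_intros | simp)+
    qed
    then show ?thesis
      using 3 by (simp add: DERIV_def exp_cut_def)
  qed
qed

lemma Ck_exp_cut: "Ck n (\<lambda>x::'a::euclidean_space. exp_cut k (c - x \<bullet> x))"
proof (induction n arbitrary: k)
  case 0
  have "isCont (exp_cut k) t" for t
    using DERIV_exp_cut DERIV_isCont by blast
  then have "continuous_on UNIV (exp_cut k)"
    by (simp add: continuous_at_imp_continuous_on)
  then show ?case
    by (auto intro!: continuous_intros continuous_on_compose2[of UNIV "exp_cut k"])
next
  case (Suc n)
  let ?D = "\<lambda>x::'a. (exp_cut (k+2) (c - x \<bullet> x) - real k * exp_cut (k+1) (c - x \<bullet> x)) *\<^sub>R (-2 *\<^sub>R x)"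
  have *: "GDERIV (\<lambda>x::'a. c - x \<bullet> x) x :> -2 *\<^sub>R x" for x
    unfolding gderiv_def by (auto intro!: derivative_eq_intros simp: inner_commute)
  have **: "Ck n (\<lambda>x. ?D x \<bullet> b)" for b
  proof -
    have "(\<lambda>x. ?D x \<bullet> b) = (\<lambda>x. (exp_cut (k+2) (c - x \<bullet> x) + - real k * exp_cut (k+1) (c - x \<bullet> x))
        * (-2 * (x \<bullet> b)))"
      by (auto simp: algebra_simps)
    moreover have "Ck n \<dots>"
      by (intro Ck_mult Ck_add Ck_const Ck_inner Suc.IH)
    ultimately show ?thesis by (simp only:)
  qed
  show ?case
    by (rule Ck_SucI[OF GDERIV_DERIV_compose[OF * DERIV_exp_cut] **])
qed

section \<open>Smooth functions and C^1 functions with compact support\<close>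

definition smooth :: "('a::euclidean_space \<Rightarrow> real) \<Rightarrow> bool" where
  "smooth f \<longleftrightarrow> (\<forall>k. Ck k f)"

lemma smooth_continuous: "smooth f \<Longrightarrow> continuous_on UNIV f"
  unfolding smooth_def using Ck.simps(1) by blast

lemma smooth_GDERIV: "smooth f \<Longrightarrow> GDERIV f x :> grad f x"
  unfolding smooth_def using Ck_SucD by blast

lemma smooth_grad: "smooth f \<Longrightarrow> b \<in> Basis \<Longrightarrow> smooth (\<lambda>x. grad f x \<bullet> b)"
  unfolding smooth_def using Ck.simps(2) by blast

lemma smooth_grad_continuous:
  assumes "smooth f" shows "continuous_on UNIV (grad f)"
proof -
  have "continuous_on UNIV (\<lambda>x. \<Sum>b\<in>Basis. (grad f x \<bullet> b) *\<^sub>R b)"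
    using smooth_grad[OF assms] by (intro continuous_intros smooth_continuous)
  then show ?thesis by (simp add: euclidean_representation)
qed

text \<open>The gradient is an argument, so that products and truncations, which are only C^1, can
  serve as test functions together with an explicit formula for their gradient.\<close>

definition C1c :: "'a::euclidean_space set \<Rightarrow> ('a \<Rightarrow> real) \<Rightarrow> ('a \<Rightarrow> 'a) \<Rightarrow> bool" where
  "C1c K \<phi> D \<longleftrightarrow> compact K \<and> (\<forall>x. GDERIV \<phi> x :> D x) \<and> continuous_on UNIV D \<and>
     (\<forall>x. x \<notin> K \<longrightarrow> \<phi> x = 0)"

lemma C1cD:
  assumes "C1c K \<phi> D"
  shows "compact K" "GDERIV \<phi> x :> D x" "continuous_on UNIV D" "continuous_on UNIV \<phi>"
    "x \<notin> K \<Longrightarrow> \<phi> x = 0" "x \<notin> K \<Longrightarrow> D x = 0" "grad \<phi> = D"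
proof -
  have D: "GDERIV \<phi> x :> D x" for x using assms by (simp add: C1c_def)
  then show "GDERIV \<phi> x :> D x" .
  show "grad \<phi> = D" by (rule ext) (rule grad_eq[OF D])
  show "compact K" "continuous_on UNIV D" "x \<notin> K \<Longrightarrow> \<phi> x = 0"
    using assms by (simp_all add: C1c_def)
  show "continuous_on UNIV \<phi>"
    by (intro continuous_at_imp_continuous_on ballI) (rule GDERIV_continuous[OF D])
  assume x: "x \<notin> K"
  have "open (- K)" "\<And>y. y \<in> - K \<Longrightarrow> \<phi> y = 0"
    using assms by (auto simp: C1c_def compact_imp_closed open_Compl)
  with D[of x] x have "GDERIV (\<lambda>x. 0) x :> D x"
    by (metis GDERIV_transform ComplI)
  then show "D x = 0" by (rule GDERIV_unique[OF _ GDERIV_const])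
qed

lemma smooth_C1c:
  assumes "smooth \<phi>" "compact K" "\<And>x. x \<notin> K \<Longrightarrow> \<phi> x = 0"
  shows "C1c K \<phi> (grad \<phi>)"
  using assms smooth_GDERIV smooth_grad_continuous unfolding C1c_def by blast

lemma test_functionI:
  assumes "smooth \<phi>" "compact K" "K \<subseteq> \<Omega>" "\<And>x. x \<notin> K \<Longrightarrow> \<phi> x = 0"
  shows "\<phi> \<in> test_functions \<Omega>"
proof -
  have "closure (support_on UNIV \<phi>) \<subseteq> K"
    using assms compact_imp_closed by (intro closure_minimal) (auto simp: support_on_def)
  then show ?thesis
    using assms unfolding test_functions_def smooth_def
    by (auto simp: compact_eq_bounded_closed intro: bounded_subset)
qed

lemma test_functionD:
  assumes "\<phi> \<in> test_functions \<Omega>"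
  obtains K where "smooth \<phi>" "compact K" "K \<subseteq> \<Omega>" "C1c K \<phi> (grad \<phi>)"
proof
  let ?K = "closure (support_on UNIV \<phi>)"
  show *: "smooth \<phi>" "compact ?K" "?K \<subseteq> \<Omega>"
    using assms unfolding test_functions_def smooth_def by auto
  have "\<phi> x = 0" if "x \<notin> ?K" for x
    using that closure_subset[of "support_on UNIV \<phi>"] by (auto simp: support_on_def)
  then show "C1c ?K \<phi> (grad \<phi>)" using * smooth_C1c by blast
qed

lemma continuous_compact_support_bounded:
  fixes f :: "'a::euclidean_space \<Rightarrow> 'b::real_normed_vector"
  assumes "continuous_on UNIV f" "compact K" "\<And>x. x \<notin> K \<Longrightarrow> f x = 0"
  obtains B where "B > 0" "\<And>x. norm (f x) \<le> B"
proof -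
  have "bounded (f ` K)"
    by (intro compact_imp_bounded compact_continuous_image assms continuous_on_subset[OF assms(1)] subset_UNIV)
  then obtain B where "B > 0" "\<And>x. x \<in> K \<Longrightarrow> norm (f x) \<le> B"
    unfolding bounded_pos by auto
  then have "norm (f x) \<le> B" for x
    using assms(3)[of x] by (cases "x \<in> K") auto
  then show ?thesis by (rule that[OF \<open>B > 0\<close>])
qed

lemma continuous_compact_support_uniform:
  fixes f :: "'a::euclidean_space \<Rightarrow> 'b::real_normed_vector"
  assumes "continuous_on UNIV f" "compact K" "\<And>x. x \<notin> K \<Longrightarrow> f x = 0"
  shows "uniformly_continuous_on UNIV f"
proof -
  obtain r where r: "r > 0" "K \<subseteq> cball 0 r"
    using bounded_subset_ballD[OF compact_imp_bounded[OF assms(2)], of 0] ball_subset_cball by (meson order_trans)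
  have u: "uniformly_continuous_on (cball 0 (r+1)) f"
    using assms by (intro compact_uniformly_continuous) (auto intro: continuous_on_subset)
  show ?thesis
    unfolding uniformly_continuous_on_def
  proof safe
    fix e :: real assume "e > 0"
    then obtain d where d: "d > 0" "\<And>x y. x \<in> cball 0 (r+1) \<Longrightarrow> y \<in> cball 0 (r+1) \<Longrightarrow> dist y x < d \<Longrightarrow> dist (f y) (f x) < e"
      using u unfolding uniformly_continuous_on_def by metis
    \<comment> \<open>The bound 1 on the distance puts both points in the ball of radius
      \<open>r + 1\<close> as soon as one of them lies in \<open>K\<close>.\<close>
    show "\<exists>d>0. \<forall>x\<in>UNIV. \<forall>x'\<in>UNIV. dist x' x < d \<longrightarrow> dist (f x') (f x) < e"
    proof (intro exI[of _ "min d 1"] conjI ballI impI)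
      fix x x' :: 'a assume *: "dist x' x < min d 1"
      show "dist (f x') (f x) < e"
      proof (cases "x \<in> K \<or> x' \<in> K")
        case True
        then have "norm x \<le> r \<or> norm x' \<le> r" using r by auto
        then have "norm x \<le> r+1" "norm x' \<le> r+1"
          using * norm_triangle_sub[of x x'] norm_triangle_sub[of x' x] by (auto simp: dist_norm norm_minus_commute)
        then show ?thesis using d(2)[of x x'] * by (auto simp: dist_commute)
      next
        case False
        then show ?thesis using assms(3) \<open>e > 0\<close> by simp
      qed
    qed (use d in auto)
  qed
qed

lemma continuous_compact_support_integrable:
  fixes f :: "'a::euclidean_space \<Rightarrow> 'b::euclidean_space"
  assumes "continuous_on UNIV f" "compact K" "\<And>x. x \<notin> K \<Longrightarrow> f x = 0"
  shows "integrable lborel f"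
proof -
  have "integrable lborel (\<lambda>x. indicator K x *\<^sub>R f x)"
    using assms continuous_on_subset by (intro borel_integrable_compact) blast+
  moreover have "(\<lambda>x. indicator K x *\<^sub>R f x) = f" using assms(3) by (auto simp: indicator_def)
  ultimately show ?thesis by simp
qed

section \<open>Invariance of Lebesgue measure under reflections and translations\<close>

lemma lborel_reflect_distr: "distr lborel borel (\<lambda>y. x - y) = (lborel :: 'a::euclidean_space measure)"
proof -
  have "(lborel :: 'a measure) = density (distr lborel borel (\<lambda>y. x + (-1) *\<^sub>R y)) (\<lambda>_. \<bar>-1::real\<bar>^DIM('a))"
    by (rule lborel_affine) simp
  then show ?thesis by (simp add: density_1)
qed

lemma lborel_translate_distr: "distr lborel borel (\<lambda>y. x + y) = (lborel :: 'a::euclidean_space measure)"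
proof -
  have "(lborel :: 'a measure) = density (distr lborel borel (\<lambda>y. x + 1 *\<^sub>R y)) (\<lambda>_. \<bar>1::real\<bar>^DIM('a))"
    by (rule lborel_affine) simp
  then show ?thesis by (simp add: density_1)
qed

lemma
  fixes f :: "'a::euclidean_space \<Rightarrow> 'b::{banach,second_countable_topology}"
  assumes [measurable]: "f \<in> borel_measurable borel"
  shows lborel_integral_reflect: "(\<integral>y. f (x - y) \<partial>lborel) = (\<integral>y. f y \<partial>lborel)"
    and lborel_integrable_reflect: "integrable lborel (\<lambda>y. f (x - y)) \<longleftrightarrow> integrable lborel f"
  using integral_distr[of "\<lambda>y. x - y" lborel borel f] integrable_distr_eq[of "\<lambda>y. x - y" lborel borel f]
  by (simp_all add: lborel_reflect_distr)

lemma
  fixes f :: "'a::euclidean_space \<Rightarrow> ennreal"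
  assumes [measurable]: "f \<in> borel_measurable borel"
  shows lborel_nn_integral_reflect: "(\<integral>\<^sup>+y. f (x - y) \<partial>lborel) = (\<integral>\<^sup>+y. f y \<partial>lborel)"
    and lborel_nn_integral_translate: "(\<integral>\<^sup>+y. f (x + y) \<partial>lborel) = (\<integral>\<^sup>+y. f y \<partial>lborel)"
  using nn_integral_distr[of "\<lambda>y. x - y" lborel borel f] nn_integral_distr[of "\<lambda>y. x + y" lborel borel f]
  by (simp_all add: lborel_reflect_distr lborel_translate_distr)

section \<open>Differentiation of convolutions\<close>

lemma GDERIV_mvt:
  fixes \<phi> :: "'a::euclidean_space \<Rightarrow> real"
  assumes "\<And>x. GDERIV \<phi> x :> D x"
  obtains t where "0 \<le> t" "t \<le> 1" "\<phi> (z + h) - \<phi> z = h \<bullet> D (z + t *\<^sub>R h)"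
proof -
  have "DERIV (\<lambda>t. \<phi> (z + t *\<^sub>R h)) t :> h \<bullet> D (z + t *\<^sub>R h)" for t
  proof -
    have "((\<lambda>t. z + t *\<^sub>R h) has_derivative (\<lambda>s. s *\<^sub>R h)) (at t)"
      by (auto intro!: derivative_eq_intros)
    then have "((\<lambda>t. \<phi> (z + t *\<^sub>R h)) has_derivative (\<lambda>s. s *\<^sub>R h \<bullet> D (z + t *\<^sub>R h))) (at t)"
      using assms[of "z + t *\<^sub>R h"] unfolding gderiv_def
      by (rule has_derivative_compose)
    then show ?thesis by (simp add: has_field_derivative_def mult.commute[of _ "h \<bullet> _"])
  qed
  then obtain t where "0 < t" "t < 1" "\<phi> (z + 1 *\<^sub>R h) - \<phi> (z + 0 *\<^sub>R h) = (1 - 0) * (h \<bullet> D (z + t *\<^sub>R h))"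
    using MVT2[of 0 1 "\<lambda>t. \<phi> (z + t *\<^sub>R h)" "\<lambda>t. h \<bullet> D (z + t *\<^sub>R h)"] by auto
  then show ?thesis using that[of t] by auto
qed

text \<open>The convolution of \<open>f\<close> with a scalar kernel. Vector values of
  \<open>f\<close> allow one operator to mollify both a function and its weak gradient.\<close>

definition cv :: "('a::euclidean_space \<Rightarrow> 'b::euclidean_space) \<Rightarrow> ('a \<Rightarrow> real) \<Rightarrow> 'a \<Rightarrow> 'b" where
  "cv f \<phi> x = (\<integral>y. \<phi> (x - y) *\<^sub>R f y \<partial>lborel)"

lemma integrable_bounded_mult:
  fixes f :: "'a \<Rightarrow> 'b::euclidean_space" and c :: "'a \<Rightarrow> real"
  assumes "integrable M f" "c \<in> borel_measurable M" "\<And>x. \<bar>c x\<bar> \<le> B"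
  shows "integrable M (\<lambda>x. c x *\<^sub>R f x)"
proof (rule Bochner_Integration.integrable_bound[of M "\<lambda>x. B *\<^sub>R f x"])
  show "AE x in M. norm (c x *\<^sub>R f x) \<le> norm (B *\<^sub>R f x)"
  proof (intro AE_I2)
    fix x
    have "\<bar>c x\<bar> \<le> \<bar>B\<bar>" using assms(3)[of x] by simp
    then show "norm (c x *\<^sub>R f x) \<le> norm (B *\<^sub>R f x)" by (simp add: mult_right_mono)
  qed
qed (use assms in auto)

lemma integrable_bounded_mult':
  fixes f :: "'a \<Rightarrow> real" and c :: "'a \<Rightarrow> 'b::euclidean_space"
  assumes "integrable M f" "c \<in> borel_measurable M" "\<And>x. norm (c x) \<le> B"
  shows "integrable M (\<lambda>x. f x *\<^sub>R c x)"
proof (rule Bochner_Integration.integrable_bound[of M "\<lambda>x. B * f x"])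
  show "AE x in M. norm (f x *\<^sub>R c x) \<le> norm (B * f x)"
  proof (intro AE_I2)
    fix x
    have "norm (c x) \<le> \<bar>B\<bar>" using assms(3)[of x] by simp
    then show "norm (f x *\<^sub>R c x) \<le> norm (B * f x)"
      by (simp add: abs_mult mult.commute[of "\<bar>B\<bar>"] mult_left_mono)
  qed
qed (use assms in auto)

text \<open>The derivative falls on the kernel. By the mean value theorem and uniform continuity of
  \<open>D\<close>, the first-order remainder of the kernel is at most \<open>e' * norm h\<close>
  for all arguments at once; integrating this against an integrable \<open>f\<close>
  finishes.\<close>

lemma cv_GDERIV:
  fixes f :: "'a::euclidean_space \<Rightarrow> real"
  assumes f: "integrable lborel f" and \<phi>: "C1c K \<phi> D"
  shows "GDERIV (cv f \<phi>) x :> (\<integral>y. f y *\<^sub>R D (x - y) \<partial>lborel)"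
proof -
  have D[measurable]: "D \<in> borel_measurable borel" and [measurable]: "\<phi> \<in> borel_measurable borel"
    using C1cD[OF \<phi>] borel_measurable_continuous_onI by blast+
  have [measurable]: "f \<in> borel_measurable borel" using f by auto
  obtain B where B: "\<And>x. norm (D x) \<le> B"
    using continuous_compact_support_bounded[OF C1cD(3,1,6)[OF \<phi>]] by metis
  obtain C where C: "\<And>x. norm (\<phi> x) \<le> C"
    using continuous_compact_support_bounded[OF C1cD(4,1,5)[OF \<phi>]] by metis
  have i1: "integrable lborel (\<lambda>y. \<phi> (x - y) *\<^sub>R f y)" for x
    by (rule integrable_bounded_mult[OF f _, of _ C]) (use C in auto)
  have i2: "integrable lborel (\<lambda>y. f y *\<^sub>R D (x - y))"
    by (rule integrable_bounded_mult'[OF f _ B]) simp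
  have i3: "integrable lborel (\<lambda>y. f y * (h \<bullet> D (x - y)))" for h
    using integrable_inner_right[OF i2, of h] by simp
  let ?I = "\<integral>y. f y *\<^sub>R D (x - y) \<partial>lborel"
  define M where "M = (\<integral>y. \<bar>f y\<bar> \<partial>lborel)"
  have M0: "M \<ge> 0" unfolding M_def by simp
  have uc: "uniformly_continuous_on UNIV D"
    using continuous_compact_support_uniform[OF C1cD(3,1,6)[OF \<phi>]] .
  show ?thesis
    unfolding gderiv_def has_derivative_at2
  proof (intro conjI)
    show "bounded_linear (\<lambda>h. h \<bullet> ?I)" by (rule bounded_linear_inner_left)
    show "((\<lambda>y. (1 / norm (y - x)) *\<^sub>R (cv f \<phi> y - (cv f \<phi> x + (y - x) \<bullet> ?I))) \<longlongrightarrow> 0) (at x)"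
    proof (rule LIM_I)
      fix e :: real assume "e > 0"
      define e' where "e' = e / (M + 1)"
      have e': "e' > 0" "e' * M < e" using \<open>e > 0\<close> M0 by (auto simp: e'_def field_simps)
      obtain d where d: "d > 0" "\<And>x y. dist x y < d \<Longrightarrow> dist (D x) (D y) < e'"
        using uc e' unfolding uniformly_continuous_on_def by (metis UNIV_I dist_commute)
      show "\<exists>s>0. \<forall>y. y \<noteq> x \<and> norm (y - x) < s \<longrightarrow>
          norm ((1 / norm (y - x)) *\<^sub>R (cv f \<phi> y - (cv f \<phi> x + (y - x) \<bullet> ?I)) - 0) < e"
      proof (intro exI[of _ d] conjI allI impI)
        fix y assume y: "y \<noteq> x \<and> norm (y - x) < d"
        define h where "h = y - x"
        have h: "h \<noteq> 0" "norm h < d" using y by (auto simp: h_def)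
        have key: "\<bar>\<phi> (y - w) - \<phi> (x - w) - h \<bullet> D (x - w)\<bar> \<le> e' * norm h" for w
        proof -
          obtain t where t: "0 \<le> t" "t \<le> 1" "\<phi> (x - w + h) - \<phi> (x - w) = h \<bullet> D (x - w + t *\<^sub>R h)"
            using GDERIV_mvt[OF C1cD(2)[OF \<phi>]] by metis
          have "dist (x - w + t *\<^sub>R h) (x - w) < d"
          proof -
            have "t * norm h \<le> 1 * norm h" by (rule mult_right_mono) (use t in auto)
            also have "\<dots> < d" using h by simp
            finally show ?thesis using t by (simp add: dist_norm)
          qed
          then have "norm (D (x - w + t *\<^sub>R h) - D (x - w)) \<le> e'" using d(2) by (fastforce simp: dist_norm)
          moreover have "\<phi> (y - w) - \<phi> (x - w) - h \<bullet> D (x - w) = h \<bullet> (D (x - w + t *\<^sub>R h) - D (x - w))"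
            using t(3) by (simp add: h_def inner_diff_right algebra_simps)
          ultimately show ?thesis
            using Cauchy_Schwarz_ineq2[of h "D (x - w + t *\<^sub>R h) - D (x - w)"]
            by (smt (verit) mult.commute mult_left_mono norm_ge_zero)
        qed
        have "cv f \<phi> y - (cv f \<phi> x + (y - x) \<bullet> ?I) =
            (\<integral>w. (\<phi> (y - w) - \<phi> (x - w) - h \<bullet> D (x - w)) * f w \<partial>lborel)"
        proof -
          have "(y - x) \<bullet> ?I = (\<integral>w. f w * (h \<bullet> D (x - w)) \<partial>lborel)"
            using integral_inner_right[OF i2, of "y - x"] by (simp add: h_def)
          then show ?thesis
            unfolding cv_def using i1[of x] i1[of y] i3[of h]
            by (simp add: algebra_simps Bochner_Integration.integral_add Bochner_Integration.integral_diff
                flip: Bochner_Integration.integral_add Bochner_Integration.integral_diff)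
        qed
        also have "norm \<dots> \<le> (\<integral>w. (e' * norm h) * \<bar>f w\<bar> \<partial>lborel)"
        proof (rule Bochner_Integration.integral_norm_bound_integral)
          show "integrable lborel (\<lambda>w. (\<phi> (y - w) - \<phi> (x - w) - h \<bullet> D (x - w)) * f w)"
            using i1[of y] i1[of x] i3[of h] by (simp add: algebra_simps)
          show "integrable lborel (\<lambda>w. e' * norm h * \<bar>f w\<bar>)" using f by auto
          show "norm ((\<phi> (y - w) - \<phi> (x - w) - h \<bullet> D (x - w)) * f w) \<le> e' * norm h * \<bar>f w\<bar>" for w
            using key[of w] by (simp add: abs_mult mult_right_mono)
        qed
        also have "\<dots> = (e' * M) * norm h" by (simp add: M_def)
        also have "\<dots> < e * norm h" using e' h by simp
        finally show "norm ((1 / norm (y - x)) *\<^sub>R (cv f \<phi> y - (cv f \<phi> x + (y - x) \<bullet> ?I)) - 0) < e"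
          using h by (simp add: h_def[symmetric] field_simps)
      qed (use d in auto)
    qed
  qed
qed

lemma cv_commute:
  fixes f :: "'a::euclidean_space \<Rightarrow> real"
  assumes [measurable]: "f \<in> borel_measurable borel" "\<phi> \<in> borel_measurable borel"
  shows "cv f \<phi> x = cv \<phi> f x"
  using lborel_integral_reflect[of "\<lambda>y. \<phi> y * f (x - y)" x] by (simp add: cv_def mult.commute)

text \<open>Partial derivatives of the convolution are convolutions with the partial derivatives of
  the kernel, hence the induction generalises over the kernel.\<close>

lemma cv_smooth:
  fixes f :: "'a::euclidean_space \<Rightarrow> real"
  assumes f: "integrable lborel f" and K: "compact K"
    and \<eta>: "smooth \<eta>" "\<And>x. x \<notin> K \<Longrightarrow> \<eta> x = 0"
  shows "smooth (cv f \<eta>)"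
proof -
  have "Ck k (cv f \<eta>)" for k
    using \<eta>
  proof (induction k arbitrary: \<eta>)
    case 0
    have "C1c K \<eta> (grad \<eta>)" using 0 K smooth_C1c by blast
    from cv_GDERIV[OF f this] show ?case
      unfolding Ck.simps by (intro continuous_at_imp_continuous_on ballI) (rule GDERIV_continuous)
  next
    case (Suc k)
    have c: "C1c K \<eta> (grad \<eta>)" using Suc K smooth_C1c by blast
    show ?case
    proof (rule Ck_SucI[OF cv_GDERIV[OF f c]])
      fix b :: 'a assume b: "b \<in> Basis"
      obtain B where B: "\<And>x. norm (grad \<eta> x) \<le> B"
        using continuous_compact_support_bounded[OF C1cD(3,1,6)[OF c]] by metis
      have [measurable]: "grad \<eta> \<in> borel_measurable borel"
        using C1cD(3)[OF c] borel_measurable_continuous_onI by blast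
      have i: "integrable lborel (\<lambda>y. f y *\<^sub>R grad \<eta> (x - y))" for x
        by (rule integrable_bounded_mult'[OF f _ B]) simp
      have "(\<lambda>x. (\<integral>y. f y *\<^sub>R grad \<eta> (x - y) \<partial>lborel) \<bullet> b) = cv f (\<lambda>y. grad \<eta> y \<bullet> b)"
      proof
        fix x
        show "(\<integral>y. f y *\<^sub>R grad \<eta> (x - y) \<partial>lborel) \<bullet> b = cv f (\<lambda>y. grad \<eta> y \<bullet> b) x"
          using integral_inner_left[OF i[of x], of b] by (simp add: cv_def mult.commute)
      qed
      then show "Ck k (\<lambda>x. (\<integral>y. f y *\<^sub>R grad \<eta> (x - y) \<partial>lborel) \<bullet> b)"
        using Suc.IH[of "\<lambda>y. grad \<eta> y \<bullet> b"] smooth_grad[OF Suc.prems(1) b] C1cD(6)[OF c] by simp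
    qed
  qed
  then show ?thesis by (simp add: smooth_def)
qed

text \<open>Convolving with the indicator of a large ball gives a function that is constant near the
  origin, so its gradient vanishes there.\<close>

lemma integral_grad_C1c:
  assumes "C1c K \<phi> D"
  shows "(\<integral>y. D y \<partial>lborel) = 0"
proof -
  note C = C1cD[OF assms]
  have [measurable]: "D \<in> borel_measurable borel" "\<phi> \<in> borel_measurable borel"
    using C(3,4) borel_measurable_continuous_onI by blast+
  obtain r where r: "r > 0" "K \<subseteq> ball 0 r"
    using bounded_subset_ballD[OF compact_imp_bounded[OF C(1)], of 0] by auto
  define f where "f = (indicator (ball 0 (r+1)) :: 'a \<Rightarrow> real)"
  have f: "integrable lborel f"
    unfolding f_def using emeasure_lborel_ball_finite by (intro integrable_real_indicator) auto
  have eq: "\<phi> (x - y) * f y = \<phi> (x - y)" "f y *\<^sub>R D (x - y) = D (x - y)" if "norm x < 1" for x y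
  proof -
    have "y \<in> ball 0 (r+1)" if "x - y \<in> K"
      using that r \<open>norm x < 1\<close> norm_triangle_ineq4[of x "x - y"] by fastforce
    then show "\<phi> (x - y) * f y = \<phi> (x - y)" "f y *\<^sub>R D (x - y) = D (x - y)"
      using C(5,6) by (auto simp: f_def indicator_def)
  qed
  have "GDERIV (cv f \<phi>) 0 :> (\<integral>y. f y *\<^sub>R D (0 - y) \<partial>lborel)"
    by (rule cv_GDERIV[OF f assms])
  moreover have "(\<integral>y. f y *\<^sub>R D (0 - y) \<partial>lborel) = (\<integral>y. D y \<partial>lborel)"
    using eq(2)[of 0] lborel_integral_reflect[of D 0] by simp
  moreover have "GDERIV (cv f \<phi>) 0 :> 0"
  proof (rule GDERIV_transform[OF GDERIV_const])
    show "(\<integral>y. \<phi> y \<partial>lborel) = cv f \<phi> x" if "x \<in> ball 0 1" for x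
    proof -
      have "norm x < 1" using that by simp
      then show ?thesis
        unfolding cv_def real_scaleR_def eq(1)[OF \<open>norm x < 1\<close>]
        using lborel_integral_reflect[of \<phi> x] by simp
    qed
  qed auto
  ultimately show ?thesis using GDERIV_unique by metis
qed

text \<open>The set where \<open>f\<close> is nonzero is open and negligible, and a nonempty open
  set is not negligible.\<close>

lemma continuous_nonneg_integral_0:
  fixes f :: "'a::euclidean_space \<Rightarrow> real"
  assumes "continuous_on UNIV f" "\<And>x. f x \<ge> 0" "integrable lborel f" "integral\<^sup>L lborel f = 0"
  shows "f x = 0"
proof -
  have "AE x in lborel. f x = 0"
    using integral_nonneg_eq_0_iff_AE[OF assms(3)] assms(2,4) by auto
  then have "AE x in lebesgue. f x = 0"
    by (rule AE_completion)
  then have "negligible {x. f x \<noteq> 0}"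
    by (simp add: negligible_iff_null_sets completion.AE_iff_null_sets)
  moreover have "open {x. f x \<noteq> 0}"
    using assms(1) by (intro open_Collect_neq) auto
  ultimately show ?thesis using open_not_negligible by blast
qed

section \<open>Mollifiers and integration by parts\<close>

definition mollifier :: "real \<Rightarrow> ('a::euclidean_space \<Rightarrow> real) \<Rightarrow> bool" where
  "mollifier \<delta> \<eta> \<longleftrightarrow> smooth \<eta> \<and> (\<forall>x. \<eta> x \<ge> 0) \<and> (\<forall>x. x \<notin> cball 0 \<delta> \<longrightarrow> \<eta> x = 0)
     \<and> integral\<^sup>L lborel \<eta> = 1"

lemma mollifierD:
  assumes "mollifier \<delta> \<eta>"
  shows "smooth \<eta>" "\<eta> x \<ge> 0" "x \<notin> cball 0 \<delta> \<Longrightarrow> \<eta> x = 0" "norm x > \<delta> \<Longrightarrow> \<eta> x = 0"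
    "integral\<^sup>L lborel \<eta> = 1" "integrable lborel \<eta>"
    "C1c (cball 0 \<delta>) \<eta> (grad \<eta>)" "\<eta> \<in> borel_measurable borel" "continuous_on UNIV \<eta>"
proof -
  show *: "smooth \<eta>" "\<eta> x \<ge> 0" "x \<notin> cball 0 \<delta> \<Longrightarrow> \<eta> x = 0" "norm x > \<delta> \<Longrightarrow> \<eta> x = 0"
    "integral\<^sup>L lborel \<eta> = 1"
    using assms unfolding mollifier_def by auto
  show C: "C1c (cball 0 \<delta>) \<eta> (grad \<eta>)"
    using assms unfolding mollifier_def by (intro smooth_C1c) auto
  show "integrable lborel \<eta>"
    using continuous_compact_support_integrable[OF C1cD(4,1,5)[OF C]] .
  show "continuous_on UNIV \<eta>" using C1cD(4)[OF C] .
  then show "\<eta> \<in> borel_measurable borel" by (rule borel_measurable_continuous_onI)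
qed

lemma mollifier_exists:
  assumes "\<delta> > 0"
  obtains \<eta> :: "'a::euclidean_space \<Rightarrow> real" where "mollifier \<delta> \<eta>"
proof -
  define f where "f = (\<lambda>x::'a. exp_cut 0 (\<delta>\<^sup>2 - x \<bullet> x))"
  have f: "smooth f" unfolding smooth_def f_def using Ck_exp_cut by blast
  have f0: "f x \<ge> 0" for x by (simp add: f_def exp_cut_nonneg)
  have f1: "f x = 0" if "x \<notin> cball 0 \<delta>" for x
  proof -
    have "\<delta>\<^sup>2 \<le> (norm x)\<^sup>2" using that assms by (intro power_mono) auto
    then show ?thesis by (simp add: f_def exp_cut_def dot_square_norm)
  qed
  have C: "C1c (cball 0 \<delta>) f (grad f)"
    using f f1 by (intro smooth_C1c) auto
  have i: "integrable lborel f"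
    using continuous_compact_support_integrable[OF C1cD(4,1,5)[OF C]] .
  have "f 0 \<noteq> 0" using assms by (simp add: f_def exp_cut_def)
  then have "integral\<^sup>L lborel f \<noteq> 0"
    using continuous_nonneg_integral_0[OF C1cD(4)[OF C] f0 i] by blast
  moreover have "integral\<^sup>L lborel f \<ge> 0" using f0 by simp
  ultimately have Z: "integral\<^sup>L lborel f > 0" by linarith
  have "mollifier \<delta> (\<lambda>x. (1 / integral\<^sup>L lborel f) * f x)"
    unfolding mollifier_def
  proof (intro conjI allI impI)
    show "smooth (\<lambda>x. (1 / integral\<^sup>L lborel f) * f x)"
      using f unfolding smooth_def by (intro allI Ck_mult Ck_const) blast
  qed (use f0 f1 Z i in auto)
  then show ?thesis using that by blast
qed

text \<open>\<open>\<Omega>\<close> and the complement of \<open>K\<close> are open and cover the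
  space. On their overlap the function is locally zero, which also forces \<open>D\<close> to vanish
  there, so the two local formulas fit together.\<close>

lemma C1c_extend:
  assumes "compact K" "open \<Omega>" "K \<subseteq> \<Omega>" "\<And>x. x \<in> \<Omega> \<Longrightarrow> GDERIV f x :> D x"
    "continuous_on \<Omega> D" "\<And>x. x \<in> \<Omega> \<Longrightarrow> x \<notin> K \<Longrightarrow> f x = 0"
  shows "C1c K (\<lambda>x. if x \<in> \<Omega> then f x else 0) (\<lambda>x. if x \<in> \<Omega> then D x else 0)"
proof -
  let ?f = "\<lambda>x. if x \<in> \<Omega> then f x else 0" and ?D = "\<lambda>x. if x \<in> \<Omega> then D x else 0"
  have op: "open (- K)" using assms(1) compact_imp_closed open_Compl by blast
  have f0: "?f x = 0" if "x \<in> - K" for x using assms(6) that by auto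
  have out: "GDERIV ?f x :> 0" if "x \<in> - K" for x
    using GDERIV_transform[OF GDERIV_const[of 0 x] op that, of ?f] f0 by simp
  have "\<And>x. x \<in> \<Omega> \<Longrightarrow> GDERIV ?f x :> D x"
    by (rule GDERIV_transform[OF assms(4) assms(2)]) auto
  then have der: "GDERIV ?f x :> ?D x" for x
    using out[of x] assms(3) by auto
  have D0: "?D x = 0" if "x \<in> - K" for x
    by (rule GDERIV_unique[OF der out[OF that]])
  have "continuous_on (\<Omega> \<union> - K) ?D"
  proof (rule continuous_on_open_Un)
    show "continuous_on \<Omega> ?D" using assms(5) by (simp cong: continuous_on_cong)
    show "continuous_on (- K) ?D"
      by (rule continuous_on_eq[OF continuous_on_const[of _ 0]]) (simp only: D0)
  qed (use assms(2) op in auto)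
  moreover have "\<Omega> \<union> - K = UNIV" using assms(3) by auto
  ultimately show ?thesis using assms(1) der f0 unfolding C1c_def by auto
qed

text \<open>Combined with \<open>integral_grad_C1c\<close> this yields integration by parts without
  boundary terms.\<close>

lemma C1c_prod:
  assumes "C1c K \<phi> D" "open \<Omega>" "K \<subseteq> \<Omega>" "\<And>x. x \<in> \<Omega> \<Longrightarrow> GDERIV f x :> E x" "continuous_on \<Omega> E"
  shows "C1c K (\<lambda>x. if x \<in> \<Omega> then f x * \<phi> x else 0)
      (\<lambda>x. if x \<in> \<Omega> then f x *\<^sub>R D x + \<phi> x *\<^sub>R E x else 0)"
proof -
  note C = C1cD[OF assms(1)]
  have f: "continuous_on \<Omega> f"
    using assms(4) GDERIV_continuous by (blast intro: continuous_at_imp_continuous_on)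
  show ?thesis
  proof (rule C1c_extend[OF C(1) assms(2,3)])
    show "GDERIV (\<lambda>x. f x * \<phi> x) x :> f x *\<^sub>R D x + \<phi> x *\<^sub>R E x" if "x \<in> \<Omega>" for x
      using GDERIV_mult[OF assms(4)[OF that] C(2)] by (simp add: add.commute)
    show "continuous_on \<Omega> (\<lambda>x. f x *\<^sub>R D x + \<phi> x *\<^sub>R E x)"
      using f assms(5) C(3,4) by (intro continuous_intros) (auto intro: continuous_on_subset)
  qed (use C(5) in auto)
qed

text \<open>The components of the $C^1$ vector field \<open>G\<close> have gradients \<open>E b\<close>, so the divergence of
  \<open>G\<close> is the trace \<open>\<Sum>b. E b x \<bullet> b\<close>.\<close>

lemma divergence_test:
  fixes G :: "'a::euclidean_space \<Rightarrow> 'a"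
  assumes \<phi>: "C1c K \<phi> D" and \<Omega>: "open \<Omega>" "K \<subseteq> \<Omega>"
    and G: "\<And>x b. x \<in> \<Omega> \<Longrightarrow> b \<in> Basis \<Longrightarrow> GDERIV (\<lambda>x. G x \<bullet> b) x :> E b x"
    and E: "\<And>b. b \<in> Basis \<Longrightarrow> continuous_on \<Omega> (E b)"
  shows "(\<integral>x. indicator K x * (G x \<bullet> D x) \<partial>lborel) =
      - (\<integral>x. indicator K x * ((\<Sum>b\<in>Basis. E b x \<bullet> b) * \<phi> x) \<partial>lborel)"
proof -
  note C = C1cD[OF \<phi>]
  have cG: "continuous_on \<Omega> (\<lambda>x. G x \<bullet> b)" if "b \<in> Basis" for b
    using G that GDERIV_continuous by (blast intro: continuous_at_imp_continuous_on)
  have "continuous_on \<Omega> (\<lambda>x. \<Sum>b\<in>Basis. (G x \<bullet> b) *\<^sub>R b)"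
    using cG by (intro continuous_on_sum continuous_on_scaleR continuous_on_const)
  then have cG': "continuous_on \<Omega> G" by (simp add: euclidean_representation)
  have i1: "integrable lborel (\<lambda>x. indicator K x * (G x \<bullet> D x))"
    using borel_integrable_compact[OF C(1), of "\<lambda>x. G x \<bullet> D x"] \<Omega>(2) cG' C(3)
    by (auto intro!: continuous_intros intro: continuous_on_subset)
  have i2: "integrable lborel (\<lambda>x. indicator K x * ((\<Sum>b\<in>Basis. E b x \<bullet> b) * \<phi> x))"
  proof -
    have "continuous_on K (\<lambda>x. (\<Sum>b\<in>Basis. E b x \<bullet> b) * \<phi> x)"
      using \<Omega>(2) E C(4)
      by (intro continuous_on_mult continuous_on_sum continuous_on_inner continuous_on_const)
        (blast intro: continuous_on_subset)+
    from borel_integrable_compact[OF C(1) this] show ?thesis by simp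
  qed
  let ?P = "\<lambda>b x. if x \<in> \<Omega> then (G x \<bullet> b) *\<^sub>R D x + \<phi> x *\<^sub>R E b x else 0"
  have P: "C1c K (\<lambda>x. if x \<in> \<Omega> then (G x \<bullet> b) * \<phi> x else 0) (?P b)" if "b \<in> Basis" for b
    using C1c_prod[OF \<phi> \<Omega> G E] that by blast
  have iP: "integrable lborel (?P b)" if "b \<in> Basis" for b
    using continuous_compact_support_integrable[OF C1cD(3,1,6)[OF P[OF that]]] .
  have eq: "(\<Sum>b\<in>Basis. ?P b x \<bullet> b) = indicator K x * (G x \<bullet> D x) + indicator K x * ((\<Sum>b\<in>Basis. E b x \<bullet> b) * \<phi> x)" for x
  proof (cases "x \<in> K")
    case True
    then have "x \<in> \<Omega>" using \<Omega>(2) by blast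
    then have "(\<Sum>b\<in>Basis. ?P b x \<bullet> b) = (\<Sum>b\<in>Basis. (G x \<bullet> b) * (D x \<bullet> b)) + (\<Sum>b\<in>Basis. E b x \<bullet> b) * \<phi> x"
      by (simp add: inner_add_left sum.distrib sum_distrib_left mult.commute)
    then show ?thesis using True by (simp add: euclidean_inner[of "G x" "D x"])
  next
    case False
    then have "?P b x = 0" for b using C(5,6) by auto
    then show ?thesis using False by (simp only: inner_zero_left sum.neutral_const) simp
  qed
  have "0 = (\<Sum>b\<in>Basis. (\<integral>x. ?P b x \<partial>lborel) \<bullet> b)"
    using integral_grad_C1c[OF P] by simp
  also have "\<dots> = (\<Sum>b\<in>Basis. (\<integral>x. ?P b x \<bullet> b \<partial>lborel))"
    using iP by (intro sum.cong refl integral_inner_left[symmetric]) auto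
  also have "\<dots> = (\<integral>x. (\<Sum>b\<in>Basis. ?P b x \<bullet> b) \<partial>lborel)"
    using iP by (intro Bochner_Integration.integral_sum[symmetric] integrable_inner_left) auto
  also have "\<dots> = (\<integral>x. indicator K x * (G x \<bullet> D x) \<partial>lborel) + (\<integral>x. indicator K x * ((\<Sum>b\<in>Basis. E b x \<bullet> b) * \<phi> x) \<partial>lborel)"
    unfolding eq by (rule Bochner_Integration.integral_add[OF i1 i2])
  finally show ?thesis by simp
qed

section \<open>Mollification in \<open>L\<^sup>m\<close>\<close>

lemma cv_borel_measurable:
  fixes V :: "'a::euclidean_space \<Rightarrow> 'b::euclidean_space"
  assumes [measurable]: "V \<in> borel_measurable borel" "\<eta> \<in> borel_measurable borel"
  shows "cv V \<eta> \<in> borel_measurable borel"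
  unfolding cv_def[abs_def]
  by (rule lborel.borel_measurable_lebesgue_integral) measurable

lemma mollifier_bounded:
  assumes "mollifier \<delta> \<eta>"
  obtains B where "B > 0" "\<And>x. \<bar>\<eta> x\<bar> \<le> B"
  using continuous_compact_support_bounded[OF C1cD(4,1,5)[OF mollifierD(7)[OF assms]]]
  by (metis real_norm_def)

lemma mollifier_weight_integrable:
  fixes f :: "'a::euclidean_space \<Rightarrow> 'b::euclidean_space"
  assumes \<eta>: "mollifier \<delta> \<eta>" and f: "integrable lborel f"
  shows "integrable lborel (\<lambda>y. \<eta> (x - y) *\<^sub>R f y)"
proof -
  obtain B where "B > 0" "\<And>x. \<bar>\<eta> x\<bar> \<le> B" using mollifier_bounded[OF \<eta>] by metis
  moreover have [measurable]: "\<eta> \<in> borel_measurable borel" using mollifierD(8)[OF \<eta>] .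
  ultimately show ?thesis by (intro integrable_bounded_mult[OF f]) auto
qed

lemma mollifier_reflect:
  assumes \<eta>: "mollifier \<delta> \<eta>"
  shows "(\<integral>y. \<eta> (x - y) \<partial>lborel) = 1" "integrable lborel (\<lambda>y. \<eta> (x - y))"
  using lborel_integral_reflect[of \<eta> x] lborel_integrable_reflect[of \<eta> x] mollifierD(5,6,8)[OF \<eta>]
  by simp_all

lemma mollifier_shift:
  assumes \<eta>: "mollifier \<delta> \<eta>"
  shows "(\<integral>\<^sup>+x. ennreal (\<eta> (x - y)) \<partial>lborel) = 1"
proof -
  have [measurable]: "\<eta> \<in> borel_measurable borel" using mollifierD(8)[OF \<eta>] .
  have "(\<integral>\<^sup>+x. ennreal (\<eta> (x - y)) \<partial>lborel) = (\<integral>\<^sup>+x. ennreal (\<eta> x) \<partial>lborel)"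
    using lborel_nn_integral_translate[of "\<lambda>x. ennreal (\<eta> x)" "-y"] by simp
  also have "\<dots> = 1"
    using mollifierD(2,5,6)[OF \<eta>] by (simp add: nn_integral_eq_integral)
  finally show ?thesis .
qed

text \<open>The convex function \<open>t powr m\<close> lies above its tangent at \<open>c\<close>;
  here this is read off from Young's inequality.\<close>

lemma powr_tangent:
  fixes m t c :: real
  assumes "m > 1" "t \<ge> 0" "c \<ge> 0"
  shows "m * t * c powr (m - 1) \<le> t powr m + (m - 1) * c powr m"
proof -
  have e: "1/m + 1/(m/(m-1)) = 1" using assms by (simp add: field_simps)
  have "t * c powr (m-1) \<le> t powr m / m + (c powr (m-1)) powr (m/(m-1)) / (m/(m-1))"
    by (rule Youngs_inequality[OF _ _ e]) (use assms in auto)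
  also have "(c powr (m-1)) powr (m/(m-1)) = c powr m" using assms by (simp add: powr_powr)
  finally show ?thesis using assms by (simp add: field_simps)
qed

text \<open>Jensen's inequality for the probability weight \<open>\<eta> (x - y)\<close>: the
  tangent inequality at \<open>c = norm (cv V \<eta> x)\<close> is multiplied by the weight and
  integrated.\<close>

lemma norm_cv_powr_le:
  fixes V :: "'a::euclidean_space \<Rightarrow> 'b::euclidean_space"
  assumes m: "m > 1" and \<eta>: "mollifier \<delta> \<eta>"
    and V: "integrable lborel V" "integrable lborel (\<lambda>y. norm (V y) powr m)"
  shows "norm (cv V \<eta> x) powr m \<le> (\<integral>y. \<eta> (x - y) * norm (V y) powr m \<partial>lborel)"
proof -
  define c where "c = norm (cv V \<eta> x)"
  have c0: "c \<ge> 0" by (simp add: c_def)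
  have e0: "\<eta> z \<ge> 0" for z using mollifierD(2)[OF \<eta>] .
  have i1: "integrable lborel (\<lambda>y. \<eta> (x - y) * norm (V y))"
    using mollifier_weight_integrable[OF \<eta> integrable_norm[OF V(1)]] by simp
  have i2: "integrable lborel (\<lambda>y. \<eta> (x - y) * norm (V y) powr m)"
    using mollifier_weight_integrable[OF \<eta> V(2)] by simp
  have "c \<le> (\<integral>y. \<eta> (x - y) * norm (V y) \<partial>lborel)"
    unfolding c_def cv_def using integral_norm_bound[of lborel "\<lambda>y. \<eta> (x - y) *\<^sub>R V y"] e0 by simp
  then have "m * c powr (m-1) * c \<le> m * c powr (m-1) * (\<integral>y. \<eta> (x - y) * norm (V y) \<partial>lborel)"
    using m by (intro mult_left_mono) auto
  also have "\<dots> = (\<integral>y. m * c powr (m-1) * (\<eta> (x - y) * norm (V y)) \<partial>lborel)" by simp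
  also have "\<dots> \<le> (\<integral>y. \<eta> (x - y) * norm (V y) powr m + (m - 1) * c powr m * \<eta> (x - y) \<partial>lborel)"
  proof (rule integral_mono)
    show "integrable lborel (\<lambda>y. m * c powr (m-1) * (\<eta> (x - y) * norm (V y)))" using i1 by auto
    show "integrable lborel (\<lambda>y. \<eta> (x - y) * norm (V y) powr m + (m - 1) * c powr m * \<eta> (x - y))"
      using i2 mollifier_reflect(2)[OF \<eta>, of x] by auto
    fix y
    have "\<eta> (x-y) * (m * norm (V y) * c powr (m-1)) \<le> \<eta> (x-y) * (norm (V y) powr m + (m-1) * c powr m)"
      using powr_tangent[OF m, of "norm (V y)" c] c0 e0 by (intro mult_left_mono) auto
    then show "m * c powr (m-1) * (\<eta> (x - y) * norm (V y)) \<le> \<eta> (x - y) * norm (V y) powr m + (m - 1) * c powr m * \<eta> (x - y)"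
      by (simp add: algebra_simps)
  qed
  also have "\<dots> = (\<integral>y. \<eta> (x - y) * norm (V y) powr m \<partial>lborel) + (m - 1) * c powr m"
    using i2 mollifier_reflect[OF \<eta>, of x] by simp
  finally have "m * c powr (m-1) * c \<le> (\<integral>y. \<eta> (x - y) * norm (V y) powr m \<partial>lborel) + (m - 1) * c powr m" .
  moreover have "c powr (m-1) * c = c powr m"
    using c0 powr_mult_base[of c "m - 1"] by (simp add: mult.commute)
  ultimately have "m * c powr m \<le> (\<integral>y. \<eta> (x - y) * norm (V y) powr m \<partial>lborel) + (m - 1) * c powr m"
    by (metis mult.assoc)
  then show ?thesis unfolding c_def[symmetric] by (simp add: algebra_simps)
qed

text \<open>Mollification contracts the L^m norm: Jensen's inequality pointwise, then Tonelli and
  the unit mass of the kernel.\<close>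

lemma nn_integral_cv_powr_le:
  fixes V :: "'a::euclidean_space \<Rightarrow> 'b::euclidean_space"
  assumes m: "m > 1" and \<eta>: "mollifier \<delta> \<eta>"
    and V: "integrable lborel V" "integrable lborel (\<lambda>y. norm (V y) powr m)"
  shows "(\<integral>\<^sup>+x. ennreal (norm (cv V \<eta> x) powr m) \<partial>lborel) \<le> (\<integral>\<^sup>+y. ennreal (norm (V y) powr m) \<partial>lborel)"
proof -
  have [measurable]: "\<eta> \<in> borel_measurable borel" using mollifierD(8)[OF \<eta>] .
  have [measurable]: "V \<in> borel_measurable borel" using V(1) by auto
  have "(\<integral>\<^sup>+x. ennreal (norm (cv V \<eta> x) powr m) \<partial>lborel)
      \<le> (\<integral>\<^sup>+x. (\<integral>\<^sup>+y. ennreal (\<eta> (x - y)) * ennreal (norm (V y) powr m) \<partial>lborel) \<partial>lborel)"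
  proof (rule nn_integral_mono)
    fix x
    have "ennreal (norm (cv V \<eta> x) powr m) \<le> ennreal (\<integral>y. \<eta> (x - y) * norm (V y) powr m \<partial>lborel)"
      using norm_cv_powr_le[OF m \<eta> V] by (rule ennreal_leI)
    also have "\<dots> = (\<integral>\<^sup>+y. ennreal (\<eta> (x - y) * norm (V y) powr m) \<partial>lborel)"
      using mollifier_weight_integrable[OF \<eta> V(2), of x] mollifierD(2)[OF \<eta>]
      by (intro nn_integral_eq_integral[symmetric]) auto
    finally show "ennreal (norm (cv V \<eta> x) powr m) \<le> (\<integral>\<^sup>+y. ennreal (\<eta> (x - y)) * ennreal (norm (V y) powr m) \<partial>lborel)"
      using mollifierD(2)[OF \<eta>] by (simp add: ennreal_mult)
  qed
  also have "\<dots> = (\<integral>\<^sup>+y. (\<integral>\<^sup>+x. ennreal (\<eta> (x - y)) * ennreal (norm (V y) powr m) \<partial>lborel) \<partial>lborel)"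
    by (rule lborel_pair.Fubini') measurable
  also have "\<dots> = (\<integral>\<^sup>+y. ennreal (norm (V y) powr m) \<partial>lborel)"
    by (simp add: nn_integral_multc mollifier_shift[OF \<eta>])
  finally show ?thesis .
qed

lemma cv_continuous_close:
  fixes g :: "'a::euclidean_space \<Rightarrow> 'b::euclidean_space"
  assumes \<eta>: "mollifier \<delta> \<eta>" and g: "integrable lborel g"
    and close: "\<And>y. dist y x \<le> \<delta> \<Longrightarrow> norm (g y - c) \<le> e"
  shows "norm (cv g \<eta> x - c) \<le> e"
proof -
  have e0: "\<eta> z \<ge> 0" for z using mollifierD(2)[OF \<eta>] .
  have i1: "integrable lborel (\<lambda>y. \<eta> (x - y) *\<^sub>R g y)" by (rule mollifier_weight_integrable[OF \<eta> g])
  have i2: "integrable lborel (\<lambda>y. \<eta> (x - y) *\<^sub>R c)"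
    using mollifier_reflect(2)[OF \<eta>] by auto
  have "cv g \<eta> x - c = (\<integral>y. \<eta> (x - y) *\<^sub>R (g y - c) \<partial>lborel)"
    using i1 i2 mollifier_reflect[OF \<eta>, of x] unfolding cv_def
    by (simp add: scaleR_diff_right Bochner_Integration.integral_diff)
  also have "norm \<dots> \<le> (\<integral>y. \<eta> (x - y) * e \<partial>lborel)"
  proof (rule Bochner_Integration.integral_norm_bound_integral)
    show "integrable lborel (\<lambda>y. \<eta> (x - y) *\<^sub>R (g y - c))" using i1 i2 by (simp add: scaleR_diff_right)
    show "integrable lborel (\<lambda>y. \<eta> (x - y) * e)" using mollifier_reflect(2)[OF \<eta>] by auto
    show "norm (\<eta> (x - y) *\<^sub>R (g y - c)) \<le> \<eta> (x - y) * e" for y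
    proof (cases "dist y x \<le> \<delta>")
      case True
      then show ?thesis using close[OF True] e0[of "x - y"] by (simp add: mult_left_mono)
    next
      case False
      then have "\<eta> (x - y) = 0" by (intro mollifierD(4)[OF \<eta>]) (simp add: dist_norm norm_minus_commute)
      then show ?thesis by simp
    qed
  qed
  also have "\<dots> = e" using mollifier_reflect[OF \<eta>, of x] by simp
  finally show ?thesis .
qed

lemma cv_eq_0:
  assumes \<eta>: "mollifier \<delta> \<eta>" and "\<And>y. dist y x \<le> \<delta> \<Longrightarrow> g y = 0"
  shows "cv g \<eta> x = 0"
proof -
  have "\<eta> (x - y) *\<^sub>R g y = 0" for y
  proof (cases "dist y x \<le> \<delta>")
    case False
    then have "\<eta> (x - y) = 0" by (intro mollifierD(4)[OF \<eta>]) (simp add: dist_norm norm_minus_commute)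
    then show ?thesis by simp
  qed (use assms(2) in simp)
  then show ?thesis by (simp only: cv_def Bochner_Integration.integral_zero)
qed

text \<open>\<open>norm (V x)\<close> is at most \<open>1 + norm (V x) powr m\<close>, and the
  constant is integrable on the ball that carries \<open>V\<close>.\<close>

lemma integrable_powr_imp_integrable:
  fixes V :: "'a::euclidean_space \<Rightarrow> 'b::euclidean_space"
  assumes [measurable]: "V \<in> borel_measurable borel" and m: "m \<ge> 1"
    and V: "integrable lborel (\<lambda>y. norm (V y) powr m)" and R: "\<And>x. x \<notin> cball 0 R \<Longrightarrow> V x = 0"
  shows "integrable lborel V"
proof (rule Bochner_Integration.integrable_bound)
  show "integrable lborel (\<lambda>x. indicator (cball 0 R) x + norm (V x) powr m)"
    using V emeasure_lborel_cball_finite[of 0 R] by (intro Bochner_Integration.integrable_add integrable_real_indicator) auto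
  show "AE x in lborel. norm (V x) \<le> norm (indicator (cball 0 R) x + norm (V x) powr m)"
  proof (intro AE_I2)
    fix x
    have "norm (V x) \<le> 1 + norm (V x) powr m"
    proof (cases "norm (V x) \<le> 1")
      case True then show ?thesis by (smt (verit) powr_ge_zero)
    next
      case False then show ?thesis using powr_mono[OF m, of "norm (V x)"] by simp
    qed
    then show "norm (V x) \<le> norm (indicator (cball 0 R) x + norm (V x) powr m)"
      using R[of x] by (cases "x \<in> cball 0 R") auto
  qed
qed simp

lemma powr_add3_le:
  fixes a b c m :: real
  assumes "a \<ge> 0" "b \<ge> 0" "c \<ge> 0" "m > 0"
  shows "(a + b + c) powr m \<le> 3 powr m * (a powr m + b powr m + c powr m)"
proof -
  define M where "M = max a (max b c)"
  have "(a + b + c) powr m \<le> (3 * M) powr m"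
    using assms by (intro powr_mono2) (auto simp: M_def)
  also have "\<dots> = 3 powr m * M powr m" by (simp add: powr_mult)
  also have "M powr m \<le> a powr m + b powr m + c powr m"
    by (auto simp: M_def max_def)
  finally show ?thesis by simp
qed

text \<open>Two applications of dominated convergence: \<open>V\<close> is approximated by its
  bounded truncations, and a bounded truncation \<open>U\<close> by uniformly bounded continuous
  functions that converge to it almost everywhere.\<close>

lemma Lm_dense_continuous:
  fixes V :: "'a::euclidean_space \<Rightarrow> 'b::euclidean_space"
  assumes [measurable]: "V \<in> borel_measurable borel" and m: "m \<ge> 1" and e: "e > 0"
    and V: "integrable lborel (\<lambda>y. norm (V y) powr m)" and R: "\<And>x. x \<notin> cball 0 R \<Longrightarrow> V x = 0"
  obtains g where "continuous_on UNIV g" "\<And>x. x \<notin> cball 0 (R+1) \<Longrightarrow> g x = 0"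
    "integrable lborel (\<lambda>y. norm (V y - g y) powr m)"
    "(\<integral>y. norm (V y - g y) powr m \<partial>lborel) < e"
proof -
  have mx: "norm (a - b) powr m \<le> 3 powr m * (norm a powr m + norm b powr m)" for a b :: 'b
  proof -
    have "norm (a - b) powr m \<le> (norm a + norm b + 0) powr m"
      using m by (intro powr_mono2) (auto simp: norm_triangle_ineq4)
    then show ?thesis using powr_add3_le[of "norm a" "norm b" 0 m] m by simp
  qed
  define W where "W = (\<lambda>n::nat. \<lambda>x. if norm (V x) \<le> real n then V x else 0)"
  have [measurable]: "W n \<in> borel_measurable borel" for n unfolding W_def by measurable
  have Wle: "norm (V x - W n x) powr m \<le> norm (V x) powr m" for n x using m by (simp add: W_def)
  have iW: "integrable lborel (\<lambda>x. norm (V x - W n x) powr m)" for n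
    by (rule Bochner_Integration.integrable_bound[OF V]) (use Wle in auto)
  have "(\<lambda>n. \<integral>x. norm (V x - W n x) powr m \<partial>lborel) \<longlonglongrightarrow> (\<integral>x. 0 \<partial>(lborel::'a measure))"
  proof (rule integral_dominated_convergence[where w="\<lambda>x. norm (V x) powr m"])
    show "AE x in lborel. (\<lambda>n. norm (V x - W n x) powr m) \<longlonglongrightarrow> 0"
    proof (intro AE_I2)
      fix x
      have "eventually (\<lambda>n. norm (V x - W n x) powr m = 0) sequentially"
        using eventually_ge_at_top[of "nat \<lceil>norm (V x)\<rceil>"]
        by eventually_elim (simp add: W_def nat_ceiling_le_eq)
      then show "(\<lambda>n. norm (V x - W n x) powr m) \<longlonglongrightarrow> 0" by (rule tendsto_eventually)
    qed
  qed (use V Wle in auto)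
  then have "eventually (\<lambda>n. (\<integral>x. norm (V x - W n x) powr m \<partial>lborel) < e / (4 * 3 powr m)) sequentially"
    using e by (intro order_tendstoD(2)) auto
  then obtain M where M: "(\<integral>x. norm (V x - W M x) powr m \<partial>lborel) < e / (4 * 3 powr m)"
    unfolding eventually_sequentially by blast
  define U where "U = W M"
  have [measurable]: "U \<in> borel_measurable borel" by (simp add: U_def)
  have U: "norm (U x) \<le> real M" "x \<notin> cball 0 R \<Longrightarrow> U x = 0" for x using R by (auto simp: U_def W_def)
  \<comment> \<open>Unfolding \<open>measurable_on\<close> supplies continuous functions that
    converge to \<open>U\<close> off a negligible set.\<close>
  have "U measurable_on UNIV"
    unfolding measurable_on_iff_borel_measurable[of UNIV, simplified]
    by (intro measurable_restrict_space1 measurable_completion) simp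
  then obtain N f where N: "negligible N" and f: "\<And>n. continuous_on UNIV (f n)"
    "\<And>x. x \<notin> N \<Longrightarrow> (\<lambda>n. f n x) \<longlonglongrightarrow> U x"
    unfolding measurable_on_def by auto
  \<comment> \<open>\<open>clip\<close> projects onto the ball in which \<open>U\<close> takes its
    values and \<open>cut\<close> confines the support. Together they supply the integrable bound
    \<open>?w\<close>, and both leave \<open>U\<close> unchanged.\<close>
  define cut where "cut = (\<lambda>x::'a. max 0 (min 1 (R + 1 - norm x)))"
  define clip where "clip = closest_point (cball (0::'b) (real M))"
  define g where "g = (\<lambda>n x. cut x *\<^sub>R clip (f n x))"
  have cc: "continuous_on UNIV clip" unfolding clip_def
    by (rule continuous_on_closest_point) auto
  have clipM: "norm (clip v) \<le> real M" for v
    using closest_point_in_set[of "cball (0::'b) (real M)" v] by (auto simp: clip_def)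
  have clipU: "clip (U x) = U x" for x unfolding clip_def using U by (intro closest_point_self) auto
  have cg: "continuous_on UNIV (g n)" for n
    unfolding g_def cut_def using f(1) cc
    by (intro continuous_intros) (auto intro: continuous_on_compose2)
  have [measurable]: "g n \<in> borel_measurable borel" for n using cg borel_measurable_continuous_onI by blast
  have g0: "x \<notin> cball 0 (R+1) \<Longrightarrow> g n x = 0" for n x by (simp add: g_def cut_def)
  have chi: "0 \<le> cut x" "cut x \<le> 1" "x \<in> cball 0 R \<Longrightarrow> cut x = 1" for x by (auto simp: cut_def)
  have gM: "norm (g n x) \<le> real M" for n x
    using chi[of x] clipM[of "f n x"] by (simp add: g_def) (metis mult_left_le_one_le norm_ge_zero order_trans)
  have glim: "(\<lambda>n. g n x) \<longlonglongrightarrow> U x" if "x \<notin> N" for x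
  proof -
    have "isCont clip (U x)" using cc by (simp add: continuous_on_eq_continuous_at)
    then have "(\<lambda>n. clip (f n x)) \<longlonglongrightarrow> clip (U x)" using f(2)[OF that] by (rule isCont_tendsto_compose)
    then have "(\<lambda>n. g n x) \<longlonglongrightarrow> cut x *\<^sub>R U x" unfolding g_def clipU by (intro tendsto_intros)
    moreover have "cut x *\<^sub>R U x = U x" using chi(3)[of x] U(2)[of x] by (cases "x \<in> cball 0 R") auto
    ultimately show ?thesis by simp
  qed
  let ?w = "\<lambda>x. (2 * real M) powr m * indicator (cball (0::'a) (R+1)) x"
  have w: "integrable lborel ?w"
    using emeasure_lborel_cball_finite[of "0::'a" "R+1"] by (intro integrable_mult_right integrable_real_indicator) auto
  have Uw: "norm (U x - g n x) powr m \<le> ?w x" for n x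
  proof (cases "x \<in> cball 0 (R+1)")
    case True
    have "norm (U x - g n x) \<le> 2 * real M" using norm_triangle_ineq4[of "U x" "g n x"] U(1)[of x] gM[of n x] by linarith
    then show ?thesis using True m by (simp add: powr_mono2)
  qed (use g0 U(2) in auto)
  have iU: "integrable lborel (\<lambda>x. norm (U x - g n x) powr m)" for n
    by (rule Bochner_Integration.integrable_bound[OF w]) (use Uw in auto)
  have "(\<lambda>n. \<integral>x. norm (U x - g n x) powr m \<partial>lborel) \<longlonglongrightarrow> (\<integral>x. 0 \<partial>(lborel::'a measure))"
  proof (rule integral_dominated_convergence[where w="?w"])
    have "AE x in lebesgue. x \<notin> N"
      using N by (simp add: negligible_iff_null_sets AE_not_in)
    then have "AE x in lborel. x \<notin> N" by (simp only: AE_completion_iff)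
    then show "AE x in lborel. (\<lambda>n. norm (U x - g n x) powr m) \<longlonglongrightarrow> 0"
    proof eventually_elim
      case (elim x)
      have "(\<lambda>n. norm (U x - g n x)) \<longlonglongrightarrow> norm (U x - U x)"
        using glim[OF elim] by (intro tendsto_intros)
      then have "(\<lambda>n. norm (U x - g n x)) \<longlonglongrightarrow> 0" unfolding diff_self norm_zero .
      moreover have "0 < m" using m by linarith
      ultimately show ?case by (intro tendsto_zero_powrI[OF _ tendsto_const]) auto
    qed
  qed (use w Uw in auto)
  then have "eventually (\<lambda>n. (\<integral>x. norm (U x - g n x) powr m \<partial>lborel) < e / (4 * 3 powr m)) sequentially"
    using e by (intro order_tendstoD(2)) auto
  then obtain n where n: "(\<integral>x. norm (U x - g n x) powr m \<partial>lborel) < e / (4 * 3 powr m)"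
    unfolding eventually_sequentially by blast
  have le: "norm (V x - g n x) powr m \<le> 3 powr m * (norm (V x - U x) powr m + norm (U x - g n x) powr m)" for x
    using mx[of "V x - U x" "g n x - U x"] by (simp add: norm_minus_commute)
  have i: "integrable lborel (\<lambda>x. 3 powr m * (norm (V x - U x) powr m + norm (U x - g n x) powr m))"
    using iW[of M] iU[of n] by (simp add: U_def)
  have iVg: "integrable lborel (\<lambda>x. norm (V x - g n x) powr m)"
    by (rule Bochner_Integration.integrable_bound[OF i]) (use le in auto)
  have "(\<integral>x. norm (V x - g n x) powr m \<partial>lborel) \<le> 3 powr m * ((\<integral>x. norm (V x - U x) powr m \<partial>lborel) + (\<integral>x. norm (U x - g n x) powr m \<partial>lborel))"
    using integral_mono[OF iVg i le] iW[of M] iU[of n] by (simp add: U_def)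
  also have "\<dots> < 3 powr m * (e / (4 * 3 powr m) + e / (4 * 3 powr m))"
    using M n unfolding U_def[symmetric] by (intro mult_strict_left_mono add_strict_mono) auto
  also have "\<dots> < e" using e by (simp add: field_simps)
  finally show ?thesis using that[OF cg g0 iVg] by blast
qed

text \<open>\<open>cv V \<eta> - V\<close> is split through a continuous \<open>g\<close> close to
  \<open>V\<close>. The mollification of \<open>V - g\<close> is small by contraction, and that of
  \<open>g\<close> is uniformly close to \<open>g\<close>. The threshold \<open>\<delta>0\<close> is
  uniform in the kernel, so the same kernel can later be used for another function as well.\<close>

lemma Lm_mollify:
  fixes V :: "'a::euclidean_space \<Rightarrow> 'b::euclidean_space"
  assumes meas: "V \<in> borel_measurable borel" and m: "m > 1" and e: "e > 0"
    and V: "integrable lborel (\<lambda>y. norm (V y) powr m)" and R: "\<And>x. x \<notin> cball 0 R \<Longrightarrow> V x = 0"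
  obtains \<delta>0 where "\<delta>0 > 0"
    "\<And>\<delta> \<eta>. \<delta> \<le> \<delta>0 \<Longrightarrow> mollifier \<delta> \<eta> \<Longrightarrow> (\<integral>\<^sup>+x. ennreal (norm (cv V \<eta> x - V x) powr m) \<partial>lborel) < ennreal e"
proof -
  note [measurable] = meas
  \<comment> \<open>Three errors of size \<open>e1\<close> and the factor \<open>3 powr m\<close>
    from \<open>powr_add3_le\<close> add up to three quarters of \<open>e\<close>.\<close>
  define e1 where "e1 = e / (4 * 3 powr m)"
  have e1: "e1 > 0" using e by (simp add: e1_def)
  obtain g where g: "continuous_on UNIV g" "\<And>x. x \<notin> cball 0 (R+1) \<Longrightarrow> g x = 0"
    "integrable lborel (\<lambda>y. norm (V y - g y) powr m)" "(\<integral>y. norm (V y - g y) powr m \<partial>lborel) < e1"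
    using Lm_dense_continuous[OF meas _ e1 V R] m by auto
  have [measurable]: "g \<in> borel_measurable borel" using g(1) borel_measurable_continuous_onI by blast
  have ig: "integrable lborel g"
    using continuous_compact_support_integrable[OF g(1) compact_cball g(2)] .
  have iV: "integrable lborel V"
    using integrable_powr_imp_integrable[OF meas _ V R] m by simp
  define \<mu> where "\<mu> = measure lborel (cball (0::'a) (R+2))"
  have \<mu>: "\<mu> \<ge> 0" "emeasure lborel (cball (0::'a) (R+2)) = ennreal \<mu>"
    unfolding \<mu>_def using emeasure_lborel_cball_finite[of "0::'a" "R+2"]
    by (auto simp: emeasure_eq_ennreal_measure)
  \<comment> \<open>A uniform error \<open>e2\<close> on a ball of volume \<open>\<mu>\<close> then
    costs at most \<open>e1\<close> in the m-th power of the norm.\<close>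
  define e2 where "e2 = (e1 / (\<mu> + 1)) powr (1/m)"
  have e2: "e2 > 0" "e2 powr m = e1 / (\<mu> + 1)" using e1 \<mu> m by (auto simp: e2_def powr_powr)
  obtain d where d: "d > 0" "\<And>x y. dist y x < d \<Longrightarrow> dist (g y) (g x) < e2"
    using continuous_compact_support_uniform[OF g(1) compact_cball g(2)] e2
    unfolding uniformly_continuous_on_def by (metis UNIV_I)
  show ?thesis
  proof (rule that[of "min (d/2) 1"])
    fix \<delta> :: real and \<eta> :: "'a \<Rightarrow> real" assume \<delta>: "\<delta> \<le> min (d/2) 1" and \<eta>: "mollifier \<delta> \<eta>"
    have [measurable]: "\<eta> \<in> borel_measurable borel" using mollifierD(8)[OF \<eta>] .
    have [measurable]: "cv V \<eta> \<in> borel_measurable borel" "cv g \<eta> \<in> borel_measurable borel" "cv (\<lambda>x. V x - g x) \<eta> \<in> borel_measurable borel"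
      by (auto intro!: cv_borel_measurable)
    have i1: "integrable lborel (\<lambda>x. V x - g x)" using iV ig by auto
    have sp: "cv V \<eta> x = cv (\<lambda>x. V x - g x) \<eta> x + cv g \<eta> x" for x
      using mollifier_weight_integrable[OF \<eta> iV, of x] mollifier_weight_integrable[OF \<eta> ig, of x]
      by (simp add: cv_def scaleR_diff_right Bochner_Integration.integral_diff)
    let ?A = "\<lambda>x. norm (cv (\<lambda>x. V x - g x) \<eta> x) powr m"
    let ?B = "\<lambda>x. norm (V x - g x) powr m"
    let ?C = "\<lambda>x. norm (cv g \<eta> x - g x) powr m"
    have pt: "norm (cv V \<eta> x - V x) powr m \<le> 3 powr m * (?A x + ?C x + ?B x)" for x
    proof -
      have "cv V \<eta> x - V x = cv (\<lambda>x. V x - g x) \<eta> x + (cv g \<eta> x - g x) - (V x - g x)"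
        unfolding sp by simp
      then have "norm (cv V \<eta> x - V x) \<le> norm (cv (\<lambda>x. V x - g x) \<eta> x) + norm (cv g \<eta> x - g x) + norm (V x - g x)"
        using norm_triangle_ineq4[of "cv (\<lambda>x. V x - g x) \<eta> x + (cv g \<eta> x - g x)" "V x - g x"]
          norm_triangle_ineq[of "cv (\<lambda>x. V x - g x) \<eta> x" "cv g \<eta> x - g x"] by simp
      then have "norm (cv V \<eta> x - V x) powr m \<le> (norm (cv (\<lambda>x. V x - g x) \<eta> x) + norm (cv g \<eta> x - g x) + norm (V x - g x)) powr m"
        using m by (intro powr_mono2) auto
      then show ?thesis using powr_add3_le[of "norm (cv (\<lambda>x. V x - g x) \<eta> x)" "norm (cv g \<eta> x - g x)" "norm (V x - g x)" m] m by simp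
    qed
    have B: "(\<integral>\<^sup>+x. ennreal (?B x) \<partial>lborel) \<le> ennreal e1"
      using g(3,4) by (subst nn_integral_eq_integral) (auto intro!: ennreal_leI)
    have A: "(\<integral>\<^sup>+x. ennreal (?A x) \<partial>lborel) \<le> ennreal e1"
      using nn_integral_cv_powr_le[OF m \<eta> i1 g(3)] B by (rule order_trans)
    have C: "(\<integral>\<^sup>+x. ennreal (?C x) \<partial>lborel) \<le> ennreal e1"
    proof -
      have "?C x \<le> e2 powr m * indicator (cball 0 (R+2)) x" for x
      proof (cases "x \<in> cball 0 (R+2)")
        case True
        have "norm (cv g \<eta> x - g x) \<le> e2"
        proof (rule cv_continuous_close[OF \<eta> ig])
          fix y assume "dist y x \<le> \<delta>"
          then have "dist y x < d" using d(1) \<delta> by linarith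
          then show "norm (g y - g x) \<le> e2" using d(2)[of y x] by (simp add: dist_norm)
        qed
        then show ?thesis using True m by (simp add: powr_mono2)
      next
        case False
        have "g y = 0" if "dist y x \<le> \<delta>" for y
        proof (rule g(2))
          have "norm x \<le> norm y + dist y x" by (metis dist_norm dist_commute norm_triangle_sub)
          then show "y \<notin> cball 0 (R+1)" using False that \<delta> by auto
        qed
        then have "cv g \<eta> x = 0" by (rule cv_eq_0[OF \<eta>])
        moreover have "g x = 0" using False by (intro g(2)) auto
        ultimately show ?thesis using False by simp
      qed
      then have "(\<integral>\<^sup>+x. ennreal (?C x) \<partial>lborel) \<le> (\<integral>\<^sup>+x. ennreal (e2 powr m) * indicator (cball (0::'a) (R+2)) x \<partial>lborel)"
        by (intro nn_integral_mono) (simp add: ennreal_indicator[symmetric] ennreal_mult[symmetric] ennreal_leI)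
      also have "\<dots> = ennreal (e2 powr m * \<mu>)" using \<mu> by (simp add: nn_integral_cmult_indicator ennreal_mult)
      also have "\<dots> \<le> ennreal e1" using e1 \<mu>(1) unfolding e2 by (intro ennreal_leI) (simp add: field_simps)
      finally show ?thesis .
    qed
    have "(\<integral>\<^sup>+x. ennreal (norm (cv V \<eta> x - V x) powr m) \<partial>lborel)
        \<le> (\<integral>\<^sup>+x. ennreal (3 powr m) * (ennreal (?A x) + ennreal (?C x) + ennreal (?B x)) \<partial>lborel)"
      using pt by (intro nn_integral_mono) (simp add: ennreal_leI flip: ennreal_plus ennreal_mult)
    also have "\<dots> = ennreal (3 powr m) * ((\<integral>\<^sup>+x. ennreal (?A x) \<partial>lborel) + (\<integral>\<^sup>+x. ennreal (?C x) \<partial>lborel) + (\<integral>\<^sup>+x. ennreal (?B x) \<partial>lborel))"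
      by (simp add: nn_integral_cmult nn_integral_add)
    also have "\<dots> \<le> ennreal (3 powr m) * (ennreal e1 + ennreal e1 + ennreal e1)"
      using A B C by (intro mult_left_mono add_mono) auto
    also have "\<dots> = ennreal (3 powr m * (e1 + e1 + e1))" using e1 by (simp flip: ennreal_plus ennreal_mult)
    also have "\<dots> < ennreal e" using e by (intro ennreal_lessI) (auto simp: e1_def field_simps)
    finally show "(\<integral>\<^sup>+x. ennreal (norm (cv V \<eta> x - V x) powr m) \<partial>lborel) < ennreal e" .
  qed (use d in auto)
qed

section \<open>The mixed operator\<close>

definition flux :: "real \<Rightarrow> real \<Rightarrow> (real \<Rightarrow> real) \<Rightarrow> 'a::real_normed_vector \<Rightarrow> 'a" where
  "flux m s g \<xi> = (norm \<xi> powr (m - 2) * g (norm \<xi>) + norm \<xi> powr (s - 2)) *\<^sub>R \<xi>"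

locale mixed_operator =
  fixes m s :: real and g :: "real \<Rightarrow> real"
  assumes ms: "m > s" "s > 1"
    and g_pos: "\<forall>t\<ge>0. g t > 0"
    and g_antimono: "antimono_on {0..} g"
    and g_C1: "g C1_differentiable_on {0<..}"
    and g_cont: "continuous_on {0..} g"
    and g_lower: "\<forall>t>0. t * deriv g t / g t + m - 1 \<ge> 0"
begin

definition a :: "real \<Rightarrow> real" where
  "a t = t powr (m - 1) * g t + t powr (s - 1)"

abbreviation A :: "'a::euclidean_space \<Rightarrow> 'a" where "A \<equiv> flux m s g"

lemma m1: "m > 1" using ms by simp

lemma g_le: "t \<ge> 0 \<Longrightarrow> g t \<le> g 0"
  using g_antimono by (auto simp: monotone_on_def)

lemma a_0 [simp]: "a 0 = 0" by (simp add: a_def)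

lemma a_ge: "t \<ge> 0 \<Longrightarrow> t powr (s - 1) \<le> a t"
  using g_pos by (simp add: a_def less_imp_le)

lemma a_le: "t \<ge> 0 \<Longrightarrow> a t \<le> (1 + g 0) * (t powr (s - 1) + t powr (m - 1))"
proof -
  assume t: "t \<ge> 0"
  have "t powr (m-1) * g t \<le> t powr (m-1) * g 0" using g_le[OF t] by (intro mult_left_mono) auto
  moreover have "0 \<le> t powr (s-1) * g 0" using g_pos by (simp add: less_imp_le)
  moreover have "0 \<le> t powr (m-1)" by simp
  ultimately show ?thesis unfolding a_def by (simp only: distrib_left distrib_right mult_1 mult.commute[of "g 0"])
qed

lemma a_cont: "continuous_on {0..} a"
  unfolding a_def[abs_def] using ms g_cont
  by (intro continuous_on_add continuous_on_mult continuous_on_powr' continuous_on_id continuous_on_const) auto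

text \<open>The derivative is \<open>t powr (m - 2) * g t\<close> times the quantity that
  \<open>g_lower\<close> makes nonnegative. This is what makes \<open>a\<close> strictly increasing,
  hence the flux monotone.\<close>

lemma powr_g_mono:
  assumes "0 \<le> x" "x \<le> y"
  shows "x powr (m - 1) * g x \<le> y powr (m - 1) * g y"
proof (rule DERIV_nonneg_imp_increasing_open[OF assms(2)])
  fix t assume t: "x < t" "t < y"
  then have t0: "t > 0" using assms by simp
  have "g differentiable (at t)"
    using g_C1 t0 by (auto simp: C1_differentiable_on_eq)
  then have d: "DERIV g t :> deriv g t"
    using DERIV_deriv_iff_real_differentiable by blast
  have "DERIV (\<lambda>t. t powr (m - 1) * g t) t :> (m - 1) * t powr (m - 1 - 1) * g t + deriv g t * t powr (m - 1)"
    by (rule DERIV_mult[OF has_real_derivative_powr[OF t0] d])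
  moreover have "(m - 1) * t powr (m - 1 - 1) * g t + deriv g t * t powr (m - 1)
      = t powr (m - 2) * g t * (t * deriv g t / g t + m - 1)"
  proof -
    have "t powr (m - 1) = t powr (m - 2) * t"
      using powr_add[of t "m - 2" 1] t0 by simp
    moreover have "g t \<noteq> 0" using g_pos t0 by (metis less_imp_le order_less_irrefl)
    ultimately show ?thesis by (simp add: field_simps)
  qed
  moreover have "\<dots> \<ge> 0" using g_lower g_pos t0 by (simp add: less_imp_le)
  ultimately show "\<exists>z. DERIV (\<lambda>t. t powr (m - 1) * g t) t :> z \<and> 0 \<le> z" by auto
next
  show "continuous_on {x..y} (\<lambda>t. t powr (m - 1) * g t)"
    using assms m1 by (intro continuous_on_mult continuous_on_powr' continuous_on_id
        continuous_on_const continuous_on_subset[OF g_cont]) auto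
qed

lemma a_strict_mono: "0 \<le> x \<Longrightarrow> x < y \<Longrightarrow> a x < a y"
  using powr_g_mono[of x y] powr_less_mono2[of "s - 1" x y] ms by (simp add: a_def)

lemma flux_eq: "A \<xi> = (a (norm \<xi>) / norm \<xi>) *\<^sub>R \<xi>"
proof (cases "\<xi> = 0")
  case False
  have "norm \<xi> powr (m - 2) = norm \<xi> powr (m - 1) / norm \<xi>" "norm \<xi> powr (s - 2) = norm \<xi> powr (s - 1) / norm \<xi>"
    using False powr_diff[of "norm \<xi>" "m - 1" 1] powr_diff[of "norm \<xi>" "s - 1" 1] by simp_all
  then show ?thesis by (simp add: flux_def a_def add_divide_distrib)
qed (simp add: flux_def)

lemma a_nonneg: "t \<ge> 0 \<Longrightarrow> a t \<ge> 0"
  using a_ge[of t] by (meson order_trans powr_ge_zero)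

lemma norm_flux: "norm (A \<xi>) = a (norm \<xi>)"
  using a_nonneg[of "norm \<xi>"] by (simp add: flux_eq)

text \<open>Cauchy-Schwarz reduces the pairing to \<open>(a x - a y) * (x - y)\<close> for the norms
  \<open>x\<close> and \<open>y\<close>, and \<open>a\<close> is strictly increasing. Equality
  forces equal norms, and on a sphere about the origin the flux is a positive multiple of the
  identity.\<close>

lemma
  fixes \<xi> \<zeta> :: "'a::euclidean_space"
  shows flux_mono: "(A \<xi> - A \<zeta>) \<bullet> (\<xi> - \<zeta>) \<ge> 0"
    and flux_mono_eq: "(A \<xi> - A \<zeta>) \<bullet> (\<xi> - \<zeta>) = 0 \<Longrightarrow> \<xi> = \<zeta>"
proof -
  let ?x = "norm \<xi>" and ?y = "norm \<zeta>"
  have 1: "A v \<bullet> v = a (norm v) * norm v" for v :: 'a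
    by (cases "v = 0") (simp_all add: flux_eq dot_square_norm power2_eq_square)
  have 2: "A \<xi> \<bullet> \<zeta> \<le> a ?x * ?y" "A \<zeta> \<bullet> \<xi> \<le> a ?y * ?x"
    using norm_cauchy_schwarz[of "A \<xi>" \<zeta>] norm_cauchy_schwarz[of "A \<zeta>" \<xi>] by (simp_all add: norm_flux)
  have 3: "(A \<xi> - A \<zeta>) \<bullet> (\<xi> - \<zeta>) \<ge> (a ?x - a ?y) * (?x - ?y)"
    using 1[of \<xi>] 1[of \<zeta>] 2 by (simp add: inner_diff_left inner_diff_right algebra_simps)
  have 4: "(a ?x - a ?y) * (?x - ?y) > 0" if "?x \<noteq> ?y"
    using that a_strict_mono[of ?x ?y] a_strict_mono[of ?y ?x]
    by (cases "?x < ?y") (auto intro: mult_pos_pos mult_neg_neg)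
  show "(A \<xi> - A \<zeta>) \<bullet> (\<xi> - \<zeta>) \<ge> 0" using 3 4 by (cases "?x = ?y") auto
  assume e: "(A \<xi> - A \<zeta>) \<bullet> (\<xi> - \<zeta>) = 0"
  then have xy: "?x = ?y" using 3 4 by auto
  show "\<xi> = \<zeta>"
  proof (cases "?x = 0")
    case True then show ?thesis using xy by simp
  next
    case False
    then have "a ?x > 0" using a_strict_mono[of 0 ?x] by simp
    moreover have "A \<xi> - A \<zeta> = (a ?x / ?x) *\<^sub>R (\<xi> - \<zeta>)"
      unfolding flux_eq xy[symmetric] by (simp add: scaleR_diff_right)
    then have "(A \<xi> - A \<zeta>) \<bullet> (\<xi> - \<zeta>) = (a ?x / ?x) * ((\<xi> - \<zeta>) \<bullet> (\<xi> - \<zeta>))" by simp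
    ultimately show ?thesis using e False by auto
  qed
qed

lemma flux_borel [measurable]: "(A :: 'a::euclidean_space \<Rightarrow> 'a) \<in> borel_measurable borel"
proof -
  have "continuous_on UNIV (\<lambda>\<xi>::'a. g (norm \<xi>))"
    by (intro continuous_on_compose2[OF g_cont]) (auto intro!: continuous_intros)
  then have [measurable]: "(\<lambda>\<xi>::'a. g (norm \<xi>)) \<in> borel_measurable borel" by (rule borel_measurable_continuous_onI)
  show ?thesis unfolding flux_def[abs_def] by measurable
qed

text \<open>The exponent is the conjugate of \<open>m\<close>: the flux of a field in L^m can be
  paired with gradients in L^m.\<close>

lemma flux_growth:
  "norm (A \<xi>) powr (m / (m - 1)) \<le> (3 * (1 + g 0)) powr (m / (m - 1)) * (1 + norm \<xi> powr m)"
proof -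
  let ?t = "norm \<xi>" and ?r = "m / (m - 1)" and ?k = "3 * (1 + g 0)"
  have r: "?r > 0" using m1 by simp
  have k: "?k \<ge> 0" using g_pos[rule_format, of 0] by simp
  have "norm (A \<xi>) \<le> (1 + g 0) * (?t powr (s - 1) + ?t powr (m - 1))"
    using a_le[of ?t] by (simp add: norm_flux)
  also have "?t powr (s - 1) + ?t powr (m - 1) \<le> 3 * max 1 (?t powr (m - 1))"
  proof (cases "?t \<le> 1")
    case True
    have "?t powr (s-1) \<le> 1" "?t powr (m-1) \<le> 1" using True ms by (auto intro: powr_le1)
    then show ?thesis by linarith
  next
    case False
    have "?t powr (s-1) \<le> ?t powr (m-1)" using False ms by (intro powr_mono) auto
    then show ?thesis by linarith
  qed
  finally have "norm (A \<xi>) \<le> (1 + g 0) * (3 * max 1 (?t powr (m - 1)))"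
    using g_pos[rule_format, of 0] by (simp add: mult_left_mono)
  then have "norm (A \<xi>) \<le> ?k * max 1 (?t powr (m - 1))" by (simp only: ac_simps)
  then have "norm (A \<xi>) powr ?r \<le> (?k * max 1 (?t powr (m - 1))) powr ?r"
    using r by (intro powr_mono2) auto
  also have "\<dots> = ?k powr ?r * (max 1 (?t powr (m - 1))) powr ?r" by (simp add: powr_mult)
  also have "(max 1 (?t powr (m - 1))) powr ?r \<le> 1 + ?t powr m"
    using m1 by (auto simp: max_def powr_powr)
  finally show ?thesis by (simp add: mult_left_mono)
qed

end

text \<open>The free scale \<open>c\<close> moves weight between the two terms. Choosing it
  according to \<open>x\<close> takes the place of Hoelder's inequality in the limits below.\<close>

lemma Young_pointwise:
  fixes x y r c :: real
  assumes r: "r > 1" and "x \<ge> 0" "y \<ge> 0" "c > 0"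
  shows "x * y \<le> c powr (r / (r - 1)) * x powr (r / (r - 1)) + c powr (- r) * y powr r"
proof -
  let ?q = "r / (r - 1)"
  have q: "?q > 1" "1 / ?q + 1 / r = 1" using r by (simp_all add: field_simps)
  have "x * y = (c * x) * (y / c)" using assms by simp
  also have "\<dots> \<le> (c * x) powr ?q / ?q + (y / c) powr r / r"
    by (rule Youngs_inequality[OF q(1) r q(2)]) (use assms in auto)
  also have "\<dots> \<le> (c * x) powr ?q + (y / c) powr r"
  proof (rule add_mono)
    have *: "z / d \<le> z" if "d \<ge> 1" "z \<ge> 0" for z d :: real
      using that by (simp add: divide_le_eq mult_le_cancel_left1)
    show "(c * x) powr ?q / ?q \<le> (c * x) powr ?q" "(y / c) powr r / r \<le> (y / c) powr r"
      using q r by (intro *; simp)+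
  qed
  also have "\<dots> = c powr ?q * x powr ?q + c powr (- r) * y powr r"
    by (simp add: powr_mult powr_divide powr_minus field_simps)
  finally show ?thesis .
qed

lemma Lp_pairing_integrable:
  fixes P R :: "'x \<Rightarrow> 'b::euclidean_space"
  assumes r: "r > 1" and [measurable]: "P \<in> borel_measurable M" "R \<in> borel_measurable M"
    and P: "integrable M (\<lambda>x. norm (P x) powr (r / (r - 1)))" and R: "integrable M (\<lambda>x. norm (R x) powr r)"
  shows "integrable M (\<lambda>x. norm (P x) * norm (R x))"
proof (rule Bochner_Integration.integrable_bound)
  show "integrable M (\<lambda>x. norm (P x) powr (r / (r - 1)) + norm (R x) powr r)" using P R by auto
  show "AE x in M. norm (norm (P x) * norm (R x)) \<le> norm (norm (P x) powr (r / (r - 1)) + norm (R x) powr r)"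
    using Young_pointwise[OF r, of "norm (P _)" "norm (R _)" 1] by (intro AE_I2) auto
qed simp

lemma Lp_pairing_tendsto_0:
  fixes P :: "'x \<Rightarrow> 'b::euclidean_space" and R :: "nat \<Rightarrow> 'x \<Rightarrow> 'b"
  assumes r: "r > 1" and [measurable]: "P \<in> borel_measurable M" "\<And>n. R n \<in> borel_measurable M"
    and P: "integrable M (\<lambda>x. norm (P x) powr (r / (r - 1)))"
    and iR: "\<And>n. integrable M (\<lambda>x. norm (R n x) powr r)"
    and R: "(\<lambda>n. \<integral>x. norm (R n x) powr r \<partial>M) \<longlonglongrightarrow> 0"
  shows "(\<lambda>n. \<integral>x. norm (P x) * norm (R n x) \<partial>M) \<longlonglongrightarrow> 0"
proof (rule LIMSEQ_I)
  fix e :: real assume e: "e > 0"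
  let ?q = "r / (r - 1)"
  define p where "p = (\<integral>x. norm (P x) powr ?q \<partial>M)"
  have p: "p \<ge> 0" by (simp add: p_def)
  have q: "?q > 0" using r by simp
  \<comment> \<open>Keeps the Young term of the fixed factor \<open>P\<close> below
    \<open>e / 2\<close>; the term of \<open>R n\<close> then tends to 0 with this \<open>c\<close>
    fixed.\<close>
  define c where "c = (e / (2 * (p + 1))) powr (1 / ?q)"
  have l: "c > 0" using e p by (simp add: c_def)
  have lq: "c powr ?q * p < e / 2"
  proof -
    have "c powr ?q = e / (2 * (p + 1))" using q e p r unfolding c_def by (simp add: powr_powr)
    moreover have "e / (2 * (p + 1)) * p < e / 2" using e p by (simp add: field_simps)
    ultimately show ?thesis by simp
  qed
  have "eventually (\<lambda>n. (\<integral>x. norm (R n x) powr r \<partial>M) < (e / 2) / c powr (- r)) sequentially"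
    using R e l by (intro order_tendstoD(2)) auto
  then obtain N where N: "\<And>n. n \<ge> N \<Longrightarrow> (\<integral>x. norm (R n x) powr r \<partial>M) < (e / 2) / c powr (- r)"
    unfolding eventually_sequentially by blast
  show "\<exists>N. \<forall>n\<ge>N. norm ((\<integral>x. norm (P x) * norm (R n x) \<partial>M) - 0) < e"
  proof (intro exI[of _ N] allI impI)
    fix n assume "n \<ge> N"
    have "(\<integral>x. norm (P x) * norm (R n x) \<partial>M)
        \<le> (\<integral>x. c powr ?q * norm (P x) powr ?q + c powr (- r) * norm (R n x) powr r \<partial>M)"
      using Lp_pairing_integrable[OF r _ _ P iR] P iR Young_pointwise[OF r _ _ l]
      by (intro integral_mono) auto
    also have "\<dots> = c powr ?q * p + c powr (- r) * (\<integral>x. norm (R n x) powr r \<partial>M)"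
      using P iR by (simp add: p_def)
    also have "\<dots> < e / 2 + e / 2"
      using lq N[OF \<open>n \<ge> N\<close>] l by (intro add_strict_mono) (simp_all add: field_simps)
    finally show "norm ((\<integral>x. norm (P x) * norm (R n x) \<partial>M) - 0) < e" by simp
  qed
qed

text \<open>The limit passage for the comparison principle. The error splits into
  \<open>(\<tau> n - \<theta>) * (P \<bullet> R)\<close>, small by uniform convergence, and
  \<open>\<tau> n * (P \<bullet> (T n - R))\<close>, small by convergence in L^r.\<close>

lemma Lp_pairing_tendsto:
  fixes P R :: "'x \<Rightarrow> 'b::euclidean_space" and T :: "nat \<Rightarrow> 'x \<Rightarrow> 'b" and \<theta> :: "'x \<Rightarrow> real" and \<tau> :: "nat \<Rightarrow> 'x \<Rightarrow> real"
  assumes r: "r > 1" and [measurable]: "P \<in> borel_measurable M" "R \<in> borel_measurable M" "\<And>n. T n \<in> borel_measurable M"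
      "\<theta> \<in> borel_measurable M" "\<And>n. \<tau> n \<in> borel_measurable M"
    and P: "integrable M (\<lambda>x. norm (P x) powr (r / (r - 1)))" and R: "integrable M (\<lambda>x. norm (R x) powr r)"
    and iT: "\<And>n. integrable M (\<lambda>x. norm (T n x - R x) powr r)"
    and T: "(\<lambda>n. \<integral>x. norm (T n x - R x) powr r \<partial>M) \<longlonglongrightarrow> 0"
    and B: "\<And>n x. \<bar>\<tau> n x\<bar> \<le> B" "\<And>x. \<bar>\<theta> x\<bar> \<le> B"
    and e: "\<And>n x. \<bar>\<tau> n x - \<theta> x\<bar> \<le> e n" "e \<longlonglongrightarrow> 0"
  shows "integrable M (\<lambda>x. P x \<bullet> (\<theta> x *\<^sub>R R x))"
    and "(\<lambda>n. \<integral>x. P x \<bullet> (\<tau> n x *\<^sub>R T n x) \<partial>M) \<longlonglongrightarrow> (\<integral>x. P x \<bullet> (\<theta> x *\<^sub>R R x) \<partial>M)"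
proof -
  have B0: "B \<ge> 0" using B(2)[of undefined] by simp
  have iPR: "integrable M (\<lambda>x. norm (P x) * norm (R x))"
    by (rule Lp_pairing_integrable[OF r _ _ P R]) auto
  have iPT: "integrable M (\<lambda>x. norm (P x) * norm (T n x - R x))" for n
    by (rule Lp_pairing_integrable[OF r _ _ P iT]) auto
  have i1: "integrable M (\<lambda>x. P x \<bullet> (\<theta> x *\<^sub>R R x))"
  proof (rule Bochner_Integration.integrable_bound)
    show "integrable M (\<lambda>x. B * (norm (P x) * norm (R x)))" using iPR by auto
    show "AE x in M. norm (P x \<bullet> (\<theta> x *\<^sub>R R x)) \<le> norm (B * (norm (P x) * norm (R x)))"
    proof (intro AE_I2)
      fix x
      have "\<bar>\<theta> x\<bar> * \<bar>P x \<bullet> R x\<bar> \<le> B * (norm (P x) * norm (R x))"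
        using B(2)[of x] Cauchy_Schwarz_ineq2[of "P x" "R x"] B0 by (intro mult_mono) auto
      then show "norm (P x \<bullet> (\<theta> x *\<^sub>R R x)) \<le> norm (B * (norm (P x) * norm (R x)))"
        using B0 by (simp add: abs_mult)
    qed
  qed simp
  from i1 show "integrable M (\<lambda>x. P x \<bullet> (\<theta> x *\<^sub>R R x))" .
  have pt: "norm (P x \<bullet> (\<tau> n x *\<^sub>R T n x) - P x \<bullet> (\<theta> x *\<^sub>R R x))
      \<le> e n * (norm (P x) * norm (R x)) + B * (norm (P x) * norm (T n x - R x))" for n x
  proof -
    have eq: "P x \<bullet> (\<tau> n x *\<^sub>R T n x) - P x \<bullet> (\<theta> x *\<^sub>R R x)
        = (\<tau> n x - \<theta> x) * (P x \<bullet> R x) + \<tau> n x * (P x \<bullet> (T n x - R x))"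
      by (simp add: inner_diff_right algebra_simps)
    have "\<bar>(\<tau> n x - \<theta> x) * (P x \<bullet> R x)\<bar> \<le> e n * (norm (P x) * norm (R x))"
      unfolding abs_mult using e(1)[of n x] Cauchy_Schwarz_ineq2[of "P x" "R x"] by (intro mult_mono) auto
    moreover have "\<bar>\<tau> n x * (P x \<bullet> (T n x - R x))\<bar> \<le> B * (norm (P x) * norm (T n x - R x))"
      unfolding abs_mult using B(1)[of n x] Cauchy_Schwarz_ineq2[of "P x" "T n x - R x"] B0 by (intro mult_mono) auto
    ultimately show ?thesis unfolding eq real_norm_def by linarith
  qed
  have ib: "integrable M (\<lambda>x. e n * (norm (P x) * norm (R x)) + B * (norm (P x) * norm (T n x - R x)))" for n
    using iPR iPT by auto
  have id: "integrable M (\<lambda>x. P x \<bullet> (\<tau> n x *\<^sub>R T n x) - P x \<bullet> (\<theta> x *\<^sub>R R x))" for n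
    by (rule Bochner_Integration.integrable_bound[OF ib[of n]]) (use pt in \<open>auto intro: order_trans[OF _ abs_ge_self]\<close>)
  have "(\<lambda>n. (\<integral>x. P x \<bullet> (\<tau> n x *\<^sub>R T n x) \<partial>M) - (\<integral>x. P x \<bullet> (\<theta> x *\<^sub>R R x) \<partial>M)) \<longlonglongrightarrow> 0"
  proof (rule Lim_null_comparison)
    show "\<forall>\<^sub>F n in sequentially. norm ((\<integral>x. P x \<bullet> (\<tau> n x *\<^sub>R T n x) \<partial>M) - (\<integral>x. P x \<bullet> (\<theta> x *\<^sub>R R x) \<partial>M))
        \<le> e n * (\<integral>x. norm (P x) * norm (R x) \<partial>M) + B * (\<integral>x. norm (P x) * norm (T n x - R x) \<partial>M)"
    proof (intro always_eventually allI)
      fix n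
      have "integrable M (\<lambda>x. (P x \<bullet> (\<tau> n x *\<^sub>R T n x) - P x \<bullet> (\<theta> x *\<^sub>R R x)) + P x \<bullet> (\<theta> x *\<^sub>R R x))"
        using id i1 by (rule Bochner_Integration.integrable_add)
      then have i2: "integrable M (\<lambda>x. P x \<bullet> (\<tau> n x *\<^sub>R T n x))" by simp
      have "norm (\<integral>x. P x \<bullet> (\<tau> n x *\<^sub>R T n x) - P x \<bullet> (\<theta> x *\<^sub>R R x) \<partial>M)
          \<le> (\<integral>x. e n * (norm (P x) * norm (R x)) + B * (norm (P x) * norm (T n x - R x)) \<partial>M)"
        using order_trans[OF integral_norm_bound integral_mono[OF integrable_norm[OF id] ib pt]] .
      then show "norm ((\<integral>x. P x \<bullet> (\<tau> n x *\<^sub>R T n x) \<partial>M) - (\<integral>x. P x \<bullet> (\<theta> x *\<^sub>R R x) \<partial>M))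
        \<le> e n * (\<integral>x. norm (P x) * norm (R x) \<partial>M) + B * (\<integral>x. norm (P x) * norm (T n x - R x) \<partial>M)"
        using i1 i2 iPR iPT[of n] by (simp add: Bochner_Integration.integral_diff)
    qed
    have "(\<lambda>n. e n * (\<integral>x. norm (P x) * norm (R x) \<partial>M) + B * (\<integral>x. norm (P x) * norm (T n x - R x) \<partial>M))
      \<longlonglongrightarrow> 0 * (\<integral>x. norm (P x) * norm (R x) \<partial>M) + B * 0"
      by (intro tendsto_intros e(2) Lp_pairing_tendsto_0[OF r _ _ P iT T]) auto
    then show "(\<lambda>n. e n * (\<integral>x. norm (P x) * norm (R x) \<partial>M) + B * (\<integral>x. norm (P x) * norm (T n x - R x) \<partial>M)) \<longlonglongrightarrow> 0"
      by simp
  qed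
  then show "(\<lambda>n. \<integral>x. P x \<bullet> (\<tau> n x *\<^sub>R T n x) \<partial>M) \<longlonglongrightarrow> (\<integral>x. P x \<bullet> (\<theta> x *\<^sub>R R x) \<partial>M)"
    by (rule LIM_zero_cancel)
qed

lemma integrable_inner_bounded:
  fixes F H :: "'x \<Rightarrow> 'b::euclidean_space"
  assumes F: "integrable M F" and [measurable]: "H \<in> borel_measurable M" and B: "\<And>x. norm (H x) \<le> B"
  shows "integrable M (\<lambda>x. F x \<bullet> H x)"
proof (rule Bochner_Integration.integrable_bound)
  have [measurable]: "F \<in> borel_measurable M" using F by auto
  show "integrable M (\<lambda>x. B * norm (F x))" by (intro integrable_mult_right integrable_norm F)
  show "AE x in M. norm (F x \<bullet> H x) \<le> norm (B * norm (F x))"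
  proof (intro AE_I2)
    fix x
    have "\<bar>F x \<bullet> H x\<bar> \<le> norm (F x) * norm (H x)" by (rule Cauchy_Schwarz_ineq2)
    also have "\<dots> \<le> norm (F x) * \<bar>B\<bar>" using B[of x] by (intro mult_left_mono) auto
    finally show "norm (F x \<bullet> H x) \<le> norm (B * norm (F x))" by (simp add: abs_mult mult.commute)
  qed
  show "(\<lambda>x. F x \<bullet> H x) \<in> borel_measurable M" by measurable
qed

section \<open>Weak supersolutions and the comparison principle\<close>

lemma compact_thickening:
  fixes K :: "'a::euclidean_space set"
  assumes "compact K" "open E" "K \<subseteq> E"
  obtains \<delta> K' where "\<delta> > 0" "compact K'" "K \<subseteq> K'" "K' \<subseteq> E" "\<And>x. x \<in> K \<Longrightarrow> cball x \<delta> \<subseteq> K'"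
proof -
  obtain \<delta> where \<delta>: "\<delta> > 0" "(\<Union>x\<in>K. cball x \<delta>) \<subseteq> E"
    using compact_subset_open_imp_cball_epsilon_subset[OF assms] by metis
  have "(\<Union>x\<in>K. \<Union>y\<in>cball 0 \<delta>. {x + y}) = (\<Union>x\<in>K. cball x \<delta>)"
  proof (intro SUP_cong refl set_eqI)
    fix x z :: 'a
    show "z \<in> (\<Union>y\<in>cball 0 \<delta>. {x + y}) \<longleftrightarrow> z \<in> cball x \<delta>"
      by (auto simp: dist_norm norm_minus_commute intro!: bexI[of _ "z - x"])
  qed
  then have "compact (\<Union>x\<in>K. cball x \<delta>)"
    using compact_sums'[OF assms(1) compact_cball, of 0 \<delta>] by simp
  moreover have "K \<subseteq> (\<Union>x\<in>K. cball x \<delta>)" using \<delta>(1) by force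
  ultimately show ?thesis using that[OF \<delta>(1) _ _ \<delta>(2)] by blast
qed

lemma GDERIV_reflect:
  assumes "GDERIV f (x - y) :> D"
  shows "GDERIV (\<lambda>y. f (x - y)) y :> - (D :: 'a::euclidean_space)"
proof -
  have "((\<lambda>y. x - y) has_derivative (\<lambda>h. - h)) (at y)"
    by (auto intro!: derivative_eq_intros)
  from has_derivative_compose[OF this, of f "\<lambda>h. h \<bullet> D"] assms
  show ?thesis unfolding gderiv_def by simp
qed

lemma smooth_reflect:
  assumes "smooth f" shows "smooth (\<lambda>y::'a::euclidean_space. f (x - y))"
proof -
  have "Ck k (\<lambda>y. f (x - y))" for k
    using assms
  proof (induction k arbitrary: f)
    case 0
    have "continuous_on UNIV (\<lambda>y. x - y)" by (intro continuous_intros)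
    from continuous_on_compose2[OF smooth_continuous[OF 0] this] show ?case by simp
  next
    case (Suc k)
    show ?case
    proof (rule Ck_SucI[OF GDERIV_reflect[OF smooth_GDERIV[OF Suc.prems]]])
      fix b :: 'a assume b: "b \<in> Basis"
      have "Ck k (\<lambda>y. -1 * (grad f (x - y) \<bullet> b))"
        using Suc.IH[OF smooth_grad[OF Suc.prems b]] by (intro Ck_mult Ck_const)
      then show "Ck k (\<lambda>y. - grad f (x - y) \<bullet> b)" by simp
    qed
  qed
  then show ?thesis by (simp add: smooth_def)
qed

text \<open>The right-hand side is frozen as a given continuous function \<open>f\<close>, so
  comparison never meets the nonlocal term. \<open>V\<close> is a Borel representative of the weak
  gradient; since test functions vanish off a compact subset of \<open>E\<close>, the integrals can
  be taken over the whole space.\<close>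

locale weak_supersolution = mixed_operator +
  fixes u f :: "'a::euclidean_space \<Rightarrow> real" and V :: "'a \<Rightarrow> 'a" and E :: "'a set"
  assumes E: "open E"
    and u_cont: "continuous_on E u" and f_cont: "continuous_on E f"
    and V_borel [measurable]: "V \<in> borel_measurable borel"
    and V_Lm: "\<And>K. compact K \<Longrightarrow> K \<subseteq> E \<Longrightarrow> integrable lborel (\<lambda>x. indicator K x * norm (V x) powr m)"
    and weak_grad: "\<And>\<phi>. \<phi> \<in> test_functions E \<Longrightarrow>
      (\<integral>x. u x *\<^sub>R grad \<phi> x \<partial>lborel) = - (\<integral>x. \<phi> x *\<^sub>R V x \<partial>lborel)"
    and weak_ineq: "\<And>\<phi>. \<phi> \<in> test_functions E \<Longrightarrow> (\<And>x. \<phi> x \<ge> 0) \<Longrightarrow>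
      (\<integral>x. flux m s g (V x) \<bullet> grad \<phi> x \<partial>lborel) \<ge> (\<integral>x. f x * \<phi> x \<partial>lborel)"
begin

lemma indicator_continuous_borel:
  fixes h :: "'a \<Rightarrow> 'b::euclidean_space"
  assumes "compact K" "continuous_on K h"
  shows "(\<lambda>x. indicator K x *\<^sub>R h x) \<in> borel_measurable borel"
  using borel_measurable_integrable[OF borel_integrable_compact[OF assms]] by simp

lemma flux_powr_integrable:
  assumes K: "compact K" "K \<subseteq> E"
  shows "integrable lborel (\<lambda>x. norm (indicator K x *\<^sub>R A (V x)) powr (m / (m - 1)))"
proof (rule Bochner_Integration.integrable_bound)
  have [measurable]: "K \<in> sets borel" using K(1) by (rule borel_compact)
  let ?C = "(3 * (1 + g 0)) powr (m / (m - 1))"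
  have "integrable lborel (\<lambda>x. indicator K x :: real)"
    using emeasure_compact_finite[OF K(1)] by (intro integrable_real_indicator) auto
  then show "integrable lborel (\<lambda>x. ?C * (indicator K x + indicator K x * norm (V x) powr m))"
    using V_Lm[OF K] by auto
  show "AE x in lborel. norm (norm (indicator K x *\<^sub>R A (V x)) powr (m / (m - 1)))
      \<le> norm (?C * (indicator K x + indicator K x * norm (V x) powr m))"
  proof (intro AE_I2)
    fix x
    show "norm (norm (indicator K x *\<^sub>R A (V x)) powr (m / (m - 1)))
      \<le> norm (?C * (indicator K x + indicator K x * norm (V x) powr m))"
      using flux_growth[of "V x"] by (cases "x \<in> K") (auto simp: abs_mult)
  qed
  show "(\<lambda>x. norm (indicator K x *\<^sub>R A (V x)) powr (m / (m - 1))) \<in> borel_measurable lborel"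
    by measurable
qed

lemma flux_integrable:
  assumes K: "compact K" "K \<subseteq> E"
  shows "integrable lborel (\<lambda>x. indicator K x *\<^sub>R A (V x))"
proof -
  have [measurable]: "K \<in> sets borel" using K(1) by (rule borel_compact)
  obtain R where R: "K \<subseteq> ball 0 R"
    using bounded_subset_ballD[OF compact_imp_bounded[OF K(1)], of 0] by auto
  show ?thesis
    by (rule integrable_powr_imp_integrable[OF _ _ flux_powr_integrable[OF K], of R])
      (use R m1 in \<open>auto simp: indicator_def\<close>)
qed

text \<open>Test functions of class $C^1$ are uniform limits, with their gradients, of mollifications.\<close>

lemma weak_ineq_C1c:
  assumes \<phi>: "C1c K \<phi> D" and K: "K \<subseteq> E" and pos: "\<And>x. \<phi> x \<ge> 0"
  shows "(\<integral>x. f x * \<phi> x \<partial>lborel) \<le> (\<integral>x. A (V x) \<bullet> D x \<partial>lborel)"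
proof -
  note C = C1cD[OF \<phi>]
  have [measurable]: "\<phi> \<in> borel_measurable borel" "D \<in> borel_measurable borel"
    using C(3,4) borel_measurable_continuous_onI by blast+
  have i\<phi>: "integrable lborel \<phi>" using continuous_compact_support_integrable[OF C(4,1,5)] .
  have iD: "integrable lborel D" using continuous_compact_support_integrable[OF C(3,1,6)] .
  obtain \<delta>0 K' where K': "\<delta>0 > 0" "compact K'" "K \<subseteq> K'" "K' \<subseteq> E" "\<And>x. x \<in> K \<Longrightarrow> cball x \<delta>0 \<subseteq> K'"
    using compact_thickening[OF C(1) E K] by metis
  have [measurable]: "K' \<in> sets borel" using K'(2) by (rule borel_compact)
  let ?F = "\<lambda>x. indicator K' x *\<^sub>R A (V x)" and ?f = "\<lambda>x. indicator K' x * f x"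
  have iF: "integrable lborel ?F" by (rule flux_integrable[OF K'(2,4)])
  have if': "integrable lborel ?f"
    using borel_integrable_compact[OF K'(2) continuous_on_subset[OF f_cont K'(4)]] by simp
  define M where "M = (\<integral>x. norm (?F x) \<partial>lborel) + (\<integral>x. \<bar>?f x\<bar> \<partial>lborel)"
  have M0: "M \<ge> 0" by (simp add: M_def)
  have step: "(\<integral>x. f x * \<phi> x \<partial>lborel) \<le> (\<integral>x. A (V x) \<bullet> D x \<partial>lborel) + e * M" if e: "e > 0" for e
  proof -
    obtain d1 where d1: "d1 > 0" "\<And>x y. dist y x < d1 \<Longrightarrow> dist (\<phi> y) (\<phi> x) < e"
      using continuous_compact_support_uniform[OF C(4,1,5)] e unfolding uniformly_continuous_on_def by (metis UNIV_I)
    obtain d2 where d2: "d2 > 0" "\<And>x y. dist y x < d2 \<Longrightarrow> dist (D y) (D x) < e"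
      using continuous_compact_support_uniform[OF C(3,1,6)] e unfolding uniformly_continuous_on_def by (metis UNIV_I)
    define \<delta> where "\<delta> = min \<delta>0 (min (d1/2) (d2/2))"
    have \<delta>: "\<delta> > 0" "\<delta> \<le> \<delta>0" "\<delta> < d1" "\<delta> < d2" using K'(1) d1(1) d2(1) by (auto simp: \<delta>_def)
    obtain \<eta> :: "'a \<Rightarrow> real" where \<eta>: "mollifier \<delta> \<eta>" using mollifier_exists[OF \<delta>(1)] .
    have [measurable]: "\<eta> \<in> borel_measurable borel" using mollifierD(8)[OF \<eta>] .
    define \<psi> where "\<psi> = cv \<phi> \<eta>"
    have s\<psi>: "smooth \<psi>" unfolding \<psi>_def
      by (rule cv_smooth[OF i\<phi> compact_cball mollifierD(1,3)[OF \<eta>]])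
    have g\<psi>: "grad \<psi> x = cv D \<eta> x" for x
    proof (rule grad_eq)
      have "\<psi> = cv \<eta> \<phi>" unfolding \<psi>_def using cv_commute[of \<phi> \<eta>] by auto
      moreover have "cv D \<eta> x = (\<integral>y. \<eta> y *\<^sub>R D (x - y) \<partial>lborel)"
        using lborel_integral_reflect[of "\<lambda>y. \<eta> y *\<^sub>R D (x - y)" x] by (simp add: cv_def)
      ultimately show "GDERIV \<psi> x :> cv D \<eta> x" using cv_GDERIV[OF mollifierD(6)[OF \<eta>] \<phi>] by simp
    qed
    have out: "\<psi> x = 0 \<and> grad \<psi> x = 0" if "x \<notin> K'" for x
    proof -
      have "y \<notin> K" if "dist y x \<le> \<delta>" for y
      proof
        assume "y \<in> K"
        moreover have "x \<in> cball y \<delta>0" using that \<delta>(2) by simp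
        ultimately show False using K'(5) \<open>x \<notin> K'\<close> by blast
      qed
      then have "\<And>y. dist y x \<le> \<delta> \<Longrightarrow> \<phi> y = 0" "\<And>y. dist y x \<le> \<delta> \<Longrightarrow> D y = 0" using C(5,6) by auto
      then show ?thesis unfolding g\<psi> unfolding \<psi>_def
        using cv_eq_0[OF \<eta>, of x \<phi>] cv_eq_0[OF \<eta>, of x D] by simp
    qed
    have \<psi>0: "\<psi> x \<ge> 0" for x
      unfolding \<psi>_def cv_def using pos mollifierD(2)[OF \<eta>] by (intro Bochner_Integration.integral_nonneg) simp
    have c1: "\<bar>\<psi> x - \<phi> x\<bar> \<le> e" for x
      unfolding \<psi>_def real_norm_def[symmetric]
    proof (rule cv_continuous_close[OF \<eta> i\<phi>])
      fix y assume "dist y x \<le> \<delta>"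
      then show "norm (\<phi> y - \<phi> x) \<le> e" using d1(2)[of y x] \<delta> by (simp add: dist_norm)
    qed
    have c2: "norm (grad \<psi> x - D x) \<le> e" for x
      unfolding g\<psi>
    proof (rule cv_continuous_close[OF \<eta> iD])
      fix y assume "dist y x \<le> \<delta>"
      then show "norm (D y - D x) \<le> e" using d2(2)[of y x] \<delta> by (simp add: dist_norm)
    qed
    have C\<psi>: "C1c K' \<psi> (grad \<psi>)" using s\<psi> K'(2) out by (intro smooth_C1c) auto
    have test: "\<psi> \<in> test_functions E" using out by (intro test_functionI[OF s\<psi> K'(2,4)]) auto
    have eqf: "f x * h x = ?f x * h x" if "x \<notin> K' \<Longrightarrow> h x = 0" for x h using that by (cases "x \<in> K'") auto
    have eqF: "A (V x) \<bullet> H x = ?F x \<bullet> H x" if "x \<notin> K' \<Longrightarrow> H x = 0" for x H using that by (cases "x \<in> K'") auto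
    have bound: "integrable lborel (\<lambda>x. ?f x * h x)" if h: "continuous_on UNIV h" "\<And>x. x \<notin> K' \<Longrightarrow> h x = 0" for h
    proof -
      obtain B where "\<And>x. norm (h x) \<le> B" using continuous_compact_support_bounded[OF h(1) K'(2) h(2)] by metis
      then show ?thesis using integrable_bounded_mult'[OF if', of h B] h(1) borel_measurable_continuous_onI by auto
    qed
    have boundF: "integrable lborel (\<lambda>x. ?F x \<bullet> H x)" if h: "continuous_on UNIV H" "\<And>x. x \<notin> K' \<Longrightarrow> H x = 0" for H
    proof -
      obtain B where B: "\<And>x. norm (H x) \<le> B" using continuous_compact_support_bounded[OF h(1) K'(2) h(2)] by metis
      have [measurable]: "H \<in> borel_measurable borel" using h(1) borel_measurable_continuous_onI by auto
      show ?thesis by (rule integrable_inner_bounded[OF iF _ B]) simp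
    qed
    have z: "x \<notin> K' \<Longrightarrow> \<phi> x = 0" "x \<notin> K' \<Longrightarrow> D x = 0" for x using C(5,6) K'(3) by blast+
    have I: "integrable lborel (\<lambda>x. ?f x * \<phi> x)" "integrable lborel (\<lambda>x. ?f x * \<psi> x)"
      "integrable lborel (\<lambda>x. ?F x \<bullet> D x)" "integrable lborel (\<lambda>x. ?F x \<bullet> grad \<psi> x)"
      using bound[OF C(4)] bound[OF C1cD(4)[OF C\<psi>]] boundF[OF C(3)] boundF[OF C1cD(3)[OF C\<psi>]] z out by blast+
    have "(\<integral>x. ?f x * \<phi> x \<partial>lborel) - (\<integral>x. ?f x * \<psi> x \<partial>lborel) = (\<integral>x. ?f x * (\<phi> x - \<psi> x) \<partial>lborel)"
      using I by (simp add: right_diff_distrib Bochner_Integration.integral_diff)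
    also have "\<dots> \<le> (\<integral>x. e * \<bar>?f x\<bar> \<partial>lborel)"
    proof (rule integral_mono)
      show "integrable lborel (\<lambda>x. ?f x * (\<phi> x - \<psi> x))" using I by (simp add: right_diff_distrib)
      show "integrable lborel (\<lambda>x. e * \<bar>?f x\<bar>)" using if' by auto
      fix x
      have "?f x * (\<phi> x - \<psi> x) \<le> \<bar>?f x\<bar> * \<bar>\<phi> x - \<psi> x\<bar>" by (metis abs_ge_self abs_mult)
      also have "\<dots> \<le> \<bar>?f x\<bar> * e" using c1[of x] by (intro mult_left_mono) (auto simp: abs_minus_commute)
      finally show "?f x * (\<phi> x - \<psi> x) \<le> e * \<bar>?f x\<bar>" by (simp add: mult.commute)
    qed
    finally have 1: "(\<integral>x. ?f x * \<phi> x \<partial>lborel) \<le> (\<integral>x. ?f x * \<psi> x \<partial>lborel) + e * (\<integral>x. \<bar>?f x\<bar> \<partial>lborel)" by simp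
    have "(\<integral>x. ?F x \<bullet> grad \<psi> x \<partial>lborel) - (\<integral>x. ?F x \<bullet> D x \<partial>lborel) = (\<integral>x. ?F x \<bullet> (grad \<psi> x - D x) \<partial>lborel)"
      using I by (simp add: inner_diff_right Bochner_Integration.integral_diff)
    also have "\<dots> \<le> (\<integral>x. e * norm (?F x) \<partial>lborel)"
    proof (rule integral_mono)
      show "integrable lborel (\<lambda>x. ?F x \<bullet> (grad \<psi> x - D x))" using I by (simp add: inner_diff_right)
      show "integrable lborel (\<lambda>x. e * norm (?F x))" by (intro integrable_mult_right integrable_norm iF)
      fix x
      have "?F x \<bullet> (grad \<psi> x - D x) \<le> norm (?F x) * norm (grad \<psi> x - D x)" by (rule norm_cauchy_schwarz)
      also have "\<dots> \<le> norm (?F x) * e" using c2[of x] by (intro mult_left_mono) auto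
      finally show "?F x \<bullet> (grad \<psi> x - D x) \<le> e * norm (?F x)" by (simp add: mult.commute)
    qed
    finally have 2: "(\<integral>x. ?F x \<bullet> grad \<psi> x \<partial>lborel) \<le> (\<integral>x. ?F x \<bullet> D x \<partial>lborel) + e * (\<integral>x. norm (?F x) \<partial>lborel)" by simp
    have "(\<integral>x. f x * \<psi> x \<partial>lborel) = (\<integral>x. ?f x * \<psi> x \<partial>lborel)" "(\<integral>x. f x * \<phi> x \<partial>lborel) = (\<integral>x. ?f x * \<phi> x \<partial>lborel)"
      "(\<integral>x. A (V x) \<bullet> grad \<psi> x \<partial>lborel) = (\<integral>x. ?F x \<bullet> grad \<psi> x \<partial>lborel)" "(\<integral>x. A (V x) \<bullet> D x \<partial>lborel) = (\<integral>x. ?F x \<bullet> D x \<partial>lborel)"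
      using eqf[of _ \<psi>] eqf[of _ \<phi>] eqF[of _ "grad \<psi>"] eqF[of _ D] out z
      by (intro Bochner_Integration.integral_cong refl; blast)+
    then show ?thesis
      using weak_ineq[OF test \<psi>0] 1 2 unfolding M_def by (simp add: algebra_simps)
  qed
  show ?thesis
  proof (rule field_le_epsilon)
    fix e :: real assume e: "e > 0"
    have "(e / (M + 1)) * M \<le> e" using e M0 by (simp add: field_simps)
    then show "(\<integral>x. f x * \<phi> x \<partial>lborel) \<le> (\<integral>x. A (V x) \<bullet> D x \<partial>lborel) + e"
      using step[of "e / (M + 1)"] e M0 by (smt (verit) divide_pos_pos)
  qed
qed

text \<open>The weak gradient is tested with \<open>\<lambda>y. \<eta> (x - y)\<close>, which is
  supported in \<open>cball x \<delta>\<close>. There the indicator of \<open>K\<close> equals 1, so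
  truncation to \<open>K\<close>, needed for integrability, changes nothing.\<close>

lemma cv_weak_grad:
  assumes K: "compact K" "K \<subseteq> E" and \<eta>: "mollifier \<delta> \<eta>" and x: "cball x \<delta> \<subseteq> K"
  shows "GDERIV (cv (\<lambda>y. indicator K y * u y) \<eta>) x :> cv (\<lambda>y. indicator K y *\<^sub>R V y) \<eta> x"
proof -
  have iu: "integrable lborel (\<lambda>y. indicator K y * u y)"
    using borel_integrable_compact[OF K(1) continuous_on_subset[OF u_cont K(2)]] by simp
  have out: "\<eta> (x - y) = 0 \<and> grad \<eta> (x - y) = 0" if "y \<notin> cball x \<delta>" for y
  proof -
    have "x - y \<notin> cball 0 \<delta>" using that unfolding mem_cball_0 by (simp add: dist_norm)
    then show ?thesis using C1cD(5,6)[OF mollifierD(7)[OF \<eta>]] by blast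
  qed
  have g: "grad (\<lambda>y. \<eta> (x - y)) y = - grad \<eta> (x - y)" for y
    by (rule grad_eq[OF GDERIV_reflect[OF smooth_GDERIV[OF mollifierD(1)[OF \<eta>]]]])
  have "(\<lambda>y. \<eta> (x - y)) \<in> test_functions E"
    using out K x by (intro test_functionI[OF smooth_reflect[OF mollifierD(1)[OF \<eta>]], of "cball x \<delta>"]) auto
  from weak_grad[OF this]
  have "(\<integral>y. u y *\<^sub>R - grad \<eta> (x - y) \<partial>lborel) = - (\<integral>y. \<eta> (x - y) *\<^sub>R V y \<partial>lborel)" unfolding g .
  then have "(\<integral>y. u y *\<^sub>R grad \<eta> (x - y) \<partial>lborel) = (\<integral>y. \<eta> (x - y) *\<^sub>R V y \<partial>lborel)" by simp
  moreover have "u y *\<^sub>R grad \<eta> (x - y) = (indicator K y * u y) *\<^sub>R grad \<eta> (x - y)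
    \<and> \<eta> (x - y) *\<^sub>R V y = \<eta> (x - y) *\<^sub>R (indicator K y *\<^sub>R V y)" for y
  proof (cases "y \<in> K")
    case False
    then have "y \<notin> cball x \<delta>" using x by blast
    then show ?thesis using out[of y] by simp
  qed simp
  ultimately have "(\<integral>y. (indicator K y * u y) *\<^sub>R grad \<eta> (x - y) \<partial>lborel) = cv (\<lambda>y. indicator K y *\<^sub>R V y) \<eta> x"
    unfolding cv_def by simp
  then show ?thesis using cv_GDERIV[OF iu mollifierD(7)[OF \<eta>], of x] by simp
qed

end

text \<open>The positive part itself is not differentiable at 0; its square is C^1 and therefore
  yields test functions of the form \<open>C1c\<close>.\<close>

lemma DERIV_pos_part_square: "DERIV (\<lambda>t::real. (max 0 t)\<^sup>2) t :> 2 * max 0 t"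
proof -
  consider "t > 0" | "t < 0" | "t = 0" by linarith
  then show ?thesis
  proof cases
    case 1
    have "DERIV (\<lambda>t::real. t\<^sup>2) t :> 2 * max 0 t" using 1 by (auto intro!: derivative_eq_intros)
    then show ?thesis
      by (rule has_field_derivative_transform_within_open[of _ _ _ "{0<..}"]) (use 1 in auto)
  next
    case 2
    have "DERIV (\<lambda>t::real. 0) t :> 2 * max 0 t" using 2 by auto
    then show ?thesis
      by (rule has_field_derivative_transform_within_open[of _ _ _ "{..<0}"]) (use 2 in auto)
  next
    case 3
    have "(\<lambda>h::real. (max 0 h)\<^sup>2 / h) \<midarrow>0\<rightarrow> 0"
    proof (rule Lim_null_comparison)
      show "\<forall>\<^sub>F h in at 0. norm ((max 0 h)\<^sup>2 / h) \<le> \<bar>h::real\<bar>"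
        by (intro always_eventually) (auto simp: max_def power2_eq_square)
      show "((\<lambda>h. \<bar>h\<bar>) \<longlongrightarrow> 0) (at (0::real))"
        by (rule tendsto_eq_intros | simp)+
    qed
    then show ?thesis using 3 by (simp add: DERIV_def)
  qed
qed

lemma powr_diff_integrable:
  fixes X Y :: "'x \<Rightarrow> 'b::euclidean_space"
  assumes r: "r > 0" and [measurable]: "X \<in> borel_measurable M" "Y \<in> borel_measurable M"
    and X: "integrable M (\<lambda>x. norm (X x) powr r)" and Y: "integrable M (\<lambda>x. norm (Y x) powr r)"
  shows "integrable M (\<lambda>x. norm (X x - Y x) powr r)"
proof (rule Bochner_Integration.integrable_bound)
  show "integrable M (\<lambda>x. 3 powr r * (norm (X x) powr r + norm (Y x) powr r))" using X Y by auto
  show "AE x in M. norm (norm (X x - Y x) powr r) \<le> norm (3 powr r * (norm (X x) powr r + norm (Y x) powr r))"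
  proof (intro AE_I2)
    fix x
    have "norm (X x - Y x) powr r \<le> (norm (X x) + norm (Y x) + 0) powr r"
      using r by (intro powr_mono2) (auto simp: norm_triangle_ineq4)
    then show "norm (norm (X x - Y x) powr r) \<le> norm (3 powr r * (norm (X x) powr r + norm (Y x) powr r))"
      using powr_add3_le[of "norm (X x)" "norm (Y x)" 0 r] r by (simp add: abs_mult)
  qed
qed measurable

lemma compact_powr_integrable:
  fixes X :: "'a::euclidean_space \<Rightarrow> 'b::euclidean_space"
  assumes K: "compact K" and X: "continuous_on K X" and r: "r > 0"
  shows "integrable lborel (\<lambda>x. norm (indicator K x *\<^sub>R X x) powr r)"
proof -
  have "continuous_on K (\<lambda>x. norm (X x) powr r)"
    using X r by (intro continuous_on_powr' continuous_intros) auto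
  from borel_integrable_compact[OF K this]
  have "integrable lborel (\<lambda>x. indicator K x * norm (X x) powr r)" by simp
  moreover have "norm (indicator K x *\<^sub>R X x) powr r = indicator K x * norm (X x) powr r" for x
    by (cases "x \<in> K") auto
  ultimately show ?thesis by simp
qed

context weak_supersolution
begin

text \<open>One kernel has to serve for both approximations, because the mollified weak gradient
  must be the gradient of the mollified function.\<close>

lemma mollified_pair:
  assumes S: "compact S" "S \<subseteq> E" and K': "\<delta>0 > 0" "compact K'" "K' \<subseteq> E"
    and S': "\<And>x. x \<in> S \<Longrightarrow> cball x \<delta>0 \<subseteq> K'" and e: "e > 0"
  shows "\<exists>\<delta> \<eta>. mollifier \<delta> \<eta> \<and> \<delta> \<le> \<delta>0 \<and> (\<forall>x\<in>S. \<bar>cv (\<lambda>y. indicator K' y * u y) \<eta> x - u x\<bar> \<le> e) \<and>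
     (\<integral>\<^sup>+x. ennreal (norm (cv (\<lambda>y. indicator K' y *\<^sub>R V y) \<eta> x - indicator K' x *\<^sub>R V x) powr m) \<partial>lborel) < ennreal e"
proof -
  have [measurable]: "K' \<in> sets borel" using K'(2) by (rule borel_compact)
  have iu: "integrable lborel (\<lambda>y. indicator K' y * u y)"
    using borel_integrable_compact[OF K'(2) continuous_on_subset[OF u_cont K'(3)]] by simp
  obtain R where R: "K' \<subseteq> ball 0 R"
    using bounded_subset_ballD[OF compact_imp_bounded[OF K'(2)], of 0] by auto
  have eq: "norm (indicator K' x *\<^sub>R V x) powr m = indicator K' x * norm (V x) powr m" for x
    by (cases "x \<in> K'") auto
  have iV: "integrable lborel (\<lambda>x. norm (indicator K' x *\<^sub>R V x) powr m)"
    unfolding eq by (rule V_Lm[OF K'(2,3)])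
  obtain \<delta>1 where \<delta>1: "\<delta>1 > 0" "\<And>\<delta> \<eta>. \<delta> \<le> \<delta>1 \<Longrightarrow> mollifier \<delta> \<eta> \<Longrightarrow>
      (\<integral>\<^sup>+x. ennreal (norm (cv (\<lambda>y. indicator K' y *\<^sub>R V y) \<eta> x - indicator K' x *\<^sub>R V x) powr m) \<partial>lborel) < ennreal e"
    by (rule Lm_mollify[OF _ m1 e iV, of R]) (use R in \<open>auto simp: indicator_def\<close>)
  have "uniformly_continuous_on K' u"
    using K'(2) continuous_on_subset[OF u_cont K'(3)] by (rule compact_uniformly_continuous[rotated])
  then obtain d where d: "d > 0" "\<And>x y. x \<in> K' \<Longrightarrow> y \<in> K' \<Longrightarrow> dist y x < d \<Longrightarrow> dist (u y) (u x) < e"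
    using e unfolding uniformly_continuous_on_def by metis
  define \<delta> where "\<delta> = min \<delta>0 (min \<delta>1 (d/2))"
  have \<delta>: "\<delta> > 0" "\<delta> \<le> \<delta>0" "\<delta> \<le> \<delta>1" "\<delta> < d" using K'(1) \<delta>1(1) d(1) by (auto simp: \<delta>_def)
  obtain \<eta> :: "'a \<Rightarrow> real" where \<eta>: "mollifier \<delta> \<eta>" using mollifier_exists[OF \<delta>(1)] .
  have "\<bar>cv (\<lambda>y. indicator K' y * u y) \<eta> x - u x\<bar> \<le> e" if x: "x \<in> S" for x
    unfolding real_norm_def[symmetric]
  proof (rule cv_continuous_close[OF \<eta> iu])
    fix y assume y: "dist y x \<le> \<delta>"
    have "y \<in> cball x \<delta>0" "x \<in> cball x \<delta>0" using y \<delta> by (auto simp: dist_commute)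
    then have "x \<in> K'" "y \<in> K'" using S'[OF x] by blast+
    then show "norm (indicator K' y * u y - u x) \<le> e" using d(2)[of x y] y \<delta> by (simp add: dist_norm)
  qed
  then show ?thesis using \<eta> \<delta> \<delta>1(2) by blast
qed

text \<open>Testing with smooth approximations of the square of the positive part of \<open>z - u - 2\<epsilon>\<close>
  and strict monotonicity of the flux give \<open>Z = V\<close> where that function is positive;
  it then has integral zero.\<close>

theorem comparison:
  assumes \<Omega>: "open \<Omega>" "bounded \<Omega>" "closure \<Omega> \<subseteq> E"
    and z: "continuous_on (closure \<Omega>) z" "\<And>x. x \<in> \<Omega> \<Longrightarrow> GDERIV z x :> Z x" "continuous_on \<Omega> Z"
    and G: "\<And>x. x \<in> \<Omega> \<Longrightarrow> A (Z x) = G x"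
      "\<And>x b. x \<in> \<Omega> \<Longrightarrow> b \<in> Basis \<Longrightarrow> GDERIV (\<lambda>x. G x \<bullet> b) x :> H b x"
      "\<And>b. b \<in> Basis \<Longrightarrow> continuous_on \<Omega> (H b)"
    and sub: "\<And>x. x \<in> \<Omega> \<Longrightarrow> - (\<Sum>b\<in>Basis. H b x \<bullet> b) \<le> f x"
    and bd: "\<And>x. x \<in> frontier \<Omega> \<Longrightarrow> z x \<le> u x" and x0: "x0 \<in> \<Omega>"
  shows "z x0 \<le> u x0"
proof (rule ccontr)
  assume neg: "\<not> z x0 \<le> u x0"
  \<comment> \<open>\<open>w x0\<close> equals \<open>8 * \<epsilon>\<close>. Level
    \<open>\<epsilon>\<close> defines the compact set \<open>K\<close>, level
    \<open>2 * \<epsilon>\<close> the truncation, and level \<open>4 * \<epsilon>\<close> the ball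
    used at the end; the gaps absorb mollification errors of at most
    \<open>\<epsilon>\<close>.\<close>
  define \<epsilon> where "\<epsilon> = (z x0 - u x0) / 8"
  have \<epsilon>: "\<epsilon> > 0" using neg by (simp add: \<epsilon>_def)
  define w where "w = (\<lambda>x. z x - u x)"
  have cw: "continuous_on (closure \<Omega>) w" unfolding w_def
    by (intro continuous_on_diff z(1) continuous_on_subset[OF u_cont \<Omega>(3)])
  have cpt: "compact (closure \<Omega>)" using \<Omega>(2) by (simp add: compact_closure)
  define K where "K = {x \<in> closure \<Omega>. \<epsilon> \<le> w x}"
  have "closed K" unfolding K_def
    using cw by (intro continuous_on_closed_Collect_le continuous_on_const) auto
  then have K: "compact K" using cpt by (auto simp: K_def compact_eq_bounded_closed intro: bounded_subset)
  have K\<Omega>: "K \<subseteq> \<Omega>"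
  proof
    fix x assume x: "x \<in> K"
    then have "x \<notin> frontier \<Omega>" using bd[of x] \<epsilon> by (auto simp: K_def w_def)
    then show "x \<in> \<Omega>" using x closure_Un_frontier[of \<Omega>] by (auto simp: K_def)
  qed
  have [measurable]: "K \<in> sets borel" "\<Omega> \<in> sets borel" using K \<Omega>(1) by (auto intro: borel_compact)
  have \<Omega>c: "\<Omega> \<subseteq> closure \<Omega>" by (rule closure_subset)
  obtain \<delta>0 K' where K': "\<delta>0 > 0" "compact K'" "closure \<Omega> \<subseteq> K'" "K' \<subseteq> E"
    "\<And>x. x \<in> closure \<Omega> \<Longrightarrow> cball x \<delta>0 \<subseteq> K'"
    using compact_thickening[OF cpt E \<Omega>(3)] by metis
  have [measurable]: "K' \<in> sets borel" using K'(2) by (rule borel_compact)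
  have KK': "K \<subseteq> K'" using K\<Omega> \<Omega>c K'(3) by blast
  have KE: "K \<subseteq> E" using KK' K'(4) by blast
  define U where "U = (\<lambda>y. indicator K' y * u y)"
  define V' where "V' = (\<lambda>y. indicator K' y *\<^sub>R V y)"
  have [measurable]: "V' \<in> borel_measurable borel" unfolding V'_def by measurable
  have iU: "integrable lborel U" unfolding U_def
    using borel_integrable_compact[OF K'(2) continuous_on_subset[OF u_cont K'(4)]] by simp
  define e where "e = (\<lambda>n::nat. min \<epsilon> (1 / real (Suc n)))"
  have e: "e n > 0" "e n \<le> \<epsilon>" for n using \<epsilon> by (auto simp: e_def)
  have e0: "e \<longlonglongrightarrow> 0"
  proof (rule Lim_null_comparison)
    show "\<forall>\<^sub>F n in sequentially. norm (e n) \<le> 1 / real (Suc n)"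
      using e by (intro always_eventually) (auto simp: e_def)
    show "(\<lambda>n. 1 / real (Suc n)) \<longlonglongrightarrow> 0" using LIMSEQ_inverse_real_of_nat by (simp add: inverse_eq_divide)
  qed
  have "\<forall>n. \<exists>\<delta> \<eta>. mollifier \<delta> \<eta> \<and> \<delta> \<le> \<delta>0 \<and> (\<forall>x\<in>closure \<Omega>. \<bar>cv U \<eta> x - u x\<bar> \<le> e n) \<and>
     (\<integral>\<^sup>+x. ennreal (norm (cv V' \<eta> x - V' x) powr m) \<partial>lborel) < ennreal (e n)"
    unfolding U_def V'_def using mollified_pair[OF cpt \<Omega>(3) K'(1,2,4,5) e(1)] by blast
  from choice[OF this] obtain \<delta> where
    "\<forall>n. \<exists>\<eta>. mollifier (\<delta> n) \<eta> \<and> \<delta> n \<le> \<delta>0 \<and> (\<forall>x\<in>closure \<Omega>. \<bar>cv U \<eta> x - u x\<bar> \<le> e n) \<and>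
     (\<integral>\<^sup>+x. ennreal (norm (cv V' \<eta> x - V' x) powr m) \<partial>lborel) < ennreal (e n)" by blast
  from choice[OF this] obtain \<eta> where \<eta>: "\<And>n. mollifier (\<delta> n) (\<eta> n)" "\<And>n. \<delta> n \<le> \<delta>0"
    "\<And>n x. x \<in> closure \<Omega> \<Longrightarrow> \<bar>cv U (\<eta> n) x - u x\<bar> \<le> e n"
    "\<And>n. (\<integral>\<^sup>+x. ennreal (norm (cv V' (\<eta> n) x - V' x) powr m) \<partial>lborel) < ennreal (e n)"
    by blast
  have [measurable]: "\<eta> n \<in> borel_measurable borel" for n using mollifierD(8)[OF \<eta>(1)] .
  have [measurable]: "cv V' (\<eta> n) \<in> borel_measurable borel" for n by (rule cv_borel_measurable) auto
  define W where "W = (\<lambda>n x. z x - cv U (\<eta> n) x)"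
  define Dw where "Dw = (\<lambda>n x. Z x - cv V' (\<eta> n) x)"
  have gU: "GDERIV (cv U (\<eta> n)) x :> cv V' (\<eta> n) x" if "x \<in> \<Omega>" for n x
    unfolding U_def V'_def
  proof (rule cv_weak_grad[OF K'(2,4) \<eta>(1)])
    have "x \<in> closure \<Omega>" using that \<Omega>c by blast
    then show "cball x (\<delta> n) \<subseteq> K'" using K'(5)[of x] \<eta>(2)[of n] subset_cball[of "\<delta> n" \<delta>0 x] by blast
  qed
  have gW: "GDERIV (W n) x :> Dw n x" if "x \<in> \<Omega>" for n x
    unfolding W_def Dw_def by (rule GDERIV_diff[OF z(2)[OF that] gU[OF that]])
  have cW: "continuous_on \<Omega> (W n)" for n
    using gW GDERIV_continuous by (blast intro: continuous_at_imp_continuous_on)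
  have cDw: "continuous_on \<Omega> (Dw n)" for n
  proof -
    have "smooth (cv U (\<eta> n))" by (rule cv_smooth[OF iU compact_cball mollifierD(1,3)[OF \<eta>(1)]])
    then have "continuous_on \<Omega> (grad (cv U (\<eta> n)))" using smooth_grad_continuous continuous_on_subset by blast
    moreover have "grad (cv U (\<eta> n)) x = cv V' (\<eta> n) x" if "x \<in> \<Omega>" for x using grad_eq[OF gU[OF that]] .
    ultimately have "continuous_on \<Omega> (cv V' (\<eta> n))" by (simp cong: continuous_on_cong)
    then show ?thesis unfolding Dw_def using z(3) by (intro continuous_on_diff)
  qed
  have Ww: "\<bar>W n x - w x\<bar> \<le> e n" if "x \<in> \<Omega>" for n x
    using \<eta>(3)[of x n] that \<Omega>c by (auto simp: W_def w_def)
  \<comment> \<open>\<open>\<tau> n\<close> is the derivative of the squared positive part, so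
    \<open>\<tau> n\<close> times \<open>T n\<close> is the gradient of the test function
    \<open>\<psi> n\<close>; \<open>\<theta>\<close> and \<open>R\<close> are the limits of the two
    factors.\<close>
  define \<tau> where "\<tau> = (\<lambda>n x. indicator \<Omega> x *\<^sub>R (2 * max 0 (W n x - 2 * \<epsilon>)))"
  define \<theta> where "\<theta> = (\<lambda>x. indicator \<Omega> x *\<^sub>R (2 * max 0 (w x - 2 * \<epsilon>)))"
  have [measurable]: "\<tau> n \<in> borel_measurable borel" for n
    unfolding \<tau>_def by (intro borel_measurable_continuous_on_indicator continuous_intros cW) auto
  have [measurable]: "\<theta> \<in> borel_measurable borel"
    unfolding \<theta>_def by (intro borel_measurable_continuous_on_indicator continuous_intros continuous_on_subset[OF cw \<Omega>c]) auto
  have small: "W n x - 2 * \<epsilon> < 0" if "x \<in> \<Omega>" "x \<notin> K" for n x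
  proof -
    have "w x < \<epsilon>" using that \<Omega>c by (auto simp: K_def)
    then show ?thesis using Ww[OF that(1), of n] e(2)[of n] by linarith
  qed
  have small': "w x - 2 * \<epsilon> < 0" if "x \<in> \<Omega>" "x \<notin> K" for x
    using that \<Omega>c \<epsilon> by (auto simp: K_def)
  have \<tau>0: "\<tau> n x = 0" if "x \<notin> K" for n x
    using small[of x n] that by (cases "x \<in> \<Omega>") (auto simp: \<tau>_def)
  have \<theta>0: "\<theta> x = 0" if "x \<notin> K" for x
    using small'[of x] that by (cases "x \<in> \<Omega>") (auto simp: \<theta>_def)
  obtain B0 where B0: "\<And>x. x \<in> closure \<Omega> \<Longrightarrow> \<bar>w x\<bar> \<le> B0"
    using compact_imp_bounded[OF compact_continuous_image[OF cw cpt]] unfolding bounded_iff by auto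
  define B where "B = 2 * (\<bar>B0\<bar> + \<epsilon>)"
  have \<tau>B: "\<bar>\<tau> n x\<bar> \<le> B" for n x
  proof (cases "x \<in> \<Omega>")
    case True
    then have "\<bar>w x\<bar> \<le> \<bar>B0\<bar>" using B0[of x] \<Omega>c by fastforce
    then have "max 0 (W n x - 2 * \<epsilon>) \<le> \<bar>B0\<bar> + \<epsilon>"
      using Ww[OF True, of n] e(2)[of n] \<epsilon> by (intro max.boundedI) linarith+
    then show ?thesis using True by (simp add: \<tau>_def B_def del: max.bounded_iff)
  qed (use \<epsilon> in \<open>auto simp: \<tau>_def B_def\<close>)
  have \<theta>B: "\<bar>\<theta> x\<bar> \<le> B" for x
  proof (cases "x \<in> \<Omega>")
    case True
    then have "\<bar>w x\<bar> \<le> \<bar>B0\<bar>" using B0[of x] \<Omega>c by fastforce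
    then have "max 0 (w x - 2 * \<epsilon>) \<le> \<bar>B0\<bar> + \<epsilon>"
      using \<epsilon> by (intro max.boundedI) linarith+
    then show ?thesis using True by (simp add: \<theta>_def B_def del: max.bounded_iff)
  qed (use \<epsilon> in \<open>auto simp: \<theta>_def B_def\<close>)
  have \<tau>\<theta>: "\<bar>\<tau> n x - \<theta> x\<bar> \<le> 2 * e n" for n x
  proof (cases "x \<in> \<Omega>")
    case True
    have "\<bar>max 0 (W n x - 2 * \<epsilon>) - max 0 (w x - 2 * \<epsilon>)\<bar> \<le> \<bar>W n x - w x\<bar>" by (simp add: max_def abs_if)
    also have "\<dots> \<le> e n" by (rule Ww[OF True])
    finally show ?thesis using True by (simp add: \<tau>_def \<theta>_def abs_if max_def split: if_splits)
  qed (use e(1)[of n] in \<open>auto simp: \<tau>_def \<theta>_def\<close>)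
  define \<psi> where "\<psi> = (\<lambda>n x. if x \<in> \<Omega> then (max 0 (W n x - 2 * \<epsilon>))\<^sup>2 else 0)"
  define D\<psi> where "D\<psi> = (\<lambda>n x. if x \<in> \<Omega> then (2 * max 0 (W n x - 2 * \<epsilon>)) *\<^sub>R Dw n x else 0)"
  have C\<psi>: "C1c K (\<psi> n) (D\<psi> n)" for n
    unfolding \<psi>_def D\<psi>_def
  proof (rule C1c_extend[OF K \<Omega>(1) K\<Omega>])
    fix x assume x: "x \<in> \<Omega>"
    have "GDERIV (\<lambda>x. W n x - 2 * \<epsilon>) x :> Dw n x" using GDERIV_diff[OF gW[OF x] GDERIV_const] by simp
    from GDERIV_DERIV_compose[OF this DERIV_pos_part_square]
    show "GDERIV (\<lambda>x. (max 0 (W n x - 2 * \<epsilon>))\<^sup>2) x :> (2 * max 0 (W n x - 2 * \<epsilon>)) *\<^sub>R Dw n x" .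
    show "(max 0 (W n x - 2 * \<epsilon>))\<^sup>2 = 0" if "x \<notin> K" using small[OF x that, of n] by (simp add: max_def)
  next
    show "continuous_on \<Omega> (\<lambda>x. (2 * max 0 (W n x - 2 * \<epsilon>)) *\<^sub>R Dw n x)"
      by (intro continuous_intros cW cDw)
  qed
  have \<psi>0: "\<psi> n x \<ge> 0" for n x by (simp add: \<psi>_def)
  define T where "T = (\<lambda>n x. indicator K x *\<^sub>R Dw n x)"
  define R where "R = (\<lambda>x. indicator K x *\<^sub>R Z x - indicator K x *\<^sub>R V x)"
  have \<tau>T: "\<tau> n x *\<^sub>R T n x = D\<psi> n x" for n x
    using \<tau>0[of x n] C1cD(6)[OF C\<psi>, of x n] K\<Omega> by (cases "x \<in> K") (auto simp: T_def D\<psi>_def \<tau>_def)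
  have cZ: "continuous_on K Z" using z(3) K\<Omega> continuous_on_subset by blast
  have cG\<Omega>: "continuous_on \<Omega> G"
  proof -
    have "continuous_on \<Omega> (\<lambda>x. G x \<bullet> b)" if "b \<in> Basis" for b
      using G(2) that GDERIV_continuous by (blast intro: continuous_at_imp_continuous_on)
    then have "continuous_on \<Omega> (\<lambda>x. \<Sum>b\<in>Basis. (G x \<bullet> b) *\<^sub>R b)"
      by (intro continuous_on_sum continuous_on_scaleR continuous_on_const)
    then show ?thesis by (simp add: euclidean_representation)
  qed
  then have cG: "continuous_on K G" using K\<Omega> continuous_on_subset by blast
  have [measurable]: "(\<lambda>x. indicator K x *\<^sub>R Z x) \<in> borel_measurable borel" "(\<lambda>x. indicator K x *\<^sub>R G x) \<in> borel_measurable borel"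
    using indicator_continuous_borel[OF K] cZ cG by blast+
  have [measurable]: "R \<in> borel_measurable borel" unfolding R_def by measurable
  have Teq: "T n x = indicator K x *\<^sub>R Z x - indicator K x *\<^sub>R cv V' (\<eta> n) x" for n x
    by (simp add: T_def Dw_def scaleR_diff_right)
  have [measurable]: "T n \<in> borel_measurable borel" for n unfolding Teq[abs_def] by measurable
  have m0: "m > 0" "m / (m - 1) > 0" using m1 by auto
  have KV: "norm (indicator K x *\<^sub>R V x) powr m = indicator K x * norm (V x) powr m" for x
    by (cases "x \<in> K") auto
  have Rm: "integrable lborel (\<lambda>x. norm (R x) powr m)"
    unfolding R_def
    by (rule powr_diff_integrable[OF m0(1) _ _ compact_powr_integrable[OF K cZ m0(1)]])
      (use V_Lm[OF K KE] KV in auto)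
  have TR: "norm (T n x - R x) powr m \<le> norm (cv V' (\<eta> n) x - V' x) powr m" for n x
  proof (cases "x \<in> K")
    case True
    then have "T n x - R x = - (cv V' (\<eta> n) x - V' x)" using KK' by (auto simp: Teq R_def V'_def)
    then show ?thesis by (metis norm_minus_cancel order_refl)
  qed (simp add: Teq R_def)
  have nnTR: "(\<integral>\<^sup>+x. ennreal (norm (T n x - R x) powr m) \<partial>lborel) < ennreal (e n)" for n
    by (rule le_less_trans[OF nn_integral_mono \<eta>(4)[of n]]) (use TR[of n] in \<open>auto intro: ennreal_leI\<close>)
  have iTR: "integrable lborel (\<lambda>x. norm (T n x - R x) powr m)" for n
    using nnTR[of n] by (intro integrableI_nonneg) (auto intro: order_less_trans[OF _ ennreal_less_top])
  have ITR: "(\<lambda>n. \<integral>x. norm (T n x - R x) powr m \<partial>lborel) \<longlonglongrightarrow> 0"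
  proof (rule Lim_null_comparison[OF _ e0], intro always_eventually allI)
    fix n
    have "ennreal (\<integral>x. norm (T n x - R x) powr m \<partial>lborel) < ennreal (e n)"
      using nnTR[of n] by (subst nn_integral_eq_integral[symmetric, OF iTR]) auto
    then show "norm (\<integral>x. norm (T n x - R x) powr m \<partial>lborel) \<le> e n"
      using e(1)[of n] by (simp add: ennreal_less_iff)
  qed
  have e20: "(\<lambda>n. 2 * e n) \<longlonglongrightarrow> 0" using tendsto_mult_right_zero[OF e0] by simp
  note pairing = Lp_pairing_tendsto[OF m1 _ _ _ _ _ _ Rm iTR ITR \<tau>B \<theta>B \<tau>\<theta> e20]
  define P where "P = (\<lambda>x. indicator K x *\<^sub>R G x - indicator K x *\<^sub>R A (V x))"
  have [measurable]: "P \<in> borel_measurable borel" unfolding P_def by measurable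
  have Pq: "integrable lborel (\<lambda>x. norm (P x) powr (m / (m - 1)))"
    unfolding P_def
    by (rule powr_diff_integrable[OF m0(2) _ _ compact_powr_integrable[OF K cG m0(2)] flux_powr_integrable[OF K KE]]) auto
  \<comment> \<open>The divergence identity for the C^1 field \<open>G\<close> and the supersolution
    inequality for \<open>u\<close>, both tested with \<open>\<psi> n\<close>, are
    subtracted.\<close>
  have le0: "(\<integral>x. P x \<bullet> (\<tau> n x *\<^sub>R T n x) \<partial>lborel) \<le> 0" for n
  proof -
    note C = C1cD[OF C\<psi>[of n]]
    have [measurable]: "D\<psi> n \<in> borel_measurable borel" using C(3) borel_measurable_continuous_onI by blast
    obtain B where "\<And>x. norm (D\<psi> n x) \<le> B" using continuous_compact_support_bounded[OF C(3,1,6)] by metis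
    then have i1: "integrable lborel (\<lambda>x. (indicator K x *\<^sub>R A (V x)) \<bullet> D\<psi> n x)"
      by (intro integrable_inner_bounded[OF flux_integrable[OF K KE]]) auto
    have "continuous_on K (\<lambda>x. G x \<bullet> D\<psi> n x)" using cG C(3) by (intro continuous_intros) (auto intro: continuous_on_subset)
    from borel_integrable_compact[OF K this]
    have i2: "integrable lborel (\<lambda>x. indicator K x * (G x \<bullet> D\<psi> n x))" by simp
    have "continuous_on K (\<lambda>x. (\<Sum>b\<in>Basis. H b x \<bullet> b) * \<psi> n x)"
      using G(3) K\<Omega> C(4)
      by (intro continuous_on_mult continuous_on_sum continuous_on_inner continuous_on_const)
        (blast intro: continuous_on_subset)+
    from borel_integrable_compact[OF K this]
    have i3: "integrable lborel (\<lambda>x. indicator K x * ((\<Sum>b\<in>Basis. H b x \<bullet> b) * \<psi> n x))" by simp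
    have "continuous_on K (\<lambda>x. f x * \<psi> n x)"
      using f_cont KE C(4) by (intro continuous_on_mult) (blast intro: continuous_on_subset)+
    from borel_integrable_compact[OF K this]
    have i4: "integrable lborel (\<lambda>x. indicator K x * (f x * \<psi> n x))" by simp
    have "P x \<bullet> (\<tau> n x *\<^sub>R T n x) = indicator K x * (G x \<bullet> D\<psi> n x) - (indicator K x *\<^sub>R A (V x)) \<bullet> D\<psi> n x" for x
      unfolding \<tau>T P_def by (simp add: inner_diff_left)
    then have "(\<integral>x. P x \<bullet> (\<tau> n x *\<^sub>R T n x) \<partial>lborel)
        = (\<integral>x. indicator K x * (G x \<bullet> D\<psi> n x) \<partial>lborel) - (\<integral>x. (indicator K x *\<^sub>R A (V x)) \<bullet> D\<psi> n x \<partial>lborel)"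
      using i1 i2 by (simp only: Bochner_Integration.integral_diff)
    also have "(\<integral>x. (indicator K x *\<^sub>R A (V x)) \<bullet> D\<psi> n x \<partial>lborel) = (\<integral>x. A (V x) \<bullet> D\<psi> n x \<partial>lborel)"
    proof (intro Bochner_Integration.integral_cong refl)
      show "(indicator K x *\<^sub>R A (V x)) \<bullet> D\<psi> n x = A (V x) \<bullet> D\<psi> n x" for x using C(6)[of x] by (cases "x \<in> K") auto
    qed
    also have "(\<integral>x. indicator K x * (G x \<bullet> D\<psi> n x) \<partial>lborel) = - (\<integral>x. indicator K x * ((\<Sum>b\<in>Basis. H b x \<bullet> b) * \<psi> n x) \<partial>lborel)"
      by (rule divergence_test[OF C\<psi> \<Omega>(1) K\<Omega> G(2,3)])
    also have "\<dots> = (\<integral>x. - (indicator K x * ((\<Sum>b\<in>Basis. H b x \<bullet> b) * \<psi> n x)) \<partial>lborel)" by simp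
    also have "\<dots> \<le> (\<integral>x. indicator K x * (f x * \<psi> n x) \<partial>lborel)"
    proof (rule integral_mono)
      show "integrable lborel (\<lambda>x. - (indicator K x * ((\<Sum>b\<in>Basis. H b x \<bullet> b) * \<psi> n x)))" using i3 by simp
      show "integrable lborel (\<lambda>x. indicator K x * (f x * \<psi> n x))" by (rule i4)
      fix x
      show "- (indicator K x * ((\<Sum>b\<in>Basis. H b x \<bullet> b) * \<psi> n x)) \<le> indicator K x * (f x * \<psi> n x)"
      proof (cases "x \<in> K")
        case True
        then have "- (\<Sum>b\<in>Basis. H b x \<bullet> b) * \<psi> n x \<le> f x * \<psi> n x"
          using sub[of x] K\<Omega> \<psi>0[of n x] by (intro mult_right_mono) auto
        then show ?thesis using True by simp
      qed simp
    qed
    also have "\<dots> = (\<integral>x. f x * \<psi> n x \<partial>lborel)"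
    proof (intro Bochner_Integration.integral_cong refl)
      show "indicator K x * (f x * \<psi> n x) = f x * \<psi> n x" for x using C(5)[of x] by (cases "x \<in> K") auto
    qed
    finally show ?thesis using weak_ineq_C1c[OF C\<psi>[of n] KE \<psi>0] by linarith
  qed
  have P1: "integrable lborel (\<lambda>x. P x \<bullet> (\<theta> x *\<^sub>R R x))"
    and P2: "(\<lambda>n. \<integral>x. P x \<bullet> (\<tau> n x *\<^sub>R T n x) \<partial>lborel) \<longlonglongrightarrow> (\<integral>x. P x \<bullet> (\<theta> x *\<^sub>R R x) \<partial>lborel)"
    by (rule pairing; use Pq in simp)+
  have PR: "P x \<bullet> (\<theta> x *\<^sub>R R x) = indicator K x * (\<theta> x * ((A (Z x) - A (V x)) \<bullet> (Z x - V x)))" for x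
    using G(1)[of x] K\<Omega> by (cases "x \<in> K") (auto simp: P_def R_def)
  have PR0: "P x \<bullet> (\<theta> x *\<^sub>R R x) \<ge> 0" for x
    unfolding PR using flux_mono[of "Z x" "V x"] by (intro mult_nonneg_nonneg) (auto simp: \<theta>_def)
  have "(\<integral>x. P x \<bullet> (\<theta> x *\<^sub>R R x) \<partial>lborel) \<le> 0"
    by (rule LIMSEQ_le_const2[OF P2]) (use le0 in blast)
  then have "(\<integral>x. P x \<bullet> (\<theta> x *\<^sub>R R x) \<partial>lborel) = 0"
    using Bochner_Integration.integral_nonneg[of lborel "\<lambda>x. P x \<bullet> (\<theta> x *\<^sub>R R x)"] PR0 by (simp add: order_antisym)
  then have "AE x in lborel. P x \<bullet> (\<theta> x *\<^sub>R R x) = 0"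
    using integral_nonneg_eq_0_iff_AE[OF P1] PR0 by simp
  then have R0: "AE x in lborel. \<theta> x *\<^sub>R R x = 0"
  proof eventually_elim
    case (elim x)
    then show ?case
      unfolding PR using flux_mono_eq[of "Z x" "V x"] by (cases "x \<in> K") (auto simp: R_def)
  qed
  obtain b :: 'a where b: "b \<in> Basis" using nonempty_Basis by blast
  \<comment> \<open>A linear field of divergence 1, cut off to \<open>K\<close>: its pairing with
    the gradient of \<open>\<psi> n\<close> is minus the integral of \<open>\<psi> n\<close>.
    Vanishing of the limiting gradient thus becomes vanishing of the limiting integral, in place of
    a Poincare inequality.\<close>
  define Q where "Q = (\<lambda>x. indicator K x *\<^sub>R ((x \<bullet> b) *\<^sub>R b))"
  have cQ: "continuous_on K (\<lambda>x. (x \<bullet> b) *\<^sub>R b)" by (intro continuous_intros)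
  have [measurable]: "Q \<in> borel_measurable borel" unfolding Q_def by measurable
  have Qq: "integrable lborel (\<lambda>x. norm (Q x) powr (m / (m - 1)))"
    unfolding Q_def by (rule compact_powr_integrable[OF K cQ m0(2)])
  have Q2: "(\<lambda>n. \<integral>x. Q x \<bullet> (\<tau> n x *\<^sub>R T n x) \<partial>lborel) \<longlonglongrightarrow> (\<integral>x. Q x \<bullet> (\<theta> x *\<^sub>R R x) \<partial>lborel)"
    by (rule pairing; use Qq in simp)
  have "(\<integral>x. Q x \<bullet> (\<theta> x *\<^sub>R R x) \<partial>lborel) = 0"
    by (rule integral_eq_zero_AE) (use R0 in eventually_elim, auto)
  moreover have "(\<integral>x. Q x \<bullet> (\<tau> n x *\<^sub>R T n x) \<partial>lborel) = - (\<integral>x. indicator K x * \<psi> n x \<partial>lborel)" for n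
  proof -
    have "Q x \<bullet> (\<tau> n x *\<^sub>R T n x) = indicator K x * (((x \<bullet> b) *\<^sub>R b) \<bullet> D\<psi> n x)" for x
      unfolding \<tau>T Q_def by simp
    then have "(\<integral>x. Q x \<bullet> (\<tau> n x *\<^sub>R T n x) \<partial>lborel) = (\<integral>x. indicator K x * (((x \<bullet> b) *\<^sub>R b) \<bullet> D\<psi> n x) \<partial>lborel)" by simp
    also have "\<dots> = - (\<integral>x. indicator K x * ((\<Sum>b'\<in>Basis. ((b \<bullet> b') *\<^sub>R b) \<bullet> b') * \<psi> n x) \<partial>lborel)"
    proof (rule divergence_test[OF C\<psi> \<Omega>(1) K\<Omega>])
      fix x b' :: 'a
      have "GDERIV (\<lambda>x. x \<bullet> ((b \<bullet> b') *\<^sub>R b)) x :> (b \<bullet> b') *\<^sub>R b" by (rule GDERIV_inner)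
      then show "GDERIV (\<lambda>x. ((x \<bullet> b) *\<^sub>R b) \<bullet> b') x :> (b \<bullet> b') *\<^sub>R b" by (simp add: mult.commute)
    qed (intro continuous_intros)
    also have "(\<Sum>b'\<in>Basis. ((b \<bullet> b') *\<^sub>R b) \<bullet> b') = 1"
      using b euclidean_inner[of b b] by simp
    finally show ?thesis by simp
  qed
  ultimately have lim: "(\<lambda>n. \<integral>x. indicator K x * \<psi> n x \<partial>lborel) \<longlonglongrightarrow> 0"
    using tendsto_minus[OF Q2] by simp
  have "open \<Omega>" "continuous_on \<Omega> w" using \<Omega>(1) cw \<Omega>c continuous_on_subset by blast+
  then have "open (w -` {4 * \<epsilon><..} \<inter> \<Omega>)"
    using open_greaterThan by (metis continuous_on_open_vimage)
  moreover have "w -` {4 * \<epsilon><..} \<inter> \<Omega> = {x \<in> \<Omega>. 4 * \<epsilon> < w x}" by auto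
  ultimately have "open {x \<in> \<Omega>. 4 * \<epsilon> < w x}" by simp
  moreover have "x0 \<in> {x \<in> \<Omega>. 4 * \<epsilon> < w x}" using x0 \<epsilon> by (auto simp: w_def \<epsilon>_def)
  ultimately obtain r where r: "r > 0" "ball x0 r \<subseteq> {x \<in> \<Omega>. 4 * \<epsilon> < w x}"
    by (meson open_contains_ball)
  have bK: "ball x0 r \<subseteq> K" using r(2) \<Omega>c \<epsilon> by (fastforce simp: K_def)
  have lower: "\<epsilon>\<^sup>2 * measure lborel (ball x0 r) \<le> (\<integral>x. indicator K x * \<psi> n x \<partial>lborel)" for n
  proof -
    note C = C1cD[OF C\<psi>[of n]]
    have "continuous_on K (\<psi> n)" using C(4) continuous_on_subset by blast
    from borel_integrable_compact[OF K this]
    have i1: "integrable lborel (\<lambda>x. indicator K x * \<psi> n x)" by simp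
    have i2: "integrable lborel (\<lambda>x. \<epsilon>\<^sup>2 * indicator (ball x0 r) x)"
      using emeasure_lborel_ball_finite[of x0 r] by (intro integrable_mult_right integrable_real_indicator) auto
    have "(\<integral>x. \<epsilon>\<^sup>2 * indicator (ball x0 r) x \<partial>lborel) \<le> (\<integral>x. indicator K x * \<psi> n x \<partial>lborel)"
    proof (rule integral_mono[OF i2 i1])
      fix x
      show "\<epsilon>\<^sup>2 * indicator (ball x0 r) x \<le> indicator K x * \<psi> n x"
      proof (cases "x \<in> ball x0 r")
        case True
        then have x: "x \<in> \<Omega>" "4 * \<epsilon> < w x" "x \<in> K" using r(2) bK by auto
        then have "\<epsilon> \<le> W n x - 2 * \<epsilon>" using Ww[OF x(1), of n] e(2)[of n] \<epsilon> by linarith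
        then have "\<epsilon>\<^sup>2 \<le> (max 0 (W n x - 2 * \<epsilon>))\<^sup>2" using \<epsilon> by (intro power_mono) auto
        then show ?thesis using x True by (simp add: \<psi>_def)
      qed (use \<psi>0 in simp)
    qed
    then show ?thesis by simp
  qed
  have "\<epsilon>\<^sup>2 * measure lborel (ball x0 r) \<le> 0"
    by (rule LIMSEQ_le_const[OF lim]) (use lower in blast)
  moreover have "measure lborel (ball x0 r) > 0" using content_ball_pos[OF r(1), of x0] by simp
  ultimately show False using \<epsilon> by (simp add: mult_le_0_iff power2_eq_square)
qed

end

section \<open>Riesz potentials\<close>

lemma balls_measurable [measurable]: "ball x r \<in> sets borel" "cball x r \<in> sets borel"
  by auto

text \<open>Only translation invariance and Tonelli are used. The double integral of
  \<open>B1 (y - f x) * k y\<close> is evaluated in both orders; since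
  \<open>B1 (y - f x) = B1 (h y - x)\<close>, either order produces the volume
  \<open>\<omega>\<close> of the unit ball as a factor, which cancels.\<close>

lemma nn_integral_lborel_isometry:
  fixes f :: "'a::euclidean_space \<Rightarrow> 'a" and k :: "'a \<Rightarrow> ennreal"
  assumes f: "linear f" and n: "\<And>x. norm (f x) = norm x" and inv: "\<And>y. f (h y) = y"
    and k[measurable]: "k \<in> borel_measurable borel"
  shows "(\<integral>\<^sup>+x. k (f x) \<partial>lborel) = (\<integral>\<^sup>+x. k x \<partial>lborel)"
proof -
  have [measurable]: "f \<in> borel_measurable borel"
    using f by (intro borel_measurable_continuous_onI linear_continuous_on linear_conv_bounded_linear[THEN iffD1])
  define B1 :: "'a \<Rightarrow> ennreal" where "B1 = indicator (ball 0 1)"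
  have [measurable]: "B1 \<in> borel_measurable borel" unfolding B1_def by (intro borel_measurable_indicator) simp
  define \<omega> where "\<omega> = (\<integral>\<^sup>+y. B1 y \<partial>lborel)"
  have om: "\<omega> = emeasure lborel (ball (0::'a) 1)" by (simp add: \<omega>_def B1_def)
  have om0: "\<omega> \<noteq> 0" unfolding om using content_ball_pos[of 1 "0::'a"] by (auto simp: measure_def)
  have omt: "\<omega> \<noteq> top" unfolding om using emeasure_lborel_ball_finite[of "0::'a" 1] by simp
  have isom: "B1 (y - f x) = B1 (h y - x)" for x y
  proof -
    have "norm (y - f x) = norm (f (h y - x))" using inv linear_diff[OF f] by simp
    then show ?thesis by (simp add: B1_def indicator_def n)
  qed
  have inner: "(\<integral>\<^sup>+x. k (f x) \<partial>lborel) = (\<integral>\<^sup>+x. k (f x + y) \<partial>lborel)" for y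
  proof -
    have "(\<integral>\<^sup>+x. k (f x) \<partial>lborel) = (\<integral>\<^sup>+x. k (f (h y + x)) \<partial>lborel)"
      by (rule lborel_nn_integral_translate[symmetric]) measurable
    then show ?thesis by (simp add: linear_add[OF f] inv add.commute)
  qed
  have "\<omega> * (\<integral>\<^sup>+x. k (f x) \<partial>lborel) = (\<integral>\<^sup>+y. B1 y * (\<integral>\<^sup>+x. k (f x) \<partial>lborel) \<partial>lborel)"
    unfolding \<omega>_def by (simp add: nn_integral_multc)
  also have "\<dots> = (\<integral>\<^sup>+y. B1 y * (\<integral>\<^sup>+x. k (f x + y) \<partial>lborel) \<partial>lborel)"
    by (rule nn_integral_cong) (metis inner)
  also have "\<dots> = (\<integral>\<^sup>+y. (\<integral>\<^sup>+x. B1 y * k (f x + y) \<partial>lborel) \<partial>lborel)"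
    by (intro nn_integral_cong nn_integral_cmult[symmetric]) measurable
  also have "\<dots> = (\<integral>\<^sup>+x. (\<integral>\<^sup>+y. B1 y * k (f x + y) \<partial>lborel) \<partial>lborel)"
    by (rule lborel_pair.Fubini') measurable
  also have "\<dots> = (\<integral>\<^sup>+x. (\<integral>\<^sup>+y. B1 (y - f x) * k y \<partial>lborel) \<partial>lborel)"
  proof (rule nn_integral_cong)
    fix x
    show "(\<integral>\<^sup>+y. B1 y * k (f x + y) \<partial>lborel) = (\<integral>\<^sup>+y. B1 (y - f x) * k y \<partial>lborel)"
      using lborel_nn_integral_translate[of "\<lambda>y. B1 (y - f x) * k y" "f x"] by simp
  qed
  also have "\<dots> = (\<integral>\<^sup>+y. (\<integral>\<^sup>+x. B1 (y - f x) * k y \<partial>lborel) \<partial>lborel)"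
    by (rule lborel_pair.Fubini') measurable
  also have "\<dots> = (\<integral>\<^sup>+y. \<omega> * k y \<partial>lborel)"
  proof (rule nn_integral_cong)
    fix y
    show "(\<integral>\<^sup>+x. B1 (y - f x) * k y \<partial>lborel) = \<omega> * k y"
      unfolding isom using lborel_nn_integral_reflect[of B1 "h y"] by (simp add: nn_integral_multc \<omega>_def)
  qed
  also have "\<dots> = \<omega> * (\<integral>\<^sup>+y. k y \<partial>lborel)" by (rule nn_integral_cmult) measurable
  finally show ?thesis using om0 omt by (simp add: ennreal_mult_cancel_left)
qed

lemma integral_lborel_isometry:
  fixes f :: "'a::euclidean_space \<Rightarrow> 'a" and k :: "'a \<Rightarrow> real"
  assumes f: "linear f" and n: "\<And>x. norm (f x) = norm x" and inv: "\<And>y. f (h y) = y"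
    and k[measurable]: "k \<in> borel_measurable borel" and pos: "\<And>x. k x \<ge> 0"
  shows "(\<integral>x. k (f x) \<partial>lborel) = (\<integral>x. k x \<partial>lborel)"
proof -
  have [measurable]: "f \<in> borel_measurable borel"
    using f by (intro borel_measurable_continuous_onI linear_continuous_on linear_conv_bounded_linear[THEN iffD1])
  show ?thesis
    using nn_integral_lborel_isometry[OF f n inv, of "\<lambda>x. ennreal (k x)"] pos
    by (subst (1 2) integral_eq_nn_integral) auto
qed

text \<open>The reflection in the hyperplane orthogonal to \<open>x - x'\<close>, which is its own
  inverse.\<close>

lemma isometry_exists:
  fixes x x' :: "'a::euclidean_space"
  assumes "norm x = norm x'"
  obtains f where "linear f" "\<And>y. norm (f y) = norm y" "\<And>y. f (f y) = y" "f x = x'"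
proof (cases "x = x'")
  case True
  show ?thesis by (rule that[of "\<lambda>y. y"]) (use True in \<open>auto intro: linearI\<close>)
next
  case False
  define v where "v = x - x'"
  have v0: "v \<bullet> v > 0" using False by (simp add: v_def)
  define f where "f = (\<lambda>y. y - (2 * (y \<bullet> v) / (v \<bullet> v)) *\<^sub>R v)"
  have nn: "f y \<bullet> f y = y \<bullet> y" for y
    using v0 by (simp add: f_def inner_diff_left inner_diff_right inner_commute field_simps)
  show ?thesis
  proof (rule that[of f])
    show "linear f"
      by (rule linearI) (simp_all add: f_def inner_add_left algebra_simps add_divide_distrib)
    show "norm (f y) = norm y" for y using nn[of y] by (simp add: norm_eq_sqrt_inner)
    have "f y \<bullet> v = - (y \<bullet> v)" for y using v0 by (simp add: f_def inner_diff_left)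
    moreover have fx: "f y = y - (2 * (y \<bullet> v) / (v \<bullet> v)) *\<^sub>R v" for y by (simp add: f_def)
    ultimately show "f (f y) = y" for y using fx[of "f y"] fx[of y] by simp
    have "x \<bullet> x = x' \<bullet> x'" using assms by (simp add: norm_eq_sqrt_inner)
    then have "2 * (x \<bullet> v) = v \<bullet> v" by (simp add: v_def inner_diff_left inner_diff_right inner_commute)
    then show "f x = x'" using v0 by (simp add: f_def) (simp add: v_def)
  qed
qed

lemma dyadic_scale:
  fixes x :: real assumes "x \<ge> 1"
  obtains k :: nat where "2 ^ k \<le> x" "x < 2 ^ Suc k"
proof -
  define k where "k = nat \<lfloor>log 2 x\<rfloor>"
  have "0 \<le> \<lfloor>log 2 x\<rfloor>" using assms by simp
  then have k: "\<lfloor>log 2 x\<rfloor> = int k" by (simp add: k_def)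
  then have "2 powr real k \<le> x" "x < 2 powr (real k + 1)"
    using floor_log_eq_powr_iff[of x 2 "int k"] assms by auto
  then show ?thesis using that[of k] by (simp add: powr_realpow powr_add)
qed

lemma ennreal_suminf_ge: "f k \<le> (\<Sum>k. f k :: ennreal)"
  using sum_le_suminf[of f "{k}"] by (simp add: summableI)

text \<open>Takes the place of polar coordinates: \<open>F\<close> is dominated by the sum of
  \<open>c k\<close> times the indicators of balls of radius \<open>r k\<close>, whose integrals
  form a geometric series.\<close>

lemma nn_integral_dyadic_bound:
  fixes F :: "'a::euclidean_space \<Rightarrow> real" and r c :: "nat \<Rightarrow> real"
  assumes r: "\<And>k. r k \<ge> 0" and c: "\<And>k. c k \<ge> 0"
    and F: "\<And>x. F x \<noteq> 0 \<Longrightarrow> \<exists>k. F x \<le> c k \<and> norm x \<le> r k"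
    and eq: "\<And>k. c k * r k ^ DIM('a) = B * q ^ k" and q: "0 \<le> q" "q < 1" and B: "B \<ge> 0"
  shows "(\<integral>\<^sup>+x. ennreal (F x) \<partial>lborel) \<le> ennreal (unit_ball_vol (DIM('a)) * B / (1 - q))"
proof -
  let ?\<omega> = "unit_ball_vol (real DIM('a))"
  have w: "?\<omega> \<ge> 0" by (simp add: unit_ball_vol_nonneg)
  have "(\<integral>\<^sup>+x. ennreal (F x) \<partial>lborel) \<le> (\<integral>\<^sup>+x. (\<Sum>k. ennreal (c k) * indicator (cball 0 (r k)) x) \<partial>(lborel :: 'a measure))"
  proof (rule nn_integral_mono)
    fix x :: 'a
    show "ennreal (F x) \<le> (\<Sum>k. ennreal (c k) * indicator (cball 0 (r k)) x)"
    proof (cases "F x = 0")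
      case False
      then obtain k where k: "F x \<le> c k" "norm x \<le> r k" using F by blast
      then have "ennreal (F x) \<le> ennreal (c k) * indicator (cball 0 (r k)) x" by (simp add: ennreal_leI)
      also have "\<dots> \<le> (\<Sum>k. ennreal (c k) * indicator (cball 0 (r k)) x)"
        by (rule ennreal_suminf_ge[of "\<lambda>k. ennreal (c k) * indicator (cball 0 (r k)) x"])
      finally show ?thesis .
    qed simp
  qed
  also have "\<dots> = (\<Sum>k. \<integral>\<^sup>+x. ennreal (c k) * indicator (cball 0 (r k)) x \<partial>(lborel :: 'a measure))"
    by (rule nn_integral_suminf)
      (intro borel_measurable_times_ennreal borel_measurable_const borel_measurable_indicator, simp)
  also have "\<dots> = (\<Sum>k. ennreal (?\<omega> * (B * q ^ k)))"
  proof (intro suminf_cong)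
    fix k
    have "(\<integral>\<^sup>+x. ennreal (c k) * indicator (cball 0 (r k)) x \<partial>(lborel :: 'a measure)) = ennreal (c k) * ennreal (?\<omega> * r k ^ DIM('a))"
      by (simp add: nn_integral_cmult_indicator emeasure_cball[OF r])
    also have "\<dots> = ennreal (?\<omega> * (c k * r k ^ DIM('a)))"
      using w c[of k] r[of k] by (simp add: ennreal_mult[symmetric] ac_simps)
    finally show "(\<integral>\<^sup>+x. ennreal (c k) * indicator (cball 0 (r k)) x \<partial>(lborel :: 'a measure)) = ennreal (?\<omega> * (B * q ^ k))"
      unfolding eq .
  qed
  also have "\<dots> = ennreal (\<Sum>k. ?\<omega> * (B * q ^ k))"
    using w B q by (intro suminf_ennreal2 summable_mult summable_geometric) auto
  also have "(\<Sum>k. ?\<omega> * (B * q ^ k)) = ?\<omega> * B / (1 - q)"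
    using q by (simp add: suminf_mult suminf_geometric summable_geometric summable_mult)
  finally show ?thesis .
qed

text \<open>Dyadic shells shrinking towards the singularity contribute a geometric series of ratio
  \<open>2 powr (\<alpha> - N)\<close>, below 1 because \<open>\<alpha>\<close> is less than the
  dimension.\<close>

lemma riesz_near:
  assumes "0 < \<alpha>" "\<alpha> < real DIM('a::euclidean_space)"
  obtains C where "C > 0" "\<And>R. R > 0 \<Longrightarrow>
    (\<integral>\<^sup>+x. ennreal (indicator (cball 0 R) x * norm x powr (-\<alpha>)) \<partial>(lborel::'a measure)) \<le> ennreal (C * R powr (real DIM('a) - \<alpha>))"
proof -
  let ?N = "real DIM('a)"
  define q where "q = 2 powr (\<alpha> - ?N)"
  have q: "0 \<le> q" "q < 1" using assms powr_less_mono[of "\<alpha> - ?N" 0 2] by (auto simp: q_def)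
  let ?C = "unit_ball_vol ?N * 2 powr \<alpha> / (1 - q)"
  show ?thesis
  proof (rule that[of ?C])
    show "?C > 0" using q by (simp add: unit_ball_vol_pos)
    fix R :: real assume R: "R > 0"
    have "(\<integral>\<^sup>+x. ennreal (indicator (cball 0 R) x * norm x powr (-\<alpha>)) \<partial>(lborel::'a measure))
      \<le> ennreal (unit_ball_vol ?N * (2 powr \<alpha> * R powr (?N - \<alpha>)) / (1 - q))"
    proof (rule nn_integral_dyadic_bound[where r="\<lambda>k. R * 2 powr (- real k)" and c="\<lambda>k. (R * 2 powr (- real k - 1)) powr (-\<alpha>)"])
      fix x :: 'a assume "indicator (cball 0 R) x * norm x powr (-\<alpha>) \<noteq> 0"
      then have x: "norm x \<le> R" "norm x > 0" by (auto simp: indicator_def split: if_splits)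
      then have "R / norm x \<ge> 1" by simp
      then obtain k :: nat where k: "2 ^ k \<le> R / norm x" "R / norm x < 2 ^ Suc k" using dyadic_scale by metis
      have 1: "norm x \<le> R * 2 powr (- real k)"
        using k(1) x by (simp add: powr_minus powr_realpow field_simps)
      have 2: "R * 2 powr (- real k - 1) \<le> norm x"
      proof -
        have "2 powr (- real k - 1) = inverse (2 ^ Suc k :: real)" by (simp add: powr_diff powr_minus powr_realpow field_simps)
        moreover have "R \<le> norm x * 2 ^ Suc k" using k(2) x by (simp add: field_simps)
        then have "R * inverse (2 ^ Suc k) \<le> norm x" by (simp add: field_simps)
        ultimately show ?thesis by (simp only:)
      qed
      have "norm x powr (-\<alpha>) \<le> (R * 2 powr (- real k - 1)) powr (-\<alpha>)"
        using 2 R assms by (intro powr_mono2') auto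
      then show "\<exists>k. indicator (cball 0 R) x * norm x powr (-\<alpha>) \<le> (R * 2 powr (- real k - 1)) powr (-\<alpha>) \<and> norm x \<le> R * 2 powr (- real k)"
        using 1 x by (intro exI[of _ k]) simp
    next
      fix k
      have "(R * 2 powr (- real k)) ^ DIM('a) = (R * 2 powr (- real k)) powr ?N"
        using R by (simp add: powr_realpow)
      then have "(R * 2 powr (- real k - 1)) powr (-\<alpha>) * (R * 2 powr (- real k)) ^ DIM('a)
         = R powr (-\<alpha>) * R powr ?N * (2 powr ((- real k - 1) * -\<alpha>) * 2 powr (- real k * ?N))"
        by (simp add: powr_mult powr_powr)
      also have "\<dots> = R powr (?N - \<alpha>) * 2 powr ((- real k - 1) * -\<alpha> + - real k * ?N)"
        by (simp only: powr_add[symmetric]) simp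
      also have "(- real k - 1) * -\<alpha> + - real k * ?N = \<alpha> + (\<alpha> - ?N) * real k" by (simp add: algebra_simps)
      also have "2 powr (\<alpha> + (\<alpha> - ?N) * real k) = 2 powr \<alpha> * q ^ k"
        by (simp add: q_def powr_add powr_powr[symmetric] powr_realpow)
      finally show "(R * 2 powr (- real k - 1)) powr (-\<alpha>) * (R * 2 powr (- real k)) ^ DIM('a) = 2 powr \<alpha> * R powr (?N - \<alpha>) * q ^ k"
        by simp
    qed (use q R in auto)
    then show "(\<integral>\<^sup>+x. ennreal (indicator (cball 0 R) x * norm x powr (-\<alpha>)) \<partial>(lborel::'a measure)) \<le> ennreal (?C * R powr (?N - \<alpha>))"
      by (simp add: ac_simps)
  qed
qed

text \<open>Here the dyadic shells grow outwards and the ratio is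
  \<open>2 powr (N - \<beta>)\<close>, below 1 because \<open>\<beta>\<close> exceeds the
  dimension.\<close>

lemma riesz_far:
  assumes "real DIM('a::euclidean_space) < \<beta>"
  obtains C where "C > 0" "\<And>R. R > 0 \<Longrightarrow>
    (\<integral>\<^sup>+x. ennreal (indicator (- ball 0 R) x * norm x powr (-\<beta>)) \<partial>(lborel::'a measure)) \<le> ennreal (C * R powr (real DIM('a) - \<beta>))"
proof -
  let ?N = "real DIM('a)"
  define q where "q = 2 powr (?N - \<beta>)"
  have q: "0 \<le> q" "q < 1" using assms powr_less_mono[of "?N - \<beta>" 0 2] by (auto simp: q_def)
  have b: "\<beta> > 0" using assms by (smt (verit) of_nat_0_le_iff)
  let ?C = "unit_ball_vol ?N * 2 powr ?N / (1 - q)"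
  show ?thesis
  proof (rule that[of ?C])
    show "?C > 0" using q by (simp add: unit_ball_vol_pos)
    fix R :: real assume R: "R > 0"
    have "(\<integral>\<^sup>+x. ennreal (indicator (- ball 0 R) x * norm x powr (-\<beta>)) \<partial>(lborel::'a measure))
      \<le> ennreal (unit_ball_vol ?N * (2 powr ?N * R powr (?N - \<beta>)) / (1 - q))"
    proof (rule nn_integral_dyadic_bound[where r="\<lambda>k. R * 2 powr (real k + 1)" and c="\<lambda>k. (R * 2 powr (real k)) powr (-\<beta>)"])
      fix x :: 'a assume "indicator (- ball 0 R) x * norm x powr (-\<beta>) \<noteq> 0"
      then have x: "norm x \<ge> R" by (auto simp: indicator_def split: if_splits)
      then have "norm x / R \<ge> 1" using R by simp
      then obtain k :: nat where k: "2 ^ k \<le> norm x / R" "norm x / R < 2 ^ Suc k" using dyadic_scale by metis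
      have 1: "norm x \<le> R * 2 powr (real k + 1)"
        using k(2) R by (simp add: powr_add powr_realpow field_simps)
      have 2: "R * 2 powr (real k) \<le> norm x"
        using k(1) R by (simp add: powr_realpow field_simps)
      have "norm x powr (-\<beta>) \<le> (R * 2 powr (real k)) powr (-\<beta>)"
        using 2 R b by (intro powr_mono2') auto
      then show "\<exists>k. indicator (- ball 0 R) x * norm x powr (-\<beta>) \<le> (R * 2 powr (real k)) powr (-\<beta>) \<and> norm x \<le> R * 2 powr (real k + 1)"
        using 1 x by (intro exI[of _ k]) simp
    next
      fix k
      have "(R * 2 powr (real k + 1)) ^ DIM('a) = (R * 2 powr (real k + 1)) powr ?N"
        using R by (simp add: powr_realpow)
      then have "(R * 2 powr (real k)) powr (-\<beta>) * (R * 2 powr (real k + 1)) ^ DIM('a)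
         = R powr (-\<beta>) * R powr ?N * (2 powr (real k * -\<beta>) * 2 powr ((real k + 1) * ?N))"
        by (simp add: powr_mult powr_powr)
      also have "\<dots> = R powr (?N - \<beta>) * 2 powr (real k * -\<beta> + (real k + 1) * ?N)"
        by (simp only: powr_add[symmetric]) simp
      also have "real k * -\<beta> + (real k + 1) * ?N = ?N + (?N - \<beta>) * real k" by (simp add: algebra_simps)
      also have "2 powr (?N + (?N - \<beta>) * real k) = 2 powr ?N * q ^ k"
        by (simp add: q_def powr_add powr_powr[symmetric] powr_realpow)
      finally show "(R * 2 powr (real k)) powr (-\<beta>) * (R * 2 powr (real k + 1)) ^ DIM('a) = 2 powr ?N * R powr (?N - \<beta>) * q ^ k"
        by simp
    qed (use q R in auto)
    then show "(\<integral>\<^sup>+x. ennreal (indicator (- ball 0 R) x * norm x powr (-\<beta>)) \<partial>(lborel::'a measure)) \<le> ennreal (?C * R powr (?N - \<beta>))"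
      by (simp add: ac_simps)
  qed
qed

lemma riesz_near_shift:
  fixes x :: "'a::euclidean_space"
  shows "(\<integral>\<^sup>+y. ennreal (indicator (cball x R) y * norm (x - y) powr (-\<alpha>)) \<partial>lborel)
    = (\<integral>\<^sup>+y. ennreal (indicator (cball 0 R) y * norm y powr (-\<alpha>)) \<partial>(lborel::'a measure))"
proof -
  have "indicator (cball x R) y = (indicator (cball 0 R) (x - y) :: real)" for y
    by (auto simp: indicator_def dist_norm norm_minus_commute)
  then show ?thesis
    using lborel_nn_integral_reflect[of "\<lambda>y. ennreal (indicator (cball 0 R) y * norm y powr (-\<alpha>))" x] by simp
qed

text \<open>The convolution of two powers is split at the scale \<open>norm x / 2\<close> into the parts near the
  origin, near \<open>x\<close>, and far from both.\<close>

lemma riesz_composition: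
  fixes \<alpha> a :: real
  assumes \<alpha>: "0 < \<alpha>" "\<alpha> < real DIM('a::euclidean_space)" and a: "0 < a" "a < real DIM('a)"
    and sum: "real DIM('a) < a + \<alpha>"
  obtains C where "C > 0" "\<And>x::'a. x \<noteq> 0 \<Longrightarrow>
    (\<integral>\<^sup>+y. ennreal (norm y powr (-a) * norm (x - y) powr (-\<alpha>)) \<partial>lborel) \<le> ennreal (C * norm x powr (real DIM('a) - \<alpha> - a))"
proof -
  let ?N = "real DIM('a)"
  obtain C1 where C1: "C1 > 0" "\<And>R. R > 0 \<Longrightarrow>
    (\<integral>\<^sup>+x. ennreal (indicator (cball 0 R) x * norm x powr (-\<alpha>)) \<partial>(lborel::'a measure)) \<le> ennreal (C1 * R powr (?N - \<alpha>))"
    using riesz_near[OF \<alpha>] by metis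
  obtain C2 where C2: "C2 > 0" "\<And>R. R > 0 \<Longrightarrow>
    (\<integral>\<^sup>+x. ennreal (indicator (cball 0 R) x * norm x powr (-a)) \<partial>(lborel::'a measure)) \<le> ennreal (C2 * R powr (?N - a))"
    using riesz_near[OF a] by metis
  obtain C3 where C3: "C3 > 0" "\<And>R. R > 0 \<Longrightarrow>
    (\<integral>\<^sup>+x. ennreal (indicator (- ball 0 R) x * norm x powr (-(a+\<alpha>))) \<partial>(lborel::'a measure)) \<le> ennreal (C3 * R powr (?N - (a+\<alpha>)))"
    using riesz_far[OF sum] by metis
  define D where "D = (C1 + C2 + 3 powr \<alpha> * C3) * (1/2) powr (?N - \<alpha> - a)"
  show ?thesis
  proof (rule that[of D])
    show "D > 0" unfolding D_def using C1(1) C2(1) C3(1) by (simp add: add_pos_pos)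
    fix x :: 'a assume x: "x \<noteq> 0"
    define R where "R = norm x / 2"
    have R: "R > 0" using x by (simp add: R_def)
    let ?A = "\<lambda>y::'a. R powr (-\<alpha>) * (indicator (cball 0 R) y * norm y powr (-a))"
    let ?B = "\<lambda>y. R powr (-a) * (indicator (cball x R) y * norm (x - y) powr (-\<alpha>))"
    let ?C = "\<lambda>y::'a. 3 powr \<alpha> * (indicator (- ball 0 R) y * norm y powr (-(a+\<alpha>)))"
    have nn: "?A y \<ge> 0" "?B y \<ge> 0" "?C y \<ge> 0" for y by auto
    have pt: "norm y powr (-a) * norm (x - y) powr (-\<alpha>) \<le> ?A y + ?B y + ?C y" for y
    proof -
      have tri: "norm x \<le> norm y + norm (x - y)" "norm y \<le> norm x + norm (x - y)"
        using norm_triangle_sub[of x y] norm_triangle_sub[of y x] by (auto simp: norm_minus_commute)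
      consider "norm y \<le> R" | "norm y > R" "norm (x - y) \<le> R" | "norm y > R" "norm (x - y) > R" by linarith
      then show ?thesis
      proof cases
        case 1
        then have "R \<le> norm (x - y)" using tri by (simp add: R_def)
        then have "norm (x - y) powr (-\<alpha>) \<le> R powr (-\<alpha>)" using R \<alpha> by (intro powr_mono2') auto
        then have "norm y powr (-a) * norm (x - y) powr (-\<alpha>) \<le> norm y powr (-a) * R powr (-\<alpha>)"
          by (intro mult_left_mono) auto
        then have "norm y powr (-a) * norm (x - y) powr (-\<alpha>) \<le> ?A y" using 1 by (simp add: mult.commute)
        then show ?thesis using nn(2,3)[of y] by linarith
      next
        case 2
        then have "norm y powr (-a) \<le> R powr (-a)" using R a by (intro powr_mono2') auto
        then have "norm y powr (-a) * norm (x - y) powr (-\<alpha>) \<le> ?B y" using 2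
          by (simp add: dist_norm mult_right_mono)
        then show ?thesis using nn(1,3)[of y] by linarith
      next
        case 3
        have "norm y \<le> 3 * norm (x - y)" using tri 3 by (simp add: R_def)
        then have "norm (x - y) powr (-\<alpha>) \<le> (norm y / 3) powr (-\<alpha>)" using 3 R \<alpha> by (intro powr_mono2') auto
        also have "\<dots> = 3 powr \<alpha> * norm y powr (-\<alpha>)" by (simp add: powr_divide powr_minus field_simps)
        finally have "norm y powr (-a) * norm (x - y) powr (-\<alpha>) \<le> norm y powr (-a) * (3 powr \<alpha> * norm y powr (-\<alpha>))"
          by (intro mult_left_mono) auto
        also have "\<dots> = 3 powr \<alpha> * norm y powr (-(a+\<alpha>))"
          using powr_add[of "norm y" "-a" "-\<alpha>"] by simp
        also have "\<dots> = ?C y" using 3 by simp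
        finally show ?thesis using nn(1,2)[of y] by linarith
      qed
    qed
    have "(\<integral>\<^sup>+y. ennreal (norm y powr (-a) * norm (x - y) powr (-\<alpha>)) \<partial>lborel)
      \<le> (\<integral>\<^sup>+y. ennreal (?A y) + ennreal (?B y) + ennreal (?C y) \<partial>lborel)"
      using pt nn by (intro nn_integral_mono) (simp add: ennreal_leI flip: ennreal_plus)
    also have "\<dots> = (\<integral>\<^sup>+y. ennreal (?A y) \<partial>lborel) + (\<integral>\<^sup>+y. ennreal (?B y) \<partial>lborel) + (\<integral>\<^sup>+y. ennreal (?C y) \<partial>lborel)"
      by (simp add: nn_integral_add)
    also have "\<dots> \<le> ennreal (R powr (-\<alpha>) * (C2 * R powr (?N - a))) + ennreal (R powr (-a) * (C1 * R powr (?N - \<alpha>)))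
        + ennreal (3 powr \<alpha> * (C3 * R powr (?N - (a+\<alpha>))))"
    proof (intro add_mono)
      have "(\<integral>\<^sup>+y. ennreal (?A y) \<partial>lborel) = ennreal (R powr (-\<alpha>)) * (\<integral>\<^sup>+y. ennreal (indicator (cball 0 R) y * norm y powr (-a)) \<partial>(lborel::'a measure))"
        by (simp add: ennreal_mult nn_integral_cmult)
      also have "\<dots> \<le> ennreal (R powr (-\<alpha>)) * ennreal (C2 * R powr (?N - a))" by (intro mult_left_mono C2(2)[OF R]) simp
      also have "\<dots> = ennreal (R powr (-\<alpha>) * (C2 * R powr (?N - a)))" using C2(1) by (simp add: ennreal_mult)
      finally show "(\<integral>\<^sup>+y. ennreal (?A y) \<partial>lborel) \<le> ennreal (R powr (-\<alpha>) * (C2 * R powr (?N - a)))" .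
      have "(\<integral>\<^sup>+y. ennreal (?B y) \<partial>lborel) = ennreal (R powr (-a)) * (\<integral>\<^sup>+y. ennreal (indicator (cball x R) y * norm (x - y) powr (-\<alpha>)) \<partial>lborel)"
        by (simp add: ennreal_mult nn_integral_cmult)
      also have "\<dots> \<le> ennreal (R powr (-a)) * ennreal (C1 * R powr (?N - \<alpha>))"
        unfolding riesz_near_shift by (intro mult_left_mono C1(2)[OF R]) simp
      also have "\<dots> = ennreal (R powr (-a) * (C1 * R powr (?N - \<alpha>)))" using C1(1) by (simp add: ennreal_mult)
      finally show "(\<integral>\<^sup>+y. ennreal (?B y) \<partial>lborel) \<le> ennreal (R powr (-a) * (C1 * R powr (?N - \<alpha>)))" .
      have "(\<integral>\<^sup>+y. ennreal (?C y) \<partial>lborel) = ennreal (3 powr \<alpha>) * (\<integral>\<^sup>+y. ennreal (indicator (- ball 0 R) y * norm y powr (-(a+\<alpha>))) \<partial>(lborel::'a measure))"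
        by (simp add: ennreal_mult nn_integral_cmult)
      also have "\<dots> \<le> ennreal (3 powr \<alpha>) * ennreal (C3 * R powr (?N - (a+\<alpha>)))" by (intro mult_left_mono C3(2)[OF R]) simp
      also have "\<dots> = ennreal (3 powr \<alpha> * (C3 * R powr (?N - (a+\<alpha>))))" using C3(1) by (simp add: ennreal_mult)
      finally show "(\<integral>\<^sup>+y. ennreal (?C y) \<partial>lborel) \<le> ennreal (3 powr \<alpha> * (C3 * R powr (?N - (a+\<alpha>))))" .
    qed
    also have "\<dots> = ennreal (R powr (-\<alpha>) * (C2 * R powr (?N - a)) + R powr (-a) * (C1 * R powr (?N - \<alpha>)) + 3 powr \<alpha> * (C3 * R powr (?N - (a+\<alpha>))))"
      using C1(1) C2(1) C3(1) by (simp add: ennreal_plus[symmetric] del: ennreal_plus)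
    also have "R powr (-\<alpha>) * (C2 * R powr (?N - a)) + R powr (-a) * (C1 * R powr (?N - \<alpha>)) + 3 powr \<alpha> * (C3 * R powr (?N - (a+\<alpha>)))
       = (C1 + C2 + 3 powr \<alpha> * C3) * R powr (?N - \<alpha> - a)"
    proof -
      have "R powr (-\<alpha>) * R powr (?N - a) = R powr (?N - \<alpha> - a)" "R powr (-a) * R powr (?N - \<alpha>) = R powr (?N - \<alpha> - a)"
        "R powr (?N - (a+\<alpha>)) = R powr (?N - \<alpha> - a)"
        by (simp_all add: powr_add[symmetric] algebra_simps)
      then show ?thesis by (simp add: algebra_simps)
    qed
    also have "R powr (?N - \<alpha> - a) = norm x powr (?N - \<alpha> - a) * (1/2) powr (?N - \<alpha> - a)"
      unfolding R_def by (simp add: powr_divide)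
    finally show "(\<integral>\<^sup>+y. ennreal (norm y powr (-a) * norm (x - y) powr (-\<alpha>)) \<partial>lborel) \<le> ennreal (D * norm x powr (?N - \<alpha> - a))"
      by (simp add: D_def ac_simps)
  qed
qed

text \<open>The bridge from the integrals over \<open>lebesgue\<close> in the definitions to
  \<open>lborel\<close> with Borel integrands, where Tonelli's theorem and the measurability prover
  are available.\<close>

lemma lebesgue_AE_eq:
  fixes F G :: "'a::euclidean_space \<Rightarrow> 'b::euclidean_space"
  assumes G: "G \<in> borel_measurable borel" and AE: "AE x in lebesgue. F x = G x"
  shows "integral\<^sup>L lebesgue F = integral\<^sup>L lborel G"
    and "integrable lebesgue F \<longleftrightarrow> integrable lborel G"
    and "F \<in> borel_measurable lebesgue"
proof -
  have G': "G \<in> borel_measurable lebesgue" using G by (intro measurable_completion) simp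
  show F: "F \<in> borel_measurable lebesgue"
    by (rule borel_measurable_AE[OF G']) (use AE in eventually_elim, simp)
  show "integral\<^sup>L lebesgue F = integral\<^sup>L lborel G"
    using integral_cong_AE[OF F G' AE] integral_completion[of G lborel] G by simp
  show "integrable lebesgue F \<longleftrightarrow> integrable lborel G"
    using integrable_cong_AE[OF F G' AE] integrable_completion[of G lborel] G by simp
qed

lemma AE_not_sphere: "AE x in lebesgue. (x::'a::euclidean_space) \<notin> sphere 0 1"
  using negligible_sphere[of "0::'a" 1] by (intro AE_not_in) (simp only: negligible_iff_null_sets)

text \<open>The weighted integrability controls the kernel at infinity, local boundedness controls
  its singularity. Boundedness is asked only on compact subsets of \<open>E\<close>, since a
  solution may be unbounded near the unit sphere.\<close>

locale riesz_potential =
  fixes \<alpha> :: real and v :: "'a::euclidean_space \<Rightarrow> real" and E :: "'a set"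
  assumes \<alpha>: "0 < \<alpha>" "\<alpha> < real DIM('a)" and openE: "open E"
    and v_borel [measurable]: "v \<in> borel_measurable borel" and v_nonneg: "\<And>y. v y \<ge> 0"
    and v_int: "integrable lborel (\<lambda>y. v y / (1 + norm y powr \<alpha>))"
    and v_bdd: "\<And>K. compact K \<Longrightarrow> K \<subseteq> E \<Longrightarrow> \<exists>M. \<forall>y\<in>K. v y \<le> M"
begin

definition pot :: "'a \<Rightarrow> real" where
  "pot x = (\<integral>y. v y * norm (x - y) powr (-\<alpha>) \<partial>lborel)"

lemma pot_borel [measurable]: "pot \<in> borel_measurable borel"
  unfolding pot_def[abs_def] by (rule lborel.borel_measurable_lebesgue_integral) measurable

lemma pot_nonneg: "pot x \<ge> 0"
  unfolding pot_def using v_nonneg by simp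

text \<open>Away from \<open>x0\<close> the distances \<open>norm (x - y)\<close> and
  \<open>dist y x0\<close> are comparable, and \<open>dist y x0 \<ge> 2 * \<delta>\<close> bounds
  both \<open>1\<close> and \<open>norm y\<close> by multiples of \<open>dist y x0\<close>.\<close>

lemma kernel_far_bound:
  assumes \<delta>: "\<delta> > 0"
  obtains C where "C > 0" "\<And>x y. dist x x0 \<le> \<delta> \<Longrightarrow> dist y x0 \<ge> 2 * \<delta> \<Longrightarrow>
    norm (x - y) powr (-\<alpha>) \<le> C * (1 / (1 + norm (y::'a) powr \<alpha>))"
proof -
  define \<kappa> where "\<kappa> = norm x0 / (2 * \<delta>) + 1"
  have k: "\<kappa> \<ge> 1" using \<delta> by (simp add: \<kappa>_def)
  define C where "C = 2 powr \<alpha> * ((1 / (2 * \<delta>)) powr \<alpha> + \<kappa> powr \<alpha>)"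
  show ?thesis
  proof (rule that[of C])
    show "C > 0" using k \<delta> by (simp add: C_def add_pos_pos)
    fix x y :: 'a assume x: "dist x x0 \<le> \<delta>" and y: "dist y x0 \<ge> 2 * \<delta>"
    define \<rho> where "\<rho> = dist y x0"
    have r: "\<rho> \<ge> 2 * \<delta>" "\<rho> > 0" using y \<delta> by (auto simp: \<rho>_def)
    have "\<rho> \<le> norm (x - y) + dist x x0"
      using dist_triangle[of y x0 x] by (simp add: \<rho>_def dist_norm norm_minus_commute)
    then have d: "\<rho> \<le> 2 * norm (x - y)" using x r by linarith
    then have d0: "norm (x - y) > 0" using r by linarith
    have "norm y \<le> norm x0 + \<rho>" using norm_triangle_sub[of y x0] by (simp add: \<rho>_def dist_norm)
    also have "norm x0 \<le> norm x0 / (2 * \<delta>) * \<rho>"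
      using r \<delta> mult_left_mono[of "2 * \<delta>" \<rho> "norm x0"] by (simp add: field_simps)
    finally have ny: "norm y \<le> \<kappa> * \<rho>" by (simp add: \<kappa>_def algebra_simps)
    have "1 \<le> \<rho> / (2 * \<delta>)" using r \<delta> by simp
    then have "1 \<le> (\<rho> / (2 * \<delta>)) powr \<alpha>" using \<alpha> by (intro ge_one_powr_ge_zero) auto
    moreover have "norm y powr \<alpha> \<le> (\<kappa> * \<rho>) powr \<alpha>" using ny \<alpha> by (intro powr_mono2) auto
    ultimately have "1 + norm y powr \<alpha> \<le> (1 / (2 * \<delta>)) powr \<alpha> * \<rho> powr \<alpha> + \<kappa> powr \<alpha> * \<rho> powr \<alpha>"
      using powr_mult[of "1 / (2 * \<delta>)" \<rho> \<alpha>] by (simp add: powr_mult)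
    also have "\<dots> = ((1 / (2 * \<delta>)) powr \<alpha> + \<kappa> powr \<alpha>) * \<rho> powr \<alpha>" by (simp only: distrib_right)
    also have "\<dots> \<le> ((1 / (2 * \<delta>)) powr \<alpha> + \<kappa> powr \<alpha>) * (2 * norm (x - y)) powr \<alpha>"
      using d r \<alpha> by (intro mult_left_mono powr_mono2) auto
    also have "\<dots> = C * norm (x - y) powr \<alpha>" by (simp add: C_def powr_mult)
    finally have "1 + norm y powr \<alpha> \<le> C * norm (x - y) powr \<alpha>" .
    moreover have "1 + norm y powr \<alpha> > 0" by (smt (verit) powr_ge_zero)
    ultimately show "norm (x - y) powr (-\<alpha>) \<le> C * (1 / (1 + norm y powr \<alpha>))"
      using d0 by (simp add: powr_minus field_simps)
  qed
qed

definition far :: "'a \<Rightarrow> real \<Rightarrow> 'a \<Rightarrow> real" where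
  "far x0 \<delta> x = (\<integral>y. indicator (- ball x0 (2 * \<delta>)) y * (v y * norm (x - y) powr (-\<alpha>)) \<partial>lborel)"

lemma far_bound:
  assumes \<delta>: "\<delta> > 0"
  obtains w where "integrable lborel w"
    "\<And>x y. dist x x0 \<le> \<delta> \<Longrightarrow> norm (indicator (- ball x0 (2 * \<delta>)) y * (v y * norm (x - y) powr (-\<alpha>))) \<le> w (y::'a)"
proof -
  obtain C where C: "C > 0" "\<And>x y. dist x x0 \<le> \<delta> \<Longrightarrow> dist y x0 \<ge> 2 * \<delta> \<Longrightarrow>
    norm (x - y) powr (-\<alpha>) \<le> C * (1 / (1 + norm (y::'a) powr \<alpha>))"
    using kernel_far_bound[OF \<delta>] by metis
  show ?thesis
  proof (rule that[of "\<lambda>y. C * (v y / (1 + norm y powr \<alpha>))"])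
    show "integrable lborel (\<lambda>y. C * (v y / (1 + norm y powr \<alpha>)))" using v_int by (rule integrable_mult_right)
    fix x y :: 'a assume x: "dist x x0 \<le> \<delta>"
    have pos: "0 < 1 + norm y powr \<alpha>" by (smt (verit) powr_ge_zero)
    show "norm (indicator (- ball x0 (2 * \<delta>)) y * (v y * norm (x - y) powr (-\<alpha>))) \<le> C * (v y / (1 + norm y powr \<alpha>))"
    proof (cases "dist y x0 \<ge> 2 * \<delta>")
      case True
      then have "v y * norm (x - y) powr (-\<alpha>) \<le> v y * (C * (1 / (1 + norm y powr \<alpha>)))"
        using C(2)[OF x True] v_nonneg by (intro mult_left_mono) auto
      then show ?thesis using True v_nonneg[of y] by (simp add: dist_commute mult.commute)
    next
      case False
      then show ?thesis using C(1) v_nonneg[of y] pos by (simp add: dist_commute)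
    qed
  qed
qed

lemma far_integrable:
  assumes "\<delta> > 0" "dist x x0 \<le> \<delta>"
  shows "integrable lborel (\<lambda>y. indicator (- ball x0 (2 * \<delta>)) y * (v y * norm (x - y) powr (-\<alpha>)))"
proof -
  obtain w where w: "integrable lborel w" "\<And>x y. dist x x0 \<le> \<delta> \<Longrightarrow> norm (indicator (- ball x0 (2 * \<delta>)) y * (v y * norm (x - y) powr (-\<alpha>))) \<le> w (y::'a)"
    using far_bound[OF assms(1)] by metis
  have "AE y in lborel. norm (indicator (- ball x0 (2 * \<delta>)) y * (v y * norm (x - y) powr (-\<alpha>))) \<le> norm (w y)"
    using w(2)[OF assms(2)] by (intro AE_I2) (metis abs_ge_self order_trans real_norm_def)
  then show ?thesis by (intro Bochner_Integration.integrable_bound[OF w(1)]) measurable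
qed

lemma far_continuous:
  assumes \<delta>: "\<delta> > 0"
  shows "isCont (far x0 \<delta>) x0"
proof -
  obtain w where w: "integrable lborel w" "\<And>x y. dist x x0 \<le> \<delta> \<Longrightarrow> norm (indicator (- ball x0 (2 * \<delta>)) y * (v y * norm (x - y) powr (-\<alpha>))) \<le> w (y::'a)"
    using far_bound[OF \<delta>] by metis
  show ?thesis
    unfolding continuous_at_sequentially
  proof (intro allI impI)
    fix X :: "nat \<Rightarrow> 'a" assume X: "X \<longlonglongrightarrow> x0"
    \<comment> \<open>Points outside the \<open>\<delta>\<close>-ball are replaced by
      \<open>x0\<close>, so that the dominating function applies to every index.\<close>
    define Y where "Y = (\<lambda>n. if dist (X n) x0 \<le> \<delta> then X n else x0)"
    have YX: "eventually (\<lambda>n. Y n = X n) sequentially"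
      using tendstoD[OF X \<delta>] by eventually_elim (simp add: Y_def)
    then have Y: "Y \<longlonglongrightarrow> x0" using X by (simp add: tendsto_cong)
    have "(\<lambda>n. far x0 \<delta> (Y n)) \<longlonglongrightarrow> far x0 \<delta> x0"
      unfolding far_def
    proof (rule integral_dominated_convergence[OF _ _ w(1)])
      show "AE y in lborel. norm (indicator (- ball x0 (2 * \<delta>)) y * (v y * norm (Y n - y) powr (-\<alpha>))) \<le> w y" for n
        using \<delta> by (intro AE_I2 w(2)) (simp add: Y_def)
      show "AE y in lborel. (\<lambda>n. indicator (- ball x0 (2 * \<delta>)) y * (v y * norm (Y n - y) powr (-\<alpha>)))
          \<longlonglongrightarrow> indicator (- ball x0 (2 * \<delta>)) y * (v y * norm (x0 - y) powr (-\<alpha>))"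
      proof (intro AE_I2)
        fix y
        show "(\<lambda>n. indicator (- ball x0 (2 * \<delta>)) y * (v y * norm (Y n - y) powr (-\<alpha>)))
          \<longlonglongrightarrow> indicator (- ball x0 (2 * \<delta>)) y * (v y * norm (x0 - y) powr (-\<alpha>))"
        proof (cases "y = x0")
          case False
          have "(\<lambda>n. norm (Y n - y)) \<longlonglongrightarrow> norm (x0 - y)" by (intro tendsto_intros Y)
          from tendsto_powr[OF this tendsto_const] False
          have "(\<lambda>n. norm (Y n - y) powr (-\<alpha>)) \<longlonglongrightarrow> norm (x0 - y) powr (-\<alpha>)" by simp
          then show ?thesis by (intro tendsto_mult tendsto_const)
        qed (use \<delta> in simp)
      qed
    qed measurable
    moreover have "eventually (\<lambda>n. far x0 \<delta> (Y n) = (far x0 \<delta> \<circ> X) n) sequentially"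
      using YX by eventually_elim simp
    ultimately show "(far x0 \<delta> \<circ> X) \<longlonglongrightarrow> far x0 \<delta> x0"
      by (rule Lim_transform_eventually)
  qed
qed

text \<open>The ball about \<open>x0\<close> is enlarged to one centred at the singularity
  \<open>x\<close>, where the integral of the kernel is independent of \<open>x\<close>.\<close>

lemma near_bound:
  assumes x0: "cball x0 (3 * \<delta>) \<subseteq> E" and \<delta>: "\<delta> > 0" and x: "dist x x0 \<le> \<delta>"
    and M: "\<And>y. y \<in> cball x0 (3 * \<delta>) \<Longrightarrow> v y \<le> M"
    and C: "\<And>R. R > 0 \<Longrightarrow> (\<integral>\<^sup>+x. ennreal (indicator (cball 0 R) x * norm x powr (-\<alpha>)) \<partial>(lborel::'a measure)) \<le> ennreal (C * R powr (real DIM('a) - \<alpha>))"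
  shows "(\<integral>\<^sup>+y. ennreal (indicator (ball x0 (2 * \<delta>)) y * (v y * norm (x - y) powr (-\<alpha>))) \<partial>lborel)
      \<le> ennreal (M * (C * (3 * \<delta>) powr (real DIM('a) - \<alpha>)))"
proof -
  have M0: "M \<ge> 0" using M[of x0] v_nonneg[of x0] \<delta> by auto
  have "(\<integral>\<^sup>+y. ennreal (indicator (ball x0 (2 * \<delta>)) y * (v y * norm (x - y) powr (-\<alpha>))) \<partial>lborel)
     \<le> (\<integral>\<^sup>+y. ennreal M * ennreal (indicator (cball x (3 * \<delta>)) y * norm (x - y) powr (-\<alpha>)) \<partial>lborel)"
  proof (rule nn_integral_mono)
    fix y
    show "ennreal (indicator (ball x0 (2 * \<delta>)) y * (v y * norm (x - y) powr (-\<alpha>)))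
       \<le> ennreal M * ennreal (indicator (cball x (3 * \<delta>)) y * norm (x - y) powr (-\<alpha>))"
    proof (cases "y \<in> ball x0 (2 * \<delta>)")
      case True
      then have "y \<in> cball x0 (3 * \<delta>)" "y \<in> cball x (3 * \<delta>)"
        using x \<delta> dist_triangle[of x y x0] by (auto simp: dist_commute)
      then have "indicator (ball x0 (2 * \<delta>)) y * (v y * norm (x - y) powr (-\<alpha>))
         \<le> M * (indicator (cball x (3 * \<delta>)) y * norm (x - y) powr (-\<alpha>))"
        using True M by (simp add: mult_right_mono)
      then show ?thesis using M0 by (simp add: ennreal_mult[symmetric] ennreal_leI)
    qed simp
  qed
  also have "\<dots> = ennreal M * (\<integral>\<^sup>+y. ennreal (indicator (cball 0 (3 * \<delta>)) y * norm y powr (-\<alpha>)) \<partial>(lborel::'a measure))"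
    unfolding riesz_near_shift[symmetric, of _ _ x] by (rule nn_integral_cmult) measurable
  also have "\<dots> \<le> ennreal M * ennreal (C * (3 * \<delta>) powr (real DIM('a) - \<alpha>))"
    using \<delta> by (intro mult_left_mono C) auto
  also have "\<dots> = ennreal (M * (C * (3 * \<delta>) powr (real DIM('a) - \<alpha>)))" using M0 by (simp add: ennreal_mult')
  finally show ?thesis .
qed

lemma pot_split:
  assumes x0: "x0 \<in> E"
  obtains \<delta>1 D where "\<delta>1 > 0" "D > 0" "\<And>\<delta> x. 0 < \<delta> \<Longrightarrow> \<delta> \<le> \<delta>1 \<Longrightarrow> dist x x0 \<le> \<delta> \<Longrightarrow>
     integrable lborel (\<lambda>y. v y * norm (x - y) powr (-\<alpha>)) \<and> \<bar>pot x - far x0 \<delta> x\<bar> \<le> D * \<delta> powr (real DIM('a) - \<alpha>)"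
proof -
  obtain e where e: "e > 0" "cball x0 e \<subseteq> E" using openE x0 open_contains_cball by blast
  obtain M0 where "\<forall>y\<in>cball x0 e. v y \<le> M0" using v_bdd[OF compact_cball e(2)] by blast
  then have M: "\<And>y. y \<in> cball x0 e \<Longrightarrow> v y \<le> \<bar>M0\<bar> + 1" by fastforce
  obtain C where C: "C > 0" "\<And>R. R > 0 \<Longrightarrow>
    (\<integral>\<^sup>+x. ennreal (indicator (cball 0 R) x * norm x powr (-\<alpha>)) \<partial>(lborel::'a measure)) \<le> ennreal (C * R powr (real DIM('a) - \<alpha>))"
    using riesz_near[OF \<alpha>] by metis
  define D where "D = (\<bar>M0\<bar> + 1) * (C * 3 powr (real DIM('a) - \<alpha>))"
  show ?thesis
  proof (rule that[of "e / 3" D])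
    show "D > 0" using C(1) by (simp add: D_def)
    fix \<delta> x assume \<delta>: "0 < \<delta>" "\<delta> \<le> e / 3" and x: "dist x x0 \<le> \<delta>"
    have sub: "cball x0 (3 * \<delta>) \<subseteq> cball x0 e" using \<delta> by (intro subset_cball) simp
    let ?n = "\<lambda>y. indicator (ball x0 (2 * \<delta>)) y * (v y * norm (x - y) powr (-\<alpha>))"
    let ?f = "\<lambda>y. indicator (- ball x0 (2 * \<delta>)) y * (v y * norm (x - y) powr (-\<alpha>))"
    have nb: "(\<integral>\<^sup>+y. ennreal (?n y) \<partial>lborel) \<le> ennreal ((\<bar>M0\<bar> + 1) * (C * (3 * \<delta>) powr (real DIM('a) - \<alpha>)))"
      using sub e(2) M by (intro near_bound[OF _ \<delta>(1) x _ C(2)]) auto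
    have n0: "?n y \<ge> 0" for y using v_nonneg by simp
    have ni: "integrable lborel ?n"
      using nb n0 by (intro integrableI_nonneg) (auto intro: le_less_trans)
    have fi: "integrable lborel ?f" by (rule far_integrable[OF \<delta>(1) x])
    have eq: "v y * norm (x - y) powr (-\<alpha>) = ?n y + ?f y" for y by (simp add: indicator_def)
    have "pot x = (\<integral>y. ?n y \<partial>lborel) + far x0 \<delta> x"
      unfolding pot_def far_def using Bochner_Integration.integral_add[OF ni fi] by (simp only: eq[symmetric])
    moreover have "(\<integral>y. ?n y \<partial>lborel) \<le> D * \<delta> powr (real DIM('a) - \<alpha>)"
    proof -
      have "ennreal (\<integral>y. ?n y \<partial>lborel) \<le> ennreal ((\<bar>M0\<bar> + 1) * (C * (3 * \<delta>) powr (real DIM('a) - \<alpha>)))"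
        using nb nn_integral_eq_integral[OF ni] n0 by simp
      then have "(\<integral>y. ?n y \<partial>lborel) \<le> (\<bar>M0\<bar> + 1) * (C * (3 * \<delta>) powr (real DIM('a) - \<alpha>))"
        using C(1) \<delta> by (subst (asm) ennreal_le_iff) auto
      then show ?thesis using \<delta> by (simp add: D_def powr_mult ac_simps)
    qed
    moreover have "(\<integral>y. ?n y \<partial>lborel) \<ge> 0" using n0 by (rule Bochner_Integration.integral_nonneg)
    moreover have "integrable lborel (\<lambda>y. v y * norm (x - y) powr (-\<alpha>))"
      using Bochner_Integration.integrable_add[OF ni fi] by (simp only: eq[symmetric])
    ultimately show "integrable lborel (\<lambda>y. v y * norm (x - y) powr (-\<alpha>)) \<and> \<bar>pot x - far x0 \<delta> x\<bar> \<le> D * \<delta> powr (real DIM('a) - \<alpha>)"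
      by simp
  qed (use e in simp)
qed

lemma pot_integrable:
  assumes x: "x \<in> E"
  shows "integrable lborel (\<lambda>y. v y * norm (x - y) powr (-\<alpha>))"
proof -
  obtain \<delta>1 D where D: "\<delta>1 > 0" "D > 0" "\<And>\<delta> x'. 0 < \<delta> \<Longrightarrow> \<delta> \<le> \<delta>1 \<Longrightarrow> dist x' x \<le> \<delta> \<Longrightarrow>
     integrable lborel (\<lambda>y. v y * norm (x' - y) powr (-\<alpha>)) \<and> \<bar>pot x' - far x \<delta> x'\<bar> \<le> D * \<delta> powr (real DIM('a) - \<alpha>)"
    by (rule pot_split[OF x]) (rule that, assumption+)
  show ?thesis using D(3)[OF D(1) order_refl, of x] D(1) by simp
qed

text \<open>The near part is \<open>O(\<delta> powr (N - \<alpha>))\<close> uniformly around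
  \<open>x0\<close>, with \<open>N\<close> the dimension, and for fixed \<open>\<delta>\<close> the
  far part is continuous at \<open>x0\<close>; three errors of a quarter of \<open>e\<close>
  remain.\<close>

lemma pot_continuous: "continuous_on E pot"
proof (intro continuous_at_imp_continuous_on ballI)
  fix x0 assume x0: "x0 \<in> E"
  obtain \<delta>1 D where \<delta>1: "\<delta>1 > 0" "D > 0" "\<And>\<delta> x. 0 < \<delta> \<Longrightarrow> \<delta> \<le> \<delta>1 \<Longrightarrow> dist x x0 \<le> \<delta> \<Longrightarrow>
     integrable lborel (\<lambda>y. v y * norm (x - y) powr (-\<alpha>)) \<and> \<bar>pot x - far x0 \<delta> x\<bar> \<le> D * \<delta> powr (real DIM('a) - \<alpha>)"
    by (rule pot_split[OF x0]) (rule that, assumption+)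
  show "isCont pot x0"
    unfolding continuous_at_eps_delta
  proof (intro allI impI)
    fix e :: real assume e: "e > 0"
    define \<nu> where "\<nu> = real DIM('a) - \<alpha>"
    have nu: "\<nu> > 0" using \<alpha> by (simp add: \<nu>_def)
    define \<delta> where "\<delta> = min \<delta>1 ((e / (4 * D)) powr (1 / \<nu>))"
    have \<delta>: "\<delta> > 0" "\<delta> \<le> \<delta>1" using \<delta>1 e by (auto simp: \<delta>_def)
    have "\<delta> powr \<nu> \<le> ((e / (4 * D)) powr (1 / \<nu>)) powr \<nu>" using nu \<delta> by (intro powr_mono2) (auto simp: \<delta>_def)
    also have "\<dots> = e / (4 * D)" using nu e \<delta>1 by (simp add: powr_powr)
    finally have D: "D * \<delta> powr \<nu> \<le> e / 4" using \<delta>1(2) by (simp add: field_simps)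
    obtain d where d: "d > 0" "\<And>x. dist x x0 < d \<Longrightarrow> \<bar>far x0 \<delta> x - far x0 \<delta> x0\<bar> < e / 4"
      using far_continuous[OF \<delta>(1), of x0] e unfolding continuous_at_eps_delta dist_real_def
      by (meson divide_pos_pos zero_less_numeral)
    show "\<exists>d>0. \<forall>x'. dist x' x0 < d \<longrightarrow> dist (pot x') (pot x0) < e"
    proof (intro exI[of _ "min d \<delta>"] conjI allI impI)
      fix x assume x: "dist x x0 < min d \<delta>"
      have "\<bar>pot x - far x0 \<delta> x\<bar> \<le> e / 4" "\<bar>pot x0 - far x0 \<delta> x0\<bar> \<le> e / 4"
        using \<delta>1(3)[OF \<delta>, of x] \<delta>1(3)[OF \<delta>, of x0] x D \<delta>(1) by (auto simp: \<nu>_def)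
      moreover have "\<bar>far x0 \<delta> x - far x0 \<delta> x0\<bar> < e / 4" using d(2) x by simp
      ultimately show "dist (pot x) (pot x0) < e" unfolding dist_real_def by linarith
    qed (use d \<delta> in auto)
  qed
qed

text \<open>The point \<open>y = x\<close> is exempted from the bound because
  \<open>0 powr (- \<alpha>)\<close> is 0; a single point is a null set.\<close>

lemma pot_lower:
  assumes x: "x \<in> E" and S: "S \<in> sets borel" "emeasure lborel S < \<infinity>"
    and c: "\<And>y. y \<in> S \<Longrightarrow> y \<noteq> x \<Longrightarrow> c \<le> v y * norm (x - y) powr (-\<alpha>)"
  shows "c * measure lborel S \<le> pot x"
proof -
  have "(\<integral>y. c * indicator S y \<partial>lborel) \<le> pot x"
    unfolding pot_def
  proof (rule integral_mono_AE)
    show "integrable lborel (\<lambda>y. c * indicator S y :: real)"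
      using S by (intro integrable_mult_right integrable_real_indicator) auto
    show "integrable lborel (\<lambda>y. v y * norm (x - y) powr (-\<alpha>))" by (rule pot_integrable[OF x])
    show "AE y in lborel. c * indicator S y \<le> v y * norm (x - y) powr (-\<alpha>)"
      using AE_lborel_singleton[of x]
    proof eventually_elim
      case (elim y)
      then show ?case using c[of y] v_nonneg[of y] by (cases "y \<in> S") auto
    qed
  qed
  then show ?thesis by simp
qed

lemma pot_upper:
  assumes "(\<integral>\<^sup>+y. ennreal (v y * norm (x - y) powr (-\<alpha>)) \<partial>lborel) \<le> ennreal B" "B \<ge> 0"
  shows "pot x \<le> B"
proof -
  have "pot x = enn2real (\<integral>\<^sup>+y. ennreal (v y * norm (x - y) powr (-\<alpha>)) \<partial>lborel)"
    unfolding pot_def using v_nonneg by (intro integral_eq_nn_integral) auto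
  also have "\<dots> \<le> B" using assms enn2real_mono[OF assms(1)] by simp
  finally show ?thesis .
qed

text \<open>Change of variables by the reflection that takes \<open>x\<close> to \<open>x'\<close>,
  under which a radial density is invariant.\<close>

lemma pot_radial:
  assumes "\<And>y y'. norm y = norm y' \<Longrightarrow> v y = v y'" "norm x = norm x'"
  shows "pot x = pot x'"
proof -
  obtain f where f: "linear f" "\<And>y. norm (f y) = norm y" "\<And>y. f (f y) = y" "f x = x'"
    using isometry_exists[OF assms(2)] by metis
  have "pot x' = (\<integral>y. v (f y) * norm (x' - f y) powr (-\<alpha>) \<partial>lborel)"
    unfolding pot_def using v_nonneg by (intro integral_lborel_isometry[OF f(1,2,3), symmetric]) auto
  also have "\<dots> = pot x"
    unfolding pot_def
  proof (intro Bochner_Integration.integral_cong refl)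
    fix y
    have "norm (x' - f y) = norm (f (x - y))" using f(4) linear_diff[OF f(1)] by simp
    then show "v (f y) * norm (x' - f y) powr (-\<alpha>) = v y * norm (x - y) powr (-\<alpha>)"
      using assms(1)[of "f y" y] f(2) by simp
  qed
  finally show ?thesis by simp
qed

end

section \<open>The potential of a power of the solution\<close>

definition dens :: "real \<Rightarrow> ('a::euclidean_space \<Rightarrow> real) \<Rightarrow> 'a \<Rightarrow> real" where
  "dens p u y = indicator exterior y * u y powr p"

text \<open>The definitions integrate over the complement of the open ball, whereas
  \<open>dens\<close> lives on the complement of the closed one; the sphere between them is
  null.\<close>

lemma
  fixes u :: "'a::euclidean_space \<Rightarrow> real"
  assumes "dens p u \<in> borel_measurable borel"
  shows conv_dens: "conv \<alpha> p u x = (\<integral>y. dens p u y * norm (x - y) powr (-\<alpha>) \<partial>lborel)"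
    and conv_integrable_dens: "conv_integrable \<alpha> p u \<longleftrightarrow> integrable lborel (\<lambda>y. dens p u y / (1 + norm y powr \<alpha>))"
proof -
  note [measurable] = assms
  have AE: "AE y in lebesgue. indicator (- ball 0 1) y *\<^sub>R (u y powr p / k y) = dens p u y / k y" for k :: "'a \<Rightarrow> real"
    using AE_not_sphere by eventually_elim (auto simp: dens_def indicator_def)
  have [measurable]: "(\<lambda>y. dens p u y / norm (x - y) powr \<alpha>) \<in> borel_measurable borel"
    "(\<lambda>y. dens p u y / (1 + norm y powr \<alpha>)) \<in> borel_measurable borel" by measurable
  show "conv \<alpha> p u x = (\<integral>y. dens p u y * norm (x - y) powr (-\<alpha>) \<partial>lborel)"
    unfolding conv_def set_lebesgue_integral_def
    by (subst lebesgue_AE_eq(1)[OF _ AE]) (simp_all add: powr_minus divide_inverse)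
  show "conv_integrable \<alpha> p u \<longleftrightarrow> integrable lborel (\<lambda>y. dens p u y / (1 + norm y powr \<alpha>))"
    unfolding conv_integrable_def set_integrable_def by (rule lebesgue_AE_eq(2)[OF _ AE]) measurable
qed

lemma dens_continuous_borel:
  fixes u :: "'a::euclidean_space \<Rightarrow> real"
  assumes "continuous_on exterior u" "\<forall>x\<in>exterior. u x > 0"
  shows "dens p u \<in> borel_measurable borel"
proof -
  have "\<forall>x\<in>exterior. u x \<noteq> 0" using assms(2) by force
  then have "continuous_on exterior (\<lambda>x. u x powr p)"
    using assms(1) by (intro continuous_on_powr continuous_on_const) auto
  from borel_measurable_continuous_on_indicator[OF _ this] show ?thesis
    by (simp add: dens_def[abs_def] borel_closed)
qed

lemma riesz_potential_dens:
  fixes u :: "'a::euclidean_space \<Rightarrow> real"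
  assumes "0 < \<alpha>" "\<alpha> < real DIM('a)" "continuous_on exterior u" "\<forall>x\<in>exterior. u x > 0" "conv_integrable \<alpha> p u"
  shows "riesz_potential \<alpha> (dens p u) exterior"
    and "conv \<alpha> p u = riesz_potential.pot \<alpha> (dens p u)"
proof -
  note b = dens_continuous_borel[OF assms(3,4), of p]
  show *: "riesz_potential \<alpha> (dens p u) exterior"
  proof
    show "integrable lborel (\<lambda>y. dens p u y / (1 + norm y powr \<alpha>))"
      using assms(5) conv_integrable_dens[OF b] by blast
    show "\<exists>M. \<forall>y\<in>K. dens p u y \<le> M" if K: "compact K" "K \<subseteq> exterior" for K
    proof -
      have "\<forall>x\<in>K. u x \<noteq> 0" using assms(4) K(2) by force
      then have "continuous_on K (\<lambda>x. u x powr p)"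
        using continuous_on_subset[OF assms(3) K(2)] by (intro continuous_on_powr continuous_on_const) auto
      then have "bounded ((\<lambda>x. u x powr p) ` K)" using K(1) compact_continuous_image compact_imp_bounded by blast
      then obtain M where "\<forall>x\<in>K. \<bar>u x powr p\<bar> \<le> M" unfolding bounded_iff by auto
      then show ?thesis by (intro exI[of _ "\<bar>M\<bar>"]) (force simp: dens_def indicator_def)
    qed
  qed (use assms(1,2) b in \<open>auto simp: dens_def\<close>)
  show "conv \<alpha> p u = riesz_potential.pot \<alpha> (dens p u)"
    using conv_dens[OF b] riesz_potential.pot_def[OF *] by auto
qed

section \<open>The inverse of the flux profile\<close>

context mixed_operator
begin

text \<open>Recovers the slope of a radial function from the size of its flux.\<close>

definition b :: "real \<Rightarrow> real" where "b = the_inv_into {0..} a"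

lemma a_inj: "inj_on a {0..}"
  by (rule inj_onI) (metis a_strict_mono atLeast_iff linorder_neqE_linordered_idom order_less_irrefl)

lemma a_surj: assumes "y \<ge> 0" obtains t where "t \<ge> 0" "a t = y"
proof -
  let ?T = "y powr (1 / (s - 1))"
  have "?T powr (s - 1) = y" using assms ms by (simp add: powr_powr)
  then have "y \<le> a ?T" using a_ge[of ?T] by simp
  then obtain t where "0 \<le> t" "t \<le> ?T" "a t = y"
    using IVT'[of a 0 y ?T] assms continuous_on_subset[OF a_cont, of "{0..?T}"] by auto
  then show ?thesis using that by blast
qed

lemma b_a: "t \<ge> 0 \<Longrightarrow> b (a t) = t"
  unfolding b_def by (rule the_inv_into_f_f[OF a_inj]) simp

lemma a_b: "y \<ge> 0 \<Longrightarrow> a (b y) = y" and b_nonneg: "y \<ge> 0 \<Longrightarrow> b y \<ge> 0"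
  by (metis a_surj b_a)+

lemma b_mono: assumes "0 \<le> x" "x \<le> y" shows "b x \<le> b y"
proof (rule ccontr)
  assume "\<not> b x \<le> b y"
  then have "a (b y) < a (b x)" using assms b_nonneg by (intro a_strict_mono) auto
  then show False using assms by (simp add: a_b)
qed

lemma b_pos: "y > 0 \<Longrightarrow> b y > 0"
  using a_b[of y] b_nonneg[of y] a_0 by (metis less_eq_real_def order_less_irrefl)

lemma b_ge: "t \<ge> 0 \<Longrightarrow> a t \<le> y \<Longrightarrow> t \<le> b y"
  using b_mono[of "a t" y] a_nonneg[of t] b_a by simp

lemma b_le: "y \<ge> 0 \<Longrightarrow> b y \<le> y powr (1 / (s - 1))"
proof -
  assume y: "y \<ge> 0"
  have "(b y powr (s - 1)) powr (1 / (s - 1)) \<le> y powr (1 / (s - 1))"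
    using a_ge[OF b_nonneg[OF y]] a_b[OF y] ms by (intro powr_mono2) auto
  then show ?thesis using b_nonneg[OF y] ms by (simp add: powr_powr)
qed

text \<open>For \<open>y \<le> 1\<close> also \<open>b y \<le> 1\<close>, where the power
  \<open>s - 1\<close> dominates the power \<open>m - 1\<close>. Hence \<open>b\<close> is
  comparable there to the inverse of \<open>t powr (s - 1)\<close>, which determines the decay
  rates.\<close>

lemma b_lower:
  assumes "0 \<le> y" "y \<le> 1"
  shows "(y / (2 * (1 + g 0))) powr (1 / (s - 1)) \<le> b y"
proof -
  have g0: "g 0 > 0" using g_pos by simp
  have "b y \<le> 1" using b_le[OF assms(1)] powr_le1[of "1 / (s - 1)" y] assms ms by simp
  then have "b y powr (m - 1) \<le> b y powr (s - 1)" using b_nonneg[OF assms(1)] ms by (intro powr_mono') auto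
  then have "(1 + g 0) * (b y powr (s - 1) + b y powr (m - 1)) \<le> (1 + g 0) * (2 * b y powr (s - 1))"
    using g0 by (intro mult_left_mono) auto
  then have "y \<le> (1 + g 0) * (2 * b y powr (s - 1))"
    using a_le[OF b_nonneg[OF assms(1)]] a_b[OF assms(1)] by linarith
  then have "y / (2 * (1 + g 0)) \<le> b y powr (s - 1)" using g0 by (simp add: field_simps)
  then have "(y / (2 * (1 + g 0))) powr (1 / (s - 1)) \<le> (b y powr (s - 1)) powr (1 / (s - 1))"
    using assms g0 ms by (intro powr_mono2) auto
  also have "\<dots> = b y" using b_nonneg[OF assms(1)] ms by (simp add: powr_powr)
  finally show ?thesis .
qed

text \<open>Continuity of an inverse comes from compactness, so each point is enclosed in the image
  of an interval \<open>{0..T}\<close>.\<close>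

lemma b_cont: "continuous_on {0..} b"
  unfolding continuous_on_eq_continuous_within
proof
  fix y :: real assume y: "y \<in> {0..}"
  define T where "T = b (y + 1)"
  have T: "T \<ge> 0" "a T = y + 1" using y by (auto simp: T_def a_b b_nonneg)
  have "continuous_on (a ` {0..T}) b"
    by (rule continuous_on_inv) (use continuous_on_subset[OF a_cont, of "{0..T}"] in \<open>auto simp: b_a\<close>)
  moreover have "{0..y+1} \<subseteq> a ` {0..T}"
  proof
    fix z assume z: "z \<in> {0..y+1}"
    then have "b z \<in> {0..T}" using b_nonneg[of z] b_mono[of z "y+1"] by (auto simp: T_def)
    then show "z \<in> a ` {0..T}" using z a_b[of z] by (intro image_eqI[of _ _ "b z"]) auto
  qed
  ultimately have "continuous_on {0..y+1} b" by (rule continuous_on_subset)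
  then have "continuous (at y within {0..y+1}) b" using y by (auto simp: continuous_on_eq_continuous_within)
  moreover have "at y within {0..} = at y within {0..y+1}"
    by (rule at_within_nhd[of _ "{..<y+1}"]) auto
  ultimately show "continuous (at y within {0..}) b" by (simp add: continuous_within)
qed

lemma flux_inverse:
  assumes "\<kappa> \<ge> 0" "norm e = 1"
  shows "A (- (b \<kappa>) *\<^sub>R e) = - \<kappa> *\<^sub>R e"
proof (cases "\<kappa> = 0")
  case True
  then have "b \<kappa> = 0" using b_a[of 0] by simp
  then show ?thesis using True by (simp add: flux_def)
next
  case False
  then have "b \<kappa> > 0" using assms b_pos by simp
  then show ?thesis using assms by (simp add: flux_eq a_b)
qed

end

section \<open>Radial comparison functions\<close>

text \<open>Up to the area of the unit sphere, \<open>H r\<close> is the inward flux of this field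
  through the sphere of radius \<open>r\<close>. Its divergence therefore sees only the derivative
  of \<open>H\<close>, as \<open>radial_field_divergence\<close> states.\<close>

lemma radial_field_gradient:
  fixes x v :: "'a::euclidean_space"
  assumes x: "x \<noteq> 0" and H: "DERIV H (norm x) :> H'" and N: "N = real DIM('a)"
  shows "GDERIV (\<lambda>x. (- (norm x powr (-N) * H (norm x)) *\<^sub>R x) \<bullet> v) x :>
     - (norm x powr (-N) * H (norm x)) *\<^sub>R v - ((x \<bullet> v) * (norm x powr (-N) * H' - N * norm x powr (-N-1) * H (norm x))) *\<^sub>R sgn x"
proof -
  let ?r = "norm x"
  have r: "?r > 0" using x by simp
  have "DERIV (\<lambda>t. - (t powr (-N) * H t)) ?r :> - ((-N) * ?r powr (-N-1) * H ?r + H' * ?r powr (-N))"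
    by (rule DERIV_minus[OF DERIV_mult[OF has_real_derivative_powr[OF r] H]])
  from GDERIV_mult[OF GDERIV_DERIV_compose[OF GDERIV_norm[OF x] this] GDERIV_inner[of v]]
  show ?thesis by (simp add: algebra_simps)
qed

lemma radial_field_divergence:
  fixes x :: "'a::euclidean_space"
  assumes x: "x \<noteq> 0" and N: "N = real DIM('a)"
  shows "(\<Sum>b\<in>Basis. (- (norm x powr (-N) * h) *\<^sub>R b - ((x \<bullet> b) * (norm x powr (-N) * h' - N * norm x powr (-N-1) * h)) *\<^sub>R sgn x) \<bullet> b)
    = - (norm x powr (1 - N) * h')"
proof -
  let ?r = "norm x"
  let ?c = "?r powr (-N) * h' - N * ?r powr (-N-1) * h"
  have r: "?r > 0" using x by simp
  have "x \<bullet> sgn x = ?r" using x by (simp add: sgn_div_norm dot_square_norm power2_eq_square)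
  then have e: "(\<Sum>b\<in>Basis. (x \<bullet> b) * (sgn x \<bullet> b)) = ?r"
    using euclidean_inner[of x "sgn x"] by simp
  have "(\<Sum>b\<in>Basis. (- (?r powr (-N) * h) *\<^sub>R b - ((x \<bullet> b) * ?c) *\<^sub>R sgn x) \<bullet> b)
     = (\<Sum>b\<in>(Basis::'a set). - (?r powr (-N) * h) - ?c * ((x \<bullet> b) * (sgn x \<bullet> b)))"
    by (intro sum.cong) (auto simp: inner_diff_left)
  also have "\<dots> = - N * (?r powr (-N) * h) - ?c * ?r"
    using e by (simp add: sum_subtractf sum_distrib_left[symmetric] N)
  also have "\<dots> = - (?r powr (1 - N) * h')"
  proof -
    have "?r powr (-N-1) * ?r = ?r powr (-N)" "?r powr (-N) * ?r = ?r powr (1 - N)"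
      using r powr_add[of ?r "-N-1" 1] powr_add[of ?r "-N" 1] by (simp_all add: add.commute)
    moreover have "?c * ?r = (?r powr (-N) * ?r) * h' - N * h * (?r powr (-N-1) * ?r)"
      by (simp add: algebra_simps)
    ultimately show ?thesis by (simp add: algebra_simps)
  qed
  finally show ?thesis .
qed

section \<open>Nonexistence\<close>

lemma integral_powr_tail_le:
  fixes \<mu> r1 r2 :: real
  assumes "\<mu> > 1" "0 < r1" "r1 \<le> r2"
  shows "integral {r1..r2} (\<lambda>t. t powr (-\<mu>)) \<le> r1 powr (1 - \<mu>) / (\<mu> - 1)"
    and "(\<lambda>t. t powr (-\<mu>)) integrable_on {r1..r2}"
proof -
  have "((\<lambda>t. t powr (-\<mu>)) has_integral (r2 powr (1 - \<mu>) / (1 - \<mu>) - r1 powr (1 - \<mu>) / (1 - \<mu>))) {r1..r2}"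
  proof (rule fundamental_theorem_of_calculus[OF assms(3)])
    fix t assume t: "t \<in> {r1..r2}"
    then have "t > 0" using assms by simp
    from DERIV_cdivide[OF has_real_derivative_powr[OF this, of "1 - \<mu>"], of "1 - \<mu>"] assms
    have "DERIV (\<lambda>t. t powr (1 - \<mu>) / (1 - \<mu>)) t :> t powr (-\<mu>)" by simp
    then show "((\<lambda>t. t powr (1 - \<mu>) / (1 - \<mu>)) has_vector_derivative t powr (-\<mu>)) (at t within {r1..r2})"
      using has_real_derivative_iff_has_vector_derivative has_vector_derivative_at_within by blast
  qed
  moreover have "r2 powr (1 - \<mu>) / (1 - \<mu>) - r1 powr (1 - \<mu>) / (1 - \<mu>) \<le> r1 powr (1 - \<mu>) / (\<mu> - 1)"
  proof -
    have "r2 powr (1 - \<mu>) / (1 - \<mu>) \<le> 0" using assms by (simp add: divide_nonneg_neg)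
    moreover have "r1 powr (1 - \<mu>) / (1 - \<mu>) = - (r1 powr (1 - \<mu>) / (\<mu> - 1))"
      by (metis minus_diff_eq minus_divide_right)
    ultimately show ?thesis by linarith
  qed
  ultimately show "integral {r1..r2} (\<lambda>t. t powr (-\<mu>)) \<le> r1 powr (1 - \<mu>) / (\<mu> - 1)"
    "(\<lambda>t. t powr (-\<mu>)) integrable_on {r1..r2}"
    by (auto simp: integral_unique has_integral_integrable)
qed

text \<open>The balls \<open>B n\<close>, with radius and distance from the origin both proportional
  to \<open>n + 2\<close>, each carry at least a fixed positive mass of \<open>F\<close>. They also
  escape to infinity, so dominated convergence would make these masses tend to 0.\<close>

lemma power_tail_not_integrable:
  fixes F :: "'a::euclidean_space \<Rightarrow> real"
  assumes F: "integrable lborel F" "\<And>y. F y \<ge> 0" and c: "c > 0"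
    and ge: "\<And>y. norm y \<ge> 2 \<Longrightarrow> F y \<ge> c * norm y powr (- real DIM('a))"
  shows False
proof -
  obtain e :: 'a where e: "norm e = 1" using vector_choose_size[of 1] by auto
  define \<omega> where "\<omega> = measure lborel (ball (0::'a) 1)"
  have om: "\<omega> > 0" using content_ball_pos[of 1 "0::'a"] by (simp add: \<omega>_def)
  define B where "B = (\<lambda>n::nat. ball ((3 * (real n + 2)) *\<^sub>R e) (real n + 2))"
  define R where "R = (\<lambda>n. real n + 2)"
  have B: "R n \<le> norm y \<and> norm y \<le> 4 * R n" if "y \<in> B n" for n y
  proof -
    have "norm ((3 * R n) *\<^sub>R e) = 3 * R n" using e by (simp add: R_def)
    moreover have "norm ((3 * R n) *\<^sub>R e - y) < R n" using that by (simp add: B_def R_def dist_norm)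
    ultimately show ?thesis
      using norm_triangle_ineq2[of "(3 * R n) *\<^sub>R e" y] norm_triangle_ineq3[of "(3 * R n) *\<^sub>R e" y] by linarith
  qed
  have [measurable]: "B n \<in> sets borel" for n unfolding B_def by simp
  have "(\<lambda>n. \<integral>y. indicator (B n) y * F y \<partial>lborel) \<longlonglongrightarrow> (\<integral>y. 0 \<partial>(lborel :: 'a measure))"
  proof (rule integral_dominated_convergence[where w=F])
    show "AE y in lborel. (\<lambda>n. indicator (B n) y * F y) \<longlonglongrightarrow> 0"
    proof (intro AE_I2)
      fix y :: 'a
      have "eventually (\<lambda>n. indicator (B n) y * F y = 0) sequentially"
        using eventually_gt_at_top[of "nat \<lceil>norm y\<rceil>"]
      proof eventually_elim
        case (elim n)
        then have "norm y < R n" unfolding R_def by linarith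
        then have "y \<notin> B n" using B[of y n] by auto
        then show ?case by simp
      qed
      then show "(\<lambda>n. indicator (B n) y * F y) \<longlonglongrightarrow> 0" by (rule tendsto_eventually)
    qed
    show "AE y in lborel. norm (indicator (B n) y * F y) \<le> F y" for n
      using F(2) by (intro AE_I2) (simp add: indicator_def)
  qed (use F in auto)
  then have lim: "(\<lambda>n. \<integral>y. indicator (B n) y * F y \<partial>lborel) \<longlonglongrightarrow> 0" by simp
  have "c * 4 powr (- real DIM('a)) * \<omega> \<le> (\<integral>y. indicator (B n) y * F y \<partial>lborel)" for n
  proof -
    let ?k = "c * (4 * R n) powr (- real DIM('a))"
    have R0: "R n > 0" by (simp add: R_def)
    have "(\<integral>y. ?k * indicator (B n) y \<partial>lborel) \<le> (\<integral>y. indicator (B n) y * F y \<partial>lborel)"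
    proof (rule integral_mono)
      show "integrable lborel (\<lambda>y. ?k * indicator (B n) y)"
        unfolding B_def using emeasure_lborel_ball_finite by (intro integrable_mult_right integrable_real_indicator) auto
      show "integrable lborel (\<lambda>y. indicator (B n) y * F y)"
        by (rule Bochner_Integration.integrable_bound[OF F(1)]) (use F in \<open>auto simp: indicator_def\<close>)
      fix y
      show "?k * indicator (B n) y \<le> indicator (B n) y * F y"
      proof (cases "y \<in> B n")
        case True
        then have "(4 * R n) powr (- real DIM('a)) \<le> norm y powr (- real DIM('a))"
          using B[OF True] R0 by (intro powr_mono2') auto
        then have "?k \<le> c * norm y powr (- real DIM('a))" using c by (intro mult_left_mono) auto
        also have "\<dots> \<le> F y" using ge[of y] B[OF True] by (auto simp: R_def)
        finally show ?thesis using True by simp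
      qed simp
    qed
    moreover have "measure lborel (B n) = \<omega> * R n powr real DIM('a)"
      using R0 by (simp add: B_def \<omega>_def content_ball R_def powr_realpow)
    moreover have "(4 * R n) powr (- real DIM('a)) * R n powr real DIM('a) = 4 powr (- real DIM('a))"
      using R0 by (simp add: powr_mult powr_minus field_simps)
    ultimately show ?thesis by (simp add: ac_simps)
  qed
  then have "c * 4 powr (- real DIM('a)) * \<omega> \<le> 0" by (intro LIMSEQ_le_const[OF lim]) blast
  then show False using c om by (simp add: mult_le_0_iff)
qed

section \<open>Positive supersolutions in the exterior domain\<close>

locale exterior_supersolution = weak_supersolution m s g u f V "exterior"
  for m s :: real and g :: "real \<Rightarrow> real" and u f :: "'a::euclidean_space \<Rightarrow> real" and V :: "'a \<Rightarrow> 'a" +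
  fixes N :: real
  assumes N: "N = real DIM('a)" and sN: "s < N"
    and u_pos: "\<forall>x\<in>exterior. u x > 0"
    and f_nonneg: "\<And>x. x \<in> exterior \<Longrightarrow> f x \<ge> 0"
begin

definition \<gamma> :: real where "\<gamma> = (N - s) / (s - 1)"

lemma gamma_pos: "\<gamma> > 0" using sN ms by (simp add: \<gamma>_def)

lemma u_pos': "norm x > 1 \<Longrightarrow> u x > 0"
  using u_pos by simp

text \<open>The radial function vanishes on the outer sphere, where \<open>u\<close> is positive, so
  a boundary hypothesis is needed on the inner sphere only. Its flux is \<open>H\<close> by
  construction.\<close>

lemma radial_comparison:
  assumes r: "1 < ra" "ra < rb"
    and H: "\<And>t. t > 1 \<Longrightarrow> DERIV H t :> H' t" "continuous_on {1<..} H'" "\<And>t. t > 1 \<Longrightarrow> H t \<ge> 0"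
    and sub: "\<And>x. ra < norm x \<Longrightarrow> norm x < rb \<Longrightarrow> norm x powr (1 - N) * H' (norm x) \<le> f x"
    and bd: "\<And>x. norm x = ra \<Longrightarrow> integral {ra..rb} (\<lambda>t. b (t powr (1 - N) * H t)) \<le> u x"
    and x: "ra \<le> norm x" "norm x \<le> rb"
  shows "integral {norm x..rb} (\<lambda>t. b (t powr (1 - N) * H t)) \<le> u x"
proof -
  define k where "k = (\<lambda>t. b (t powr (1 - N) * H t))"
  have cH: "continuous_on {1<..} H" using H(1) DERIV_isCont by (force intro: continuous_at_imp_continuous_on)
  have kc: "continuous_on {1<..} k"
    unfolding k_def by (rule continuous_on_compose2[OF b_cont])
      (use H(3) cH in \<open>auto intro!: continuous_intros\<close>)
  have kc': "continuous_on {ra..rb} k" using kc r by (auto intro: continuous_on_subset)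
  have ki: "k integrable_on {ra..rb}" using kc' by (rule integrable_continuous_interval)
  \<comment> \<open>Subtraction from the full integral moves the variable to the upper limit, where
    the fundamental theorem of calculus applies.\<close>
  define F where "F = (\<lambda>\<rho>. integral {ra..rb} k - integral {ra..\<rho>} k)"
  have Feq: "F \<rho> = integral {\<rho>..rb} k" if "ra \<le> \<rho>" "\<rho> \<le> rb" for \<rho>
    using Henstock_Kurzweil_Integration.integral_combine[OF that ki] by (simp add: F_def)
  have Fd: "DERIV F \<rho> :> - k \<rho>" if "ra < \<rho>" "\<rho> < rb" for \<rho>
  proof -
    have "((\<lambda>x. integral {ra..x} k) has_real_derivative k \<rho>) (at \<rho> within {ra..rb})"
      using that by (intro integral_has_real_derivative[OF kc']) auto
    then have "DERIV (\<lambda>x. integral {ra..x} k) \<rho> :> k \<rho>" using that by (simp add: at_within_Icc_at)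
    from DERIV_diff[OF DERIV_const this] show ?thesis unfolding F_def by simp
  qed
  have Fc: "continuous_on {ra..rb} F" unfolding F_def
    using indefinite_integral_continuous_1[OF ki] by (intro continuous_intros)
  show ?thesis
  proof (cases "norm x = ra \<or> norm x = rb")
    case True
    then show ?thesis using bd[of x] u_pos'[of x] r by auto
  next
    case False
    define \<Omega> where "\<Omega> = {x::'a. ra < norm x \<and> norm x < rb}"
    have op: "open \<Omega>" unfolding \<Omega>_def by (intro open_Collect_conj open_Collect_less continuous_intros)
    have cl: "closure \<Omega> \<subseteq> {x. ra \<le> norm x \<and> norm x \<le> rb}"
      by (rule closure_minimal) (auto simp: \<Omega>_def intro!: closed_Collect_conj closed_Collect_le continuous_intros)
    have fr: "norm y = ra \<or> norm y = rb" if "y \<in> frontier \<Omega>" for y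
    proof -
      have "y \<in> closure \<Omega>" "y \<notin> \<Omega>" using that op by (auto simp: frontier_def interior_open)
      then show ?thesis using cl by (force simp: \<Omega>_def)
    qed
    have om0: "y \<noteq> 0" "norm y > 1" if "y \<in> \<Omega>" for y using that r by (auto simp: \<Omega>_def)
    have "F (norm x) \<le> u x"
    proof (rule comparison[where z="\<lambda>x. F (norm x)" and Z="\<lambda>x. - (k (norm x)) *\<^sub>R sgn x"
          and G="\<lambda>x. - (norm x powr (-N) * H (norm x)) *\<^sub>R x" and \<Omega>=\<Omega>
          and H="\<lambda>v x. - (norm x powr (-N) * H (norm x)) *\<^sub>R v - ((x \<bullet> v) * (norm x powr (-N) * H' (norm x) - N * norm x powr (-N-1) * H (norm x))) *\<^sub>R sgn x"])
      show "open \<Omega>" by (rule op)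
      show "bounded \<Omega>" by (rule bounded_subset[OF bounded_ball[of 0 rb]]) (auto simp: \<Omega>_def)
      show "closure \<Omega> \<subseteq> exterior" using cl r by force
      show "continuous_on (closure \<Omega>) (\<lambda>x. F (norm x))"
        by (rule continuous_on_compose2[OF Fc]) (use cl in \<open>auto intro!: continuous_intros\<close>)
      show "GDERIV (\<lambda>x. F (norm x)) y :> - k (norm y) *\<^sub>R sgn y" if "y \<in> \<Omega>" for y
        using that by (intro GDERIV_DERIV_compose GDERIV_norm om0 Fd) (auto simp: \<Omega>_def)
      show "continuous_on \<Omega> (\<lambda>x. - k (norm x) *\<^sub>R sgn x)"
        using om0 by (intro continuous_intros continuous_on_compose2[OF kc]) (auto simp: \<Omega>_def)
      show "A (- k (norm y) *\<^sub>R sgn y) = - (norm y powr (-N) * H (norm y)) *\<^sub>R y" if "y \<in> \<Omega>" for y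
      proof -
        have "A (- k (norm y) *\<^sub>R sgn y) = - (norm y powr (1 - N) * H (norm y)) *\<^sub>R sgn y"
          unfolding k_def using om0[OF that] H(3) by (intro flux_inverse) (auto simp: norm_sgn)
        also have "\<dots> = - (norm y powr (-N) * H (norm y)) *\<^sub>R y"
          using om0[OF that] powr_add[of "norm y" 1 "-N"] by (simp add: sgn_div_norm)
        finally show ?thesis .
      qed
      show "GDERIV (\<lambda>x. - (norm x powr (-N) * H (norm x)) *\<^sub>R x \<bullet> v) y :> - (norm y powr (-N) * H (norm y)) *\<^sub>R v - ((y \<bullet> v) * (norm y powr (-N) * H' (norm y) - N * norm y powr (-N-1) * H (norm y))) *\<^sub>R sgn y"
        if "y \<in> \<Omega>" for y v
        using om0[OF that] by (intro radial_field_gradient H N) auto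
      show "continuous_on \<Omega> (\<lambda>x. - (norm x powr (-N) * H (norm x)) *\<^sub>R v - ((x \<bullet> v) * (norm x powr (-N) * H' (norm x) - N * norm x powr (-N-1) * H (norm x))) *\<^sub>R sgn x)" for v
        using om0 by (intro continuous_intros continuous_on_compose2[OF cH] continuous_on_compose2[OF H(2)]) auto
      show "- (\<Sum>b\<in>Basis. (- (norm y powr (-N) * H (norm y)) *\<^sub>R b - ((y \<bullet> b) * (norm y powr (-N) * H' (norm y) - N * norm y powr (-N-1) * H (norm y))) *\<^sub>R sgn y) \<bullet> b) \<le> f y"
        if "y \<in> \<Omega>" for y
        using radial_field_divergence[OF om0(1)[OF that] N, of "H (norm y)" "H' (norm y)"] sub[of y] that by (auto simp: \<Omega>_def)
      show "F (norm y) \<le> u y" if "y \<in> frontier \<Omega>" for y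
        using fr[OF that] bd[of y] u_pos'[of y] r Feq[of rb] Feq[of ra] by (auto simp: k_def)
      show "x \<in> \<Omega>" using False x by (simp add: \<Omega>_def)
    qed
    then show ?thesis using Feq[OF x] by (simp add: k_def)
  qed
qed

text \<open>Scaling \<open>H\<close> by a small factor makes the radial comparison function lie below \<open>u\<close> on the
  sphere of radius 2, uniformly in the outer radius.\<close>

lemma lower_bound:
  assumes H: "\<And>t. t > 1 \<Longrightarrow> DERIV H t :> H' t" "continuous_on {1<..} H'" "\<And>t. t > 1 \<Longrightarrow> H t \<ge> 0"
    "\<And>t. t > 1 \<Longrightarrow> H' t \<ge> 0"
    and CH: "CH > 0" "\<And>t. t \<ge> 2 \<Longrightarrow> H t \<le> CH * t powr \<delta>" and \<delta>: "0 \<le> \<delta>" "\<delta> < N - s"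
    and eH: "eH > 0" "\<And>x. norm x \<ge> 2 \<Longrightarrow> eH * (norm x powr (1 - N) * H' (norm x)) \<le> f x"
  obtains c where "c > 0" "\<And>x. norm x \<ge> 2 \<Longrightarrow> c * norm x powr (-\<gamma>) * H (norm x) powr (1 / (s - 1)) \<le> u x"
proof -
  have s1: "s - 1 > 0" "1 / (s - 1) > 0" using ms by auto
  \<comment> \<open>The decay exponent of the slope \<open>b (t powr (1 - N + \<delta>))\<close>; it
    exceeds 1, and the profile stays bounded, exactly because
    \<open>\<delta> < N - s\<close>.\<close>
  define \<mu> where "\<mu> = (N - 1 - \<delta>) / (s - 1)"
  have mu: "\<mu> > 1" using \<delta> s1 by (simp add: \<mu>_def)
  have g0: "g 0 > 0" using g_pos by simp
  obtain y0 where y0: "y0 \<in> sphere (0::'a) 2" "\<And>y. y \<in> sphere 0 2 \<Longrightarrow> u y0 \<le> u y"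
  proof -
    obtain e :: 'a where "norm e = 2" using vector_choose_size[of 2] by auto
    then have "sphere (0::'a) 2 \<noteq> {}" by auto
    moreover have "continuous_on (sphere 0 2) u" by (rule continuous_on_subset[OF u_cont]) auto
    ultimately show ?thesis using continuous_attains_inf[OF compact_sphere] that by blast
  qed
  define m0 where "m0 = u y0"
  have m0: "m0 > 0" using u_pos'[of y0] y0(1) by (simp add: m0_def)
  \<comment> \<open>With slope at most \<open>q * t powr (- \<mu>)\<close> the profile at radius 2
    is at most \<open>m0\<close>, the minimum of \<open>u\<close> on that sphere.\<close>
  define q where "q = m0 * (\<mu> - 1) / 2 powr (1 - \<mu>)"
  have q: "q > 0" using m0 mu by (simp add: q_def)
  \<comment> \<open>The three bounds serve in turn the differential inequality, the condition
    \<open>?y \<le> 1\<close> of \<open>b_lower\<close>, and the slope bound with constant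
    \<open>q\<close>.\<close>
  define e where "e = min eH (min (1 / CH) (q powr (s - 1) / CH))"
  have e: "e > 0" "e \<le> eH" "e * CH \<le> 1" "e * CH \<le> q powr (s - 1)"
    using eH CH q by (auto simp: e_def min_def field_simps)
  have eq: "(e * CH) powr (1 / (s - 1)) \<le> q"
  proof -
    have "(e * CH) powr (1 / (s - 1)) \<le> (q powr (s - 1)) powr (1 / (s - 1))"
      using e CH s1 by (intro powr_mono2) auto
    then show ?thesis using q s1 by (simp add: powr_powr)
  qed
  let ?k = "\<lambda>t. b (t powr (1 - N) * (e * H t))"
  have cH: "continuous_on {1<..} H" using H(1) DERIV_isCont by (force intro: continuous_at_imp_continuous_on)
  have kc: "continuous_on {1<..} ?k"
    by (rule continuous_on_compose2[OF b_cont]) (use H(3) cH e in \<open>auto intro!: continuous_intros\<close>)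
  have ki: "?k integrable_on {r..r'}" if "r > 1" for r r'
    using kc that by (intro integrable_continuous_interval) (auto intro: continuous_on_subset)
  have arg: "t powr (1 - N) * (e * H t) \<le> (e * CH) * t powr (1 - N + \<delta>)" if "t \<ge> 2" for t
  proof -
    have "t powr (1 - N) * (e * H t) \<le> t powr (1 - N) * (e * (CH * t powr \<delta>))"
      using CH(2)[OF that] e by (intro mult_left_mono) auto
    then show ?thesis by (simp add: powr_add ac_simps)
  qed
  have arg0: "t powr (1 - N) * (e * H t) \<ge> 0" if "t > 1" for t using H(3)[OF that] e by simp
  have kub: "?k t \<le> q * t powr (-\<mu>)" if t: "t \<ge> 2" for t
  proof -
    have "?k t \<le> (t powr (1 - N) * (e * H t)) powr (1 / (s - 1))" using arg0[of t] t by (intro b_le) auto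
    also have "\<dots> \<le> ((e * CH) * t powr (1 - N + \<delta>)) powr (1 / (s - 1))"
      using arg[OF t] arg0[of t] t s1 by (intro powr_mono2) auto
    also have "\<dots> = (e * CH) powr (1 / (s - 1)) * t powr (-\<mu>)"
      by (simp add: powr_mult powr_powr \<mu>_def minus_divide_left algebra_simps)
    also have "\<dots> \<le> q * t powr (-\<mu>)" using eq by (intro mult_right_mono) auto
    finally show ?thesis .
  qed
  have kI: "integral {2..r2} ?k \<le> m0" if r2: "r2 \<ge> 2" for r2
  proof -
    have "integral {2..r2} ?k \<le> integral {2..r2} (\<lambda>t. q * t powr (-\<mu>))"
      using kub integral_powr_tail_le(2)[OF mu _ r2] by (intro integral_le ki integrable_on_mult_right) auto
    also have "\<dots> = q * integral {2..r2} (\<lambda>t. t powr (-\<mu>))" by simp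
    also have "\<dots> \<le> q * (2 powr (1 - \<mu>) / (\<mu> - 1))"
      using integral_powr_tail_le(1)[OF mu _ r2] q by (intro mult_left_mono) auto
    also have "\<dots> = m0" using mu by (simp add: q_def)
    finally show ?thesis .
  qed
  define c where "c = (2 powr (1 - N) * e / (2 * (1 + g 0))) powr (1 / (s - 1))"
  show ?thesis
  proof (rule that[of c])
    show "c > 0" using e g0 by (simp add: c_def)
    fix x :: 'a assume x: "norm x \<ge> 2"
    define \<rho> where "\<rho> = norm x"
    have r: "\<rho> \<ge> 2" using x by (simp add: \<rho>_def)
    \<comment> \<open>A lower bound for the flux density on \<open>{\<rho>..2*\<rho>}\<close>, since
      \<open>H\<close> is nondecreasing. This interval alone gives the profile its full order of
      magnitude, so the outer radius \<open>2 * norm x\<close> suffices.\<close>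
    let ?y = "(2 * \<rho>) powr (1 - N) * (e * H \<rho>)"
    have H0: "H \<rho> \<ge> 0" using H(3) r by simp
    have mono: "b ?y \<le> ?k t" if t: "t \<in> {\<rho>..2*\<rho>}" for t
    proof (rule b_mono)
      show "0 \<le> ?y" using H0 e by simp
      have "H \<rho> \<le> H t"
      proof (rule DERIV_nonneg_imp_nondecreasing[of \<rho> t H])
        show "\<exists>y. DERIV H z :> y \<and> 0 \<le> y" if "\<rho> \<le> z" "z \<le> t" for z
          using H(1)[of z] H(4)[of z] that r by (intro exI[of _ "H' z"]) auto
      qed (use t in simp)
      moreover have "(2 * \<rho>) powr (1 - N) \<le> t powr (1 - N)"
        using t r sN ms by (intro powr_mono2') auto
      ultimately show "?y \<le> t powr (1 - N) * (e * H t)"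
        using H0 e by (intro mult_mono mult_left_mono) auto
    qed
    have "integral {\<rho>..2*\<rho>} (\<lambda>t. b ?y) \<le> integral {\<rho>..2*\<rho>} ?k"
      using mono r by (intro integral_le ki) auto
    then have 1: "\<rho> * b ?y \<le> integral {\<rho>..2*\<rho>} ?k" using r by simp
    have 2: "integral {\<rho>..2*\<rho>} ?k \<le> u x"
      unfolding \<rho>_def
    proof (rule radial_comparison[where ra=2 and rb="2 * norm x" and H="\<lambda>t. e * H t" and H'="\<lambda>t. e * H' t"])
      show "DERIV (\<lambda>t. e * H t) t :> e * H' t" if "t > 1" for t using H(1)[OF that] by (rule DERIV_cmult)
      show "continuous_on {1<..} (\<lambda>t. e * H' t)" using H(2) by (intro continuous_intros)
      show "norm y powr (1 - N) * (e * H' (norm y)) \<le> f y" if "2 < norm y" for y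
      proof -
        have "e * (norm y powr (1 - N) * H' (norm y)) \<le> eH * (norm y powr (1 - N) * H' (norm y))"
          using e H(4)[of "norm y"] that by (intro mult_right_mono) auto
        then show ?thesis using eH(2)[of y] that by (simp add: mult.left_commute)
      qed
      show "integral {2..2 * norm x} ?k \<le> u y" if "norm y = 2" for y
        using kI[of "2 * norm x"] x y0(2)[of y] that by (simp add: m0_def)
    qed (use x e H(3) in auto)
    have y1: "?y \<le> 1"
    proof -
      have "?y \<le> \<rho> powr (1 - N) * (e * H \<rho>)"
        using r sN ms e H0 by (intro mult_right_mono powr_mono2') auto
      also have "\<dots> \<le> (e * CH) * \<rho> powr (1 - N + \<delta>)" by (rule arg[OF r])
      also have "\<dots> \<le> 1 * 1"
        using e CH r \<delta> ms powr_mono[of "1 - N + \<delta>" 0 \<rho>] by (intro mult_mono) auto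
      finally show ?thesis by simp
    qed
    have "c * \<rho> powr (-\<gamma>) * H \<rho> powr (1 / (s - 1)) = \<rho> * (?y / (2 * (1 + g 0))) powr (1 / (s - 1))"
    proof -
      have "-\<gamma> = 1 + (1 - N) * (1 / (s - 1))" using s1 by (simp add: \<gamma>_def field_simps)
      then have "\<rho> powr (-\<gamma>) = \<rho> * (\<rho> powr (1 - N)) powr (1 / (s - 1))" using r by (simp add: powr_add powr_powr)
      moreover have "?y / (2 * (1 + g 0)) = (2 powr (1 - N) * e / (2 * (1 + g 0))) * (\<rho> powr (1 - N) * H \<rho>)"
        by (simp add: powr_mult)
      ultimately show ?thesis unfolding c_def by (simp only: powr_mult) simp
    qed
    also have "\<dots> \<le> \<rho> * b ?y" using b_lower[OF _ y1] H0 e r by (intro mult_left_mono) auto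
    finally show "c * norm x powr (-\<gamma>) * H (norm x) powr (1 / (s - 1)) \<le> u x" using 1 2 by (simp add: \<rho>_def)
  qed
qed

text \<open>Comparison with \<open>K\<close> plus the radial function of constant right-hand side
  \<open>d\<close> that vanishes on the boundary. Its flux is \<open>- (d / N) (x - x0)\<close>, its
  slope at radius \<open>t\<close> is \<open>b (d * t / N)\<close>, and the gain comes from
  integrating the slope over the outer half of the radius.\<close>

lemma ball_step:
  assumes \<rho>: "\<rho> > 0" "cball x0 \<rho> \<subseteq> exterior" and d: "d \<ge> 0"
    and K: "\<And>x. x \<in> cball x0 \<rho> \<Longrightarrow> K \<le> u x" and f: "\<And>x. x \<in> ball x0 \<rho> \<Longrightarrow> d \<le> f x"
    and x: "x \<in> cball x0 (\<rho> / 2)"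
  shows "K + (\<rho> / 2) * b (d * \<rho> / (2 * N)) \<le> u x"
proof -
  have N0: "N > 0" using sN ms by simp
  define k where "k = (\<lambda>t. b (d * t / N))"
  have k0: "k t \<ge> 0" if "t \<ge> 0" for t unfolding k_def using that d N0 by (intro b_nonneg) simp
  have kmono: "k t \<le> k t'" if "0 \<le> t" "t \<le> t'" for t t'
    unfolding k_def using that d N0 by (intro b_mono divide_right_mono mult_left_mono) auto
  have kc: "continuous_on {0..} k" unfolding k_def
    by (rule continuous_on_compose2[OF b_cont]) (use d N0 in \<open>auto intro!: continuous_intros\<close>)
  have ki: "k integrable_on {t..t'}" if "t \<ge> 0" for t t'
    using kc that by (intro integrable_continuous_interval) (auto intro: continuous_on_subset)
  have kz: "k 0 = 0" using b_a[of 0] by (simp add: k_def)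
  define F where "F = (\<lambda>r. integral {0..\<rho>} k - integral {0..r} k)"
  have Feq: "F r = integral {r..\<rho>} k" if "0 \<le> r" "r \<le> \<rho>" for r
    using Henstock_Kurzweil_Integration.integral_combine[OF that ki] by (simp add: F_def)
  have Fd: "DERIV F r :> - k r" if "0 < r" for r
  proof -
    have "((\<lambda>x. integral {0..x} k) has_real_derivative k r) (at r within {0..r+1})"
      using that kc by (intro integral_has_real_derivative) (auto intro: continuous_on_subset)
    then have "DERIV (\<lambda>x. integral {0..x} k) r :> k r" using that by (simp add: at_within_Icc_at)
    from DERIV_diff[OF DERIV_const this] show ?thesis unfolding F_def by simp
  qed
  have Fc: "continuous_on {0..\<rho>} F" unfolding F_def
    using indefinite_integral_continuous_1[OF ki[of 0]] by (intro continuous_intros) auto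
  define Z where "Z = (\<lambda>x::'a. - (k (norm (x - x0))) *\<^sub>R sgn (x - x0))"
  have kn: "continuous_on UNIV (\<lambda>y. k (norm (y - x0)))"
    by (rule continuous_on_compose2[OF kc]) (auto intro!: continuous_intros)
  then have "isCont (\<lambda>y. k (norm (y - x0))) x0" by (simp add: continuous_on_eq_continuous_at)
  then have kt: "((\<lambda>y. k (norm (y - x0))) \<longlongrightarrow> 0) (at x0)"
    using kz by (simp add: isCont_def)
  have Zn: "norm (Z y) \<le> k (norm (y - x0))" for y
    unfolding Z_def using k0[of "norm (y - x0)"] by (cases "y = x0") (auto simp: norm_sgn kz)
  have Z0: "Z x0 = 0" by (simp add: Z_def)
  have Zc: "continuous_on UNIV Z"
  proof (intro continuous_at_imp_continuous_on ballI)
    fix y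
    show "isCont Z y"
    proof (cases "y = x0")
      case True
      have "(Z \<longlongrightarrow> 0) (at x0)" by (rule Lim_null_comparison[OF _ kt]) (use Zn in simp)
      then show ?thesis using True Z0 by (simp add: isCont_def)
    next
      case False
      have "isCont (\<lambda>y. k (norm (y - x0))) y" using kn by (simp add: continuous_on_eq_continuous_at)
      then show ?thesis unfolding Z_def using False by (intro continuous_intros) auto
    qed
  qed
  \<comment> \<open>The norm is not differentiable at the centre. There \<open>k 0 = 0\<close>, so
    both the derivative and the field \<open>Z\<close> are 0 and have to be treated
    separately.\<close>
  have gz: "GDERIV (\<lambda>y. K + F (norm (y - x0))) y :> Z y" for y
  proof (cases "y = x0")
    case False
    have "GDERIV (\<lambda>y. norm (y - x0)) y :> sgn (y - x0)"
    proof -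
      have "((\<lambda>y. y - x0) has_derivative (\<lambda>h. h)) (at y)" by (auto intro!: derivative_eq_intros)
      from has_derivative_compose[OF this GDERIV_norm[unfolded gderiv_def]] False
      show ?thesis unfolding gderiv_def by simp
    qed
    from GDERIV_DERIV_compose[OF this Fd] False
    have "GDERIV (\<lambda>y. F (norm (y - x0))) y :> Z y" by (simp add: Z_def)
    from GDERIV_add[OF GDERIV_const this] show ?thesis by simp
  next
    case True
    have "((\<lambda>y. (F (norm (y - x0)) - F 0) / norm (y - x0)) \<longlongrightarrow> 0) (at x0)"
    proof (rule Lim_null_comparison[OF _ kt], unfold eventually_at_filter, intro always_eventually allI impI)
      fix y assume y: "y \<noteq> x0"
      let ?r = "norm (y - x0)"
      have "integral {0..?r} k \<le> integral {0..?r} (\<lambda>t. k ?r)" using kmono by (intro integral_le ki) auto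
      moreover have "integral {0..?r} k \<ge> 0" using k0 by (intro Henstock_Kurzweil_Integration.integral_nonneg ki) auto
      ultimately show "norm ((F ?r - F 0) / ?r) \<le> k ?r" using y by (simp add: F_def field_simps)
    qed
    then have "((\<lambda>y. K + F (norm (y - x0))) has_derivative (\<lambda>h. 0)) (at x0)"
      unfolding has_derivative_at2 by (simp add: divide_inverse mult.commute)
    then show ?thesis using True Z0 by (simp add: gderiv_def)
  qed
  have "K + F (norm (x - x0)) \<le> u x"
  proof (rule comparison[where z="\<lambda>y. K + F (norm (y - x0))" and Z=Z and G="\<lambda>y. - (d / N) *\<^sub>R (y - x0)"
        and \<Omega>="ball x0 \<rho>" and H="\<lambda>v y. - (d / N) *\<^sub>R v"])
    have cl: "closure (ball x0 \<rho>) = cball x0 \<rho>" using \<rho> by (simp add: closure_ball)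
    show "closure (ball x0 \<rho>) \<subseteq> exterior" using cl \<rho>(2) by simp
    show "continuous_on (closure (ball x0 \<rho>)) (\<lambda>y. K + F (norm (y - x0)))"
      unfolding cl by (intro continuous_intros continuous_on_compose2[OF Fc]) (auto simp: dist_norm norm_minus_commute)
    show "continuous_on (ball x0 \<rho>) Z" using Zc continuous_on_subset by blast
    show "A (Z y) = - (d / N) *\<^sub>R (y - x0)" for y
    proof (cases "y = x0")
      case True then show ?thesis by (simp add: Z0 flux_def)
    next
      case False
      have "A (Z y) = - (d * norm (y - x0) / N) *\<^sub>R sgn (y - x0)"
        unfolding Z_def k_def using d N0 False by (intro flux_inverse) (auto simp: norm_sgn)
      then show ?thesis using False by (simp add: sgn_div_norm)
    qed
    show "GDERIV (\<lambda>y. - (d / N) *\<^sub>R (y - x0) \<bullet> v) y :> - (d / N) *\<^sub>R v" for y v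
      using GDERIV_diff[OF GDERIV_inner[of "- (d / N) *\<^sub>R v" y] GDERIV_const[of "- (d / N) * (x0 \<bullet> v)" y]]
      by (simp add: inner_diff_left algebra_simps)
    show "- (\<Sum>v\<in>(Basis::'a set). (- (d / N) *\<^sub>R v) \<bullet> v) \<le> f y" if "y \<in> ball x0 \<rho>" for y
      using f[OF that] N N0 by (simp add: sum_negf)
    show "K + F (norm (y - x0)) \<le> u y" if "y \<in> frontier (ball x0 \<rho>)" for y
    proof -
      have "norm (y - x0) = \<rho>" using that \<rho> by (simp add: frontier_ball dist_norm norm_minus_commute)
      then show ?thesis using K[of y] Feq[of \<rho>] \<rho> by (simp add: dist_norm norm_minus_commute)
    qed
    show "x \<in> ball x0 \<rho>" using x \<rho> by auto
  qed (use gz in \<open>auto intro!: continuous_intros\<close>)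
  moreover have "(\<rho> / 2) * b (d * \<rho> / (2 * N)) \<le> F (norm (x - x0))"
  proof -
    let ?r = "norm (x - x0)"
    have r: "?r \<le> \<rho> / 2" using x by (simp add: dist_norm norm_minus_commute)
    have "integral {\<rho>/2..\<rho>} (\<lambda>t. k (\<rho> / 2)) \<le> integral {\<rho>/2..\<rho>} k"
      using kmono \<rho> by (intro integral_le ki) auto
    also have "\<dots> \<le> integral {?r..\<rho>} k"
      using r \<rho> k0 order_trans[OF norm_ge_zero[of "x - x0"]] by (intro integral_subset_le ki) auto
    also have "\<dots> = F ?r" using r \<rho> by (intro Feq[symmetric]) auto
    finally show ?thesis using \<rho> by (simp add: k_def)
  qed
  ultimately show ?thesis by linarith
qed

text \<open>The condition \<open>big\<close> survives the step from \<open>(K, \<rho>)\<close> to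
  \<open>(\<theta> * K, \<rho> / 2)\<close>, because its right-hand side is multiplied by
  \<open>\<theta> powr (q - \<sigma> + 1) / 2 powr \<sigma>\<close>. The value of
  \<open>\<theta>\<close> makes this factor 1 for \<open>\<sigma> = m\<close> and larger for
  \<open>\<sigma> = s\<close>. Both exponents are needed since \<open>a\<close> is controlled by a
  sum of two powers.\<close>

lemma blow_up:
  fixes q :: real
  assumes q: "q > m - 1" and \<rho>: "\<rho> > 0" "cball x0 \<rho> \<subseteq> exterior" and D: "D > 0" and K: "K > 0"
    and uK: "\<And>x. x \<in> cball x0 \<rho> \<Longrightarrow> K \<le> u x"
    and fD: "\<And>x. x \<in> cball x0 \<rho> \<Longrightarrow> D * u x powr q \<le> f x"
    and \<theta>: "\<theta> = 2 powr (m / (q - m + 1))"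
    and big: "\<And>\<sigma>. \<sigma> \<in> {s, m} \<Longrightarrow> 4 * N * (1 + g 0) * (2 * \<theta>) powr (m - 1) \<le> D * K powr (q - \<sigma> + 1) * \<rho> powr \<sigma>"
  shows False
proof -
  have N0: "N > 0" using sN ms by simp
  have g0: "g 0 > 0" using g_pos by simp
  have th: "\<theta> > 1" unfolding \<theta> using q m1 by (simp add: gr_one_powr)
  have th\<sigma>: "\<theta> powr (q - \<sigma> + 1) \<ge> 2 powr \<sigma>" if "\<sigma> \<in> {s, m}" for \<sigma>
  proof -
    have "2 powr \<sigma> \<le> 2 powr m" using that ms by (intro powr_mono) auto
    also have "\<dots> = \<theta> powr (q - m + 1)" unfolding \<theta> using q by (simp add: powr_powr)
    also have "\<dots> \<le> \<theta> powr (q - \<sigma> + 1)" using that ms th by (intro powr_mono) auto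
    finally show ?thesis .
  qed
  define Kj where "Kj = (\<lambda>j::nat. \<theta> ^ j * K)"
  define rj where "rj = (\<lambda>j::nat. \<rho> / 2 ^ j)"
  have Kj0: "Kj j > 0" and rj0: "rj j > 0" for j using th K \<rho> by (auto simp: Kj_def rj_def)
  have rj\<rho>: "rj j \<le> \<rho>" for j using \<rho>(1) by (simp add: rj_def divide_le_eq mult_le_cancel_left1)
  have claim: "\<forall>x\<in>cball x0 (rj j). Kj j \<le> u x" for j
  proof (induction j)
    case 0
    then show ?case using uK by (simp add: Kj_def rj_def)
  next
    case (Suc j)
    have sub: "cball x0 (rj j) \<subseteq> cball x0 \<rho>" using rj\<rho> by (rule subset_cball)
    define d where "d = D * Kj j powr q"
    have fd: "d \<le> f x" if "x \<in> ball x0 (rj j)" for x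
    proof -
      have x: "x \<in> cball x0 (rj j)" using that by simp
      then have "Kj j powr q \<le> u x powr q" using Suc Kj0[of j] q m1 by (intro powr_mono2) (auto simp: less_imp_le)
      then have "d \<le> D * u x powr q" unfolding d_def using D by (intro mult_left_mono) auto
      then show ?thesis using fD[of x] x sub by auto
    qed
    \<comment> \<open>The slope for which the gain \<open>(rj j / 2) * t\<close> of
      \<open>ball_step\<close> equals \<open>\<theta> * Kj j\<close>.\<close>
    define t where "t = 2 * \<theta> * Kj j / rj j"
    have t0: "t > 0" using th Kj0[of j] rj0[of j] by (simp add: t_def)
    \<comment> \<open>Each of the two powers bounding \<open>a t\<close> may use up half of the
      available flux \<open>d * rj j / (2 * N)\<close>.\<close>
    have half: "(1 + g 0) * t powr (\<sigma> - 1) \<le> d * rj j / (4 * N)" if \<sigma>: "\<sigma> \<in> {s, m}" for \<sigma>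
    proof -
      have "4 * N * (1 + g 0) * (2 * \<theta>) powr (\<sigma> - 1) \<le> 4 * N * (1 + g 0) * (2 * \<theta>) powr (m - 1)"
        using \<sigma> ms th N0 g0 by (intro mult_left_mono powr_mono) auto
      also have "\<dots> \<le> D * K powr (q - \<sigma> + 1) * \<rho> powr \<sigma>" by (rule big[OF \<sigma>])
      also have "\<dots> \<le> D * K powr (q - \<sigma> + 1) * \<rho> powr \<sigma> * (\<theta> powr (q - \<sigma> + 1) / 2 powr \<sigma>) ^ j"
      proof -
        have "1 \<le> (\<theta> powr (q - \<sigma> + 1) / 2 powr \<sigma>) ^ j" using th\<sigma>[OF \<sigma>] by (intro one_le_power) simp
        from mult_left_mono[OF this, of "D * K powr (q - \<sigma> + 1) * \<rho> powr \<sigma>"] D show ?thesis by simp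
      qed
      also have "\<dots> = D * Kj j powr (q - \<sigma> + 1) * rj j powr \<sigma>"
      proof -
        have "(\<theta> ^ j) powr (q - \<sigma> + 1) = (\<theta> powr (q - \<sigma> + 1)) ^ j" "(2 ^ j) powr \<sigma> = (2 powr \<sigma>) ^ j"
          using th by (simp_all add: powr_realpow[symmetric] powr_powr mult.commute)
        then show ?thesis by (simp add: Kj_def rj_def powr_mult powr_divide power_divide)
      qed
      finally have main: "4 * N * (1 + g 0) * (2 * \<theta>) powr (\<sigma> - 1) \<le> D * Kj j powr (q - \<sigma> + 1) * rj j powr \<sigma>" .
      have "Kj j powr (q - \<sigma> + 1) * Kj j powr (\<sigma> - 1) = Kj j powr q" "rj j powr \<sigma> = rj j * rj j powr (\<sigma> - 1)"
        using rj0[of j] powr_add[of "rj j" 1 "\<sigma> - 1"] by (simp_all add: powr_add[symmetric])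
      then have e: "D * Kj j powr (q - \<sigma> + 1) * rj j powr \<sigma> * (Kj j powr (\<sigma> - 1) / rj j powr (\<sigma> - 1)) = d * rj j"
        using rj0[of j] by (simp add: d_def field_simps)
      have "4 * N * ((1 + g 0) * t powr (\<sigma> - 1)) = 4 * N * (1 + g 0) * (2 * \<theta>) powr (\<sigma> - 1) * (Kj j powr (\<sigma> - 1) / rj j powr (\<sigma> - 1))"
        unfolding t_def by (simp add: powr_mult powr_divide)
      also have "\<dots> \<le> d * rj j" unfolding e[symmetric] by (intro mult_right_mono main) auto
      finally show ?thesis using N0 by (simp add: field_simps)
    qed
    have "a t \<le> (1 + g 0) * t powr (s - 1) + (1 + g 0) * t powr (m - 1)"
      using a_le[of t] t0 by (simp add: distrib_left)
    also have "\<dots> \<le> d * rj j / (2 * N)" using half[of s] half[of m] by simp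
    finally have "t \<le> b (d * rj j / (2 * N))" using t0 by (intro b_ge) auto
    then have "\<theta> * Kj j \<le> (rj j / 2) * b (d * rj j / (2 * N))"
      using rj0[of j] by (simp add: t_def field_simps)
    moreover have "Kj j + (rj j / 2) * b (d * rj j / (2 * N)) \<le> u x" if "x \<in> cball x0 (rj j / 2)" for x
      using Suc sub \<rho>(2) rj0[of j] D by (intro ball_step[OF _ _ _ _ fd that]) (auto simp: d_def)
    ultimately have "\<theta> * Kj j \<le> u x" if "x \<in> cball x0 (rj j / 2)" for x
      using that Kj0[of j] by force
    moreover have "Kj (Suc j) = \<theta> * Kj j" "rj (Suc j) = rj j / 2" by (simp_all add: Kj_def rj_def)
    ultimately show ?case by simp
  qed
  obtain j where "u x0 / K < \<theta> ^ j" using real_arch_pow[OF th] by blast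
  then have "u x0 < Kj j" using K by (simp add: Kj_def field_simps)
  then show False using claim[of j] rj0[of j] by (auto dest: bspec[of _ _ x0])
qed

text \<open>A constant flux \<open>H = 1\<close> is divergence free, so nonnegativity of the
  right-hand side is enough for the comparison.\<close>

lemma fundamental_lower_bound:
  obtains c where "c > 0" "\<And>x. norm x \<ge> 2 \<Longrightarrow> c * norm x powr (-\<gamma>) \<le> u x"
proof -
  obtain c where c: "c > 0" "\<And>x. norm x \<ge> 2 \<Longrightarrow> c * norm x powr (-\<gamma>) * 1 powr (1 / (s - 1)) \<le> u x"
  proof (rule lower_bound[where H="\<lambda>t. 1" and H'="\<lambda>t. 0" and CH=1 and \<delta>=0 and eH = 1])
    show "1 * (norm x powr (1 - N) * 0) \<le> f x" if "2 \<le> norm x" for x using f_nonneg[of x] that by simp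
  qed (use sN that in auto)
  then show ?thesis using that by simp
qed

text \<open>If the potential decays like \<open>norm x powr (-\<beta>)\<close> with \<open>\<beta> + \<gamma> * q \<le> N\<close>, the right-hand side has
  infinite mass at infinity; the resulting logarithmic gain over the fundamental lower bound
  contradicts the local upper bound expressed by \<open>blow_up\<close>.\<close>

lemma no_slow_potential:
  fixes q \<beta> :: real
  assumes q: "q > m - 1" and W: "\<And>x. x \<in> exterior \<Longrightarrow> f x = W x * u x powr q"
    and c1: "c1 > 0" "\<And>x. norm x \<ge> 2 \<Longrightarrow> c1 * norm x powr (-\<beta>) \<le> W x"
    and \<beta>: "\<beta> + \<gamma> * q \<le> N"
  shows False
proof -
  have s1: "s - 1 > 0" using ms by simp
  have N1: "N > 1" using sN ms by simp
  have q0: "q > 0" using q m1 by simp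
  have g0: "g 0 > 0" using g_pos by simp
  obtain c2 where c2: "c2 > 0" "\<And>x. norm x \<ge> 2 \<Longrightarrow> c2 * norm x powr (-\<gamma>) \<le> u x"
    using fundamental_lower_bound by blast
  have fge: "c1 * c2 powr q * norm x powr (-N) \<le> f x" if x: "norm x \<ge> 2" for x
  proof -
    have "norm x powr (-N) \<le> norm x powr (-\<beta> + -\<gamma> * q)" using x \<beta> by (intro powr_mono) auto
    then have "c1 * c2 powr q * norm x powr (-N) \<le> c1 * c2 powr q * (norm x powr (-\<beta>) * norm x powr (-\<gamma> * q))"
      using c1 by (intro mult_left_mono) (auto simp: powr_add[symmetric])
    also have "\<dots> = (c1 * norm x powr (-\<beta>)) * (c2 * norm x powr (-\<gamma>)) powr q"
      by (simp add: powr_mult powr_powr)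
    also have "\<dots> \<le> W x * u x powr q"
    proof (intro mult_mono powr_mono2 c1(2) c2(2) x)
      show "0 \<le> W x" using c1(1) by (intro order_trans[OF _ c1(2)[OF x]]) simp
    qed (use q0 c2 in auto)
    also have "\<dots> = f x" using W[of x] x by simp
    finally show ?thesis .
  qed
  \<comment> \<open>An exponent strictly between 0 and \<open>N - s\<close>, with which
    \<open>ln t \<le> t powr \<delta> / \<delta>\<close> makes the logarithm an admissible
    \<open>H\<close> in \<open>lower_bound\<close>.\<close>
  define \<delta> where "\<delta> = (N - s) / 2"
  have \<delta>: "0 < \<delta>" "\<delta> < N - s" using sN by (auto simp: \<delta>_def)
  obtain c3 where c3: "c3 > 0" "\<And>x. norm x \<ge> 2 \<Longrightarrow> c3 * norm x powr (-\<gamma>) * ln (norm x) powr (1 / (s - 1)) \<le> u x"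
  proof (rule lower_bound[where H=ln and H'="\<lambda>t. 1 / t" and CH="1 / \<delta>" and \<delta>=\<delta> and eH = "c1 * c2 powr q"])
    show "c1 * c2 powr q * (norm x powr (1 - N) * (1 / norm x)) \<le> f x" if "2 \<le> norm x" for x
    proof -
      have "norm x powr (1 - N) * (1 / norm x) = norm x powr (-N)" using that powr_diff[of "norm x" "1 - N" 1] by simp
      then show ?thesis using fge[OF that] by simp
    qed
    show "ln t \<le> 1 / \<delta> * t powr \<delta>" if "2 \<le> t" for t using ln_powr_bound[of t \<delta>] that \<delta> by simp
  qed (use \<delta> c1 c2 that in \<open>auto intro!: DERIV_ln_divide continuous_intros\<close>)
  define \<theta> where "\<theta> = 2 powr (m / (q - m + 1))"
  define C where "C = 4 * N * (1 + g 0) * (2 * \<theta>) powr (m - 1)"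
  have C0: "C > 0" using N1 g0 by (simp add: C_def \<theta>_def)
  \<comment> \<open>Compares \<open>norm y powr (- \<beta>)\<close> with
    \<open>R powr (- \<beta>)\<close> for \<open>norm y\<close> between \<open>R / 2\<close> and
    \<open>3 / 2 * R\<close>; the minimum covers both signs of \<open>\<beta>\<close>.\<close>
  define \<kappa> where "\<kappa> = min ((1/2) powr (-\<beta>)) ((3/2) powr (-\<beta>))"
  have k0: "\<kappa> > 0" by (simp add: \<kappa>_def)
  define Q where "Q = c1 * \<kappa> * (c3 * (3/2) powr (-\<gamma>)) powr (q - s + 1) * (1/2) powr s"
  have Q0: "Q > 0" using c1 c3 k0 by (simp add: Q_def)
  have qs: "q - s + 1 > 0" using q ms by simp
  \<comment> \<open>The size that the logarithmic factor must reach: with it the constants collected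
    in \<open>Q\<close> meet the threshold \<open>C\<close> of \<open>blow_up\<close>.\<close>
  define L where "L = (C / Q) powr (1 / (q - s + 1))"
  have L: "L > 0" "Q * L powr (q - s + 1) = C" using Q0 C0 qs by (auto simp: L_def powr_powr)
  \<comment> \<open>So far out the logarithmic factor is at least \<open>L\<close> on the whole
    ball, and the lower bound \<open>K\<close> does not exceed the radius
    \<open>\<rho>\<close>.\<close>
  define R where "R = max 4 (max (2 * exp (L powr (s - 1))) (2 * (c3 * L)))"
  have R: "R \<ge> 4" "2 * exp (L powr (s - 1)) \<le> R" "2 * (c3 * L) \<le> R" by (auto simp: R_def)
  obtain x0 :: 'a where x0: "norm x0 = R" using vector_choose_size[of R] R by auto
  define \<rho> where "\<rho> = R / 2"
  have near: "R / 2 \<le> norm y \<and> norm y \<le> 3 / 2 * R" if "y \<in> cball x0 \<rho>" for y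
    using that x0 norm_triangle_ineq3[of x0 y] by (simp add: dist_norm \<rho>_def abs_le_iff)
  define K where "K = c3 * (3/2 * R) powr (-\<gamma>) * L"
  define D where "D = c1 * (\<kappa> * R powr (-\<beta>))"
  have K0: "K > 0" using c3 L R by (simp add: K_def)
  have D0: "D > 0" using c1 k0 R by (simp add: D_def)
  have uK: "K \<le> u y" if y: "y \<in> cball x0 \<rho>" for y
  proof -
    have n: "R / 2 \<le> norm y" "norm y \<le> 3/2 * R" "norm y \<ge> 2" using near[OF y] R by auto
    have "L powr (s - 1) \<le> ln (norm y)"
    proof -
      have "exp (L powr (s - 1)) \<le> norm y" using R n by linarith
      moreover have "norm y > 0" using n by linarith
      ultimately show ?thesis using ln_ge_iff by blast
    qed
    then have "(L powr (s - 1)) powr (1 / (s - 1)) \<le> ln (norm y) powr (1 / (s - 1))" using s1 by (intro powr_mono2) auto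
    then have "L \<le> ln (norm y) powr (1 / (s - 1))" using L s1 by (simp add: powr_powr)
    moreover have "(3/2 * R) powr (-\<gamma>) \<le> norm y powr (-\<gamma>)" using n gamma_pos by (intro powr_mono2') auto
    ultimately have "K \<le> c3 * norm y powr (-\<gamma>) * ln (norm y) powr (1 / (s - 1))"
      unfolding K_def using c3 L by (intro mult_mono mult_left_mono) auto
    then show ?thesis using c3(2)[OF n(3)] by linarith
  qed
  have fD: "D * u y powr q \<le> f y" if y: "y \<in> cball x0 \<rho>" for y
  proof -
    have n: "R / 2 \<le> norm y" "norm y \<le> 3/2 * R" "norm y \<ge> 2" using near[OF y] R by auto
    have "\<kappa> * R powr (-\<beta>) \<le> norm y powr (-\<beta>)"
    proof (cases "\<beta> \<ge> 0")
      case True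
      have "\<kappa> * R powr (-\<beta>) \<le> (3/2) powr (-\<beta>) * R powr (-\<beta>)" by (intro mult_right_mono) (auto simp: \<kappa>_def)
      also have "\<dots> = (3/2 * R) powr (-\<beta>)" by (rule powr_mult[symmetric])
      also have "\<dots> \<le> norm y powr (-\<beta>)" using n True by (intro powr_mono2') auto
      finally show ?thesis .
    next
      case False
      have "\<kappa> * R powr (-\<beta>) \<le> (1/2) powr (-\<beta>) * R powr (-\<beta>)" by (intro mult_right_mono) (auto simp: \<kappa>_def)
      also have "\<dots> = (1/2 * R) powr (-\<beta>)" by (rule powr_mult[symmetric])
      also have "\<dots> \<le> norm y powr (-\<beta>)" using n False R by (intro powr_mono2) auto
      finally show ?thesis .
    qed
    then have "D \<le> W y" using c1(2)[OF n(3)] c1(1) unfolding D_def by (meson less_imp_le mult_left_mono order_trans)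
    then have "D * u y powr q \<le> W y * u y powr q" by (intro mult_right_mono) auto
    then show ?thesis using W[of y] n by simp
  qed
  \<comment> \<open>Since \<open>\<gamma> * (s - 1) = N - s\<close>, the powers of \<open>R\<close>
    add up to \<open>N - \<beta> - \<gamma> * q\<close>, which is nonnegative. The condition is
    scale invariant in the borderline case, and only the factor \<open>L\<close> makes it
    hold.\<close>
  have bs: "C \<le> D * K powr (q - s + 1) * \<rho> powr s"
  proof -
    have "K = c3 * (3/2) powr (-\<gamma>) * L * R powr (-\<gamma>)" unfolding K_def by (simp only: powr_mult mult.assoc mult.commute[of L])
    then have "K powr (q - s + 1) = (c3 * (3/2) powr (-\<gamma>)) powr (q - s + 1) * L powr (q - s + 1) * R powr (-\<gamma> * (q - s + 1))"
      by (simp only: powr_mult powr_powr)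
    moreover have "\<rho> powr s = R powr s * (1/2) powr s" unfolding \<rho>_def by (simp add: powr_divide)
    ultimately have "D * K powr (q - s + 1) * \<rho> powr s
       = Q * L powr (q - s + 1) * (R powr (-\<beta>) * R powr (-\<gamma> * (q - s + 1)) * R powr s)"
      unfolding D_def Q_def by (simp only: ac_simps)
    also have "R powr (-\<beta>) * R powr (-\<gamma> * (q - s + 1)) * R powr s = R powr (-\<beta> + -\<gamma> * (q - s + 1) + s)"
      by (simp only: powr_add)
    also have "-\<beta> + -\<gamma> * (q - s + 1) + s = N - \<beta> - \<gamma> * q"
      using s1 by (simp add: \<gamma>_def field_simps)
    finally have "D * K powr (q - s + 1) * \<rho> powr s = C * R powr (N - \<beta> - \<gamma> * q)" using L by simp
    moreover have "1 \<le> R powr (N - \<beta> - \<gamma> * q)" using R \<beta> by (intro ge_one_powr_ge_zero) auto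
    ultimately show ?thesis using C0 by simp
  qed
  have K\<rho>: "K \<le> \<rho>"
  proof -
    have "(3/2 * R) powr (-\<gamma>) \<le> 1" using R gamma_pos powr_mono[of "-\<gamma>" 0 "3/2 * R"] by simp
    then have "K \<le> c3 * 1 * L" unfolding K_def using c3 L by (intro mult_mono mult_left_mono) auto
    then show ?thesis using R by (simp add: \<rho>_def)
  qed
  \<comment> \<open>Because \<open>K \<le> \<rho>\<close>, the condition for
    \<open>\<sigma> = s\<close> implies that for \<open>\<sigma> = m\<close>: a factor
    \<open>K powr (m - s)\<close> is traded for \<open>\<rho> powr (m - s)\<close>.\<close>
  have bm: "C \<le> D * K powr (q - m + 1) * \<rho> powr m"
  proof -
    have "K powr (m - s) \<le> \<rho> powr (m - s)" using K\<rho> K0 ms by (intro powr_mono2) auto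
    then have "D * K powr (q - m + 1) * \<rho> powr s * K powr (m - s) \<le> D * K powr (q - m + 1) * \<rho> powr s * \<rho> powr (m - s)"
      using D0 by (intro mult_left_mono) auto
    moreover have "K powr (q - m + 1) * K powr (m - s) = K powr (q - s + 1)" "\<rho> powr s * \<rho> powr (m - s) = \<rho> powr m"
      by (simp_all add: powr_add[symmetric] algebra_simps)
    ultimately have "D * K powr (q - s + 1) * \<rho> powr s \<le> D * K powr (q - m + 1) * \<rho> powr m"
      by (metis (no_types, lifting) mult.assoc mult.commute)
    then show ?thesis using bs by linarith
  qed
  show False
  proof (rule blow_up[OF q _ _ D0 K0 uK fD \<theta>_def])
    show "\<rho> > 0" using R by (simp add: \<rho>_def)
    show "cball x0 \<rho> \<subseteq> exterior" using near R by fastforce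
    show "4 * N * (1 + g 0) * (2 * \<theta>) powr (m - 1) \<le> D * K powr (q - \<sigma> + 1) * \<rho> powr \<sigma>" if "\<sigma> \<in> {s, m}" for \<sigma>
      using that bs bm by (auto simp: C_def)
  qed
qed

text \<open>If the first condition fails, the weighted density is at least a multiple of
  \<open>|x|^(-N)\<close>, which is not integrable at infinity. For the other two,
  \<open>no_slow_potential\<close> is applied to lower bounds of the potential: the mass in a fixed
  unit ball gives the exponent \<open>\<alpha>\<close>, and the mass in a ball of radius
  \<open>norm x\<close> about \<open>2 x\<close> gives
  \<open>\<alpha> - N + \<gamma> * p\<close>.\<close>

theorem exponent_conditions:
  fixes \<alpha> p q :: real
  assumes \<alpha>: "0 < \<alpha>" "\<alpha> < N" and p: "p > 0" and q: "q > m - 1"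
    and ci: "conv_integrable \<alpha> p u" and f: "\<And>x. x \<in> exterior \<Longrightarrow> f x = conv \<alpha> p u x * u x powr q"
  shows "\<gamma> * p > N - \<alpha>" "\<gamma> * q > N - \<alpha>" "\<gamma> * (p + q) > 2 * N - \<alpha>"
proof -
  have \<alpha>': "\<alpha> < real DIM('a)" using \<alpha> N by simp
  have N1: "N > 1" using sN ms by simp
  interpret P: riesz_potential \<alpha> "dens p u" "exterior :: 'a set"
    by (rule riesz_potential_dens(1)[OF \<alpha>(1) \<alpha>' u_cont u_pos ci])
  note cp = riesz_potential_dens(2)[OF \<alpha>(1) \<alpha>' u_cont u_pos ci]
  obtain c2 where c2: "c2 > 0" "\<And>x. norm x \<ge> 2 \<Longrightarrow> c2 * norm x powr (-\<gamma>) \<le> u x"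
    using fundamental_lower_bound by blast
  have dl: "(c2 * R powr (-\<gamma>)) powr p \<le> dens p u y" if "norm y \<ge> 2" "norm y \<le> R" for y R
  proof -
    have "R powr (-\<gamma>) \<le> norm y powr (-\<gamma>)" using that gamma_pos by (intro powr_mono2') auto
    then have "c2 * R powr (-\<gamma>) \<le> u y" using c2(2)[OF that(1)] c2(1) by (meson less_imp_le mult_left_mono order_trans)
    then have "(c2 * R powr (-\<gamma>)) powr p \<le> u y powr p" using c2(1) p by (intro powr_mono2) auto
    then show ?thesis using that by (simp add: dens_def)
  qed
  define \<omega> where "\<omega> = measure lborel (ball (0::'a) 1)"
  have om: "\<omega> > 0" using content_ball_pos[of 1 "0::'a"] by (simp add: \<omega>_def)
  show "\<gamma> * p > N - \<alpha>"
  proof (rule ccontr)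
    assume "\<not> \<gamma> * p > N - \<alpha>"
    then have le: "- N \<le> - \<gamma> * p - \<alpha>" by simp
    show False
    proof (rule power_tail_not_integrable[OF P.v_int, of "c2 powr p / 2"])
      show "dens p u y / (1 + norm y powr \<alpha>) \<ge> 0" for y
        using P.v_nonneg[of y] by (intro divide_nonneg_nonneg add_nonneg_nonneg) auto
      show "c2 powr p / 2 > 0" using c2 by simp
      fix y :: 'a assume y: "2 \<le> norm y"
      have a1: "1 \<le> norm y powr \<alpha>" using y \<alpha> by (intro ge_one_powr_ge_zero) auto
      have "norm y powr (- N) \<le> norm y powr (- \<gamma> * p - \<alpha>)" using le y by (intro powr_mono) auto
      also have "\<dots> = norm y powr (- \<gamma> * p) / norm y powr \<alpha>" by (rule powr_diff)
      finally have "c2 powr p / 2 * norm y powr (- N) \<le> c2 powr p / 2 * (norm y powr (- \<gamma> * p) / norm y powr \<alpha>)"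
        by (intro mult_left_mono) auto
      also have "\<dots> = (c2 * norm y powr (-\<gamma>)) powr p / (2 * norm y powr \<alpha>)" by (simp add: powr_mult powr_powr)
      also have "\<dots> \<le> dens p u y / (1 + norm y powr \<alpha>)"
        using dl[OF y order_refl] a1 P.v_nonneg[of y] by (intro frac_le) auto
      finally show "c2 powr p / 2 * norm y powr (- real DIM('a)) \<le> dens p u y / (1 + norm y powr \<alpha>)" unfolding N .
    qed
  qed
  show "\<gamma> * q > N - \<alpha>"
  proof (rule ccontr)
    assume "\<not> \<gamma> * q > N - \<alpha>"
    then have le: "\<alpha> + \<gamma> * q \<le> N" by simp
    obtain e :: 'a where e: "norm e = 4" using vector_choose_size[of 4] by auto
    let ?c = "(c2 * 5 powr (-\<gamma>)) powr p * 4 powr (-\<alpha>)"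
    show False
    proof (rule no_slow_potential[OF q f _ _ le])
      show "?c * \<omega> > 0" using c2 om by simp
      fix x :: 'a assume x: "2 \<le> norm x"
      have "(?c * norm x powr (-\<alpha>)) * measure lborel (ball e 1) \<le> P.pot x"
      proof (rule P.pot_lower)
        show "emeasure lborel (ball e 1) < \<infinity>" using emeasure_lborel_ball_finite by auto
        fix y assume y: "y \<in> ball e 1" "y \<noteq> x"
        then have n: "norm y \<ge> 2" "norm y \<le> 5"
          using e norm_triangle_ineq3[of e y] by (auto simp: dist_norm abs_le_iff)
        have "norm (x - y) \<le> 4 * norm x" using norm_triangle_ineq4[of x y] n x by linarith
        then have k: "(4 * norm x) powr (-\<alpha>) \<le> norm (x - y) powr (-\<alpha>)"
          using y \<alpha> by (intro powr_mono2') auto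
        have "?c * norm x powr (-\<alpha>) = (c2 * 5 powr (-\<gamma>)) powr p * (4 * norm x) powr (-\<alpha>)" by (simp add: powr_mult)
        also have "\<dots> \<le> dens p u y * norm (x - y) powr (-\<alpha>)"
          using dl[OF n] k P.v_nonneg[of y] by (intro mult_mono) auto
        finally show "?c * norm x powr (-\<alpha>) \<le> dens p u y * norm (x - y) powr (-\<alpha>)" .
      qed (use x in auto)
      moreover have "measure lborel (ball e 1) = \<omega>" by (simp add: \<omega>_def content_ball)
      ultimately show "?c * \<omega> * norm x powr (-\<alpha>) \<le> conv \<alpha> p u x" unfolding cp by (simp add: ac_simps)
    qed
  qed
  show "\<gamma> * (p + q) > 2 * N - \<alpha>"
  proof (rule ccontr)
    assume "\<not> \<gamma> * (p + q) > 2 * N - \<alpha>"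
    then have le: "(\<alpha> - N + \<gamma> * p) + \<gamma> * q \<le> N" by (simp add: algebra_simps)
    let ?c = "(c2 * 3 powr (-\<gamma>)) powr p * 2 powr (-\<alpha>)"
    show False
    proof (rule no_slow_potential[OF q f _ _ le])
      show "?c * \<omega> > 0" using c2 om by simp
      fix x :: 'a assume x: "2 \<le> norm x"
      have "(?c * norm x powr (-\<gamma> * p - \<alpha>)) * measure lborel (ball (2 *\<^sub>R x) (norm x)) \<le> P.pot x"
      proof (rule P.pot_lower)
        show "emeasure lborel (ball (2 *\<^sub>R x) (norm x)) < \<infinity>" using emeasure_lborel_ball_finite by auto
        fix y assume y: "y \<in> ball (2 *\<^sub>R x) (norm x)"
        then have d: "norm (2 *\<^sub>R x - y) < norm x" by (simp add: dist_norm)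
        have n: "norm y > norm x" "norm y \<le> 3 * norm x"
          using d norm_triangle_ineq3[of "2 *\<^sub>R x" y] by (auto simp: abs_le_iff)
        have "norm (x - y) = norm ((2 *\<^sub>R x - y) - x)" by (simp add: scaleR_2)
        then have "norm (x - y) \<le> 2 * norm x" using d norm_triangle_ineq4[of "2 *\<^sub>R x - y" x] by linarith
        moreover have "x \<noteq> y" using n by auto
        ultimately have k: "(2 * norm x) powr (-\<alpha>) \<le> norm (x - y) powr (-\<alpha>)" using \<alpha> by (intro powr_mono2') auto
        have "?c * norm x powr (-\<gamma> * p - \<alpha>) = (c2 * (3 * norm x) powr (-\<gamma>)) powr p * (2 * norm x) powr (-\<alpha>)"
          using powr_add[of "norm x" "-\<gamma> * p" "-\<alpha>"] by (simp add: powr_mult powr_powr)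
        also have "\<dots> \<le> dens p u y * norm (x - y) powr (-\<alpha>)"
          using dl[of y "3 * norm x"] n x k P.v_nonneg[of y] by (intro mult_mono) auto
        finally show "?c * norm x powr (-\<gamma> * p - \<alpha>) \<le> dens p u y * norm (x - y) powr (-\<alpha>)" .
      qed (use x in auto)
      moreover have "measure lborel (ball (2 *\<^sub>R x) (norm x)) = \<omega> * norm x powr N"
      proof -
        have "norm x > 0" using x by linarith
        from powr_realpow[OF this] show ?thesis by (simp add: \<omega>_def content_ball N)
      qed
      moreover have "norm x powr (-\<gamma> * p - \<alpha>) * norm x powr N = norm x powr (- (\<alpha> - N + \<gamma> * p))"
        by (simp add: powr_add[symmetric] algebra_simps)
      ultimately show "?c * \<omega> * norm x powr (- (\<alpha> - N + \<gamma> * p)) \<le> conv \<alpha> p u x"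
        unfolding cp by (metis (no_types, lifting) mult.assoc mult.commute)
    qed
  qed
qed

end

section \<open>From the solution notions to supersolutions with Borel data\<close>

lemma borel_integrable_off_compact:
  fixes F :: "'a::euclidean_space \<Rightarrow> 'b::euclidean_space"
  assumes "compact K" "continuous_on K F" "\<And>x. x \<notin> K \<Longrightarrow> F x = 0"
  shows "integrable lborel F"
proof -
  have "(\<lambda>x. indicator K x *\<^sub>R F x) = F" using assms(3) by (auto simp: indicator_def)
  then show ?thesis using borel_integrable_compact[OF assms(1,2)] by simp
qed

text \<open>Components with respect to the finite basis reduce the claim to real functions.\<close>

lemma borel_version_exists:
  fixes h :: "'a::euclidean_space \<Rightarrow> 'b::euclidean_space"
  assumes "h \<in> borel_measurable lebesgue"
  obtains k where "k \<in> borel_measurable borel" "AE x in lebesgue. h x = k x"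
proof -
  have "\<exists>g. g \<in> borel_measurable borel \<and> (AE x in lborel. h x \<bullet> b = g x)" for b
    using completion_ex_borel_measurable_real[of "\<lambda>x. h x \<bullet> b" lborel] assms by auto
  then obtain G where G: "\<And>b. G b \<in> borel_measurable borel" "\<And>b. AE x in lborel. h x \<bullet> b = G b x" by metis
  have "AE x in lborel. \<forall>b\<in>Basis. h x \<bullet> b = G b x"
    by (subst AE_finite_all) (auto intro: G(2))
  then have "AE x in lborel. h x = (\<Sum>b\<in>Basis. G b x *\<^sub>R b)"
  proof eventually_elim
    case (elim x)
    then have "(\<Sum>b\<in>Basis. G b x *\<^sub>R b) = (\<Sum>b\<in>Basis. (h x \<bullet> b) *\<^sub>R b)" by simp
    then show ?case by (simp add: euclidean_representation)
  qed
  then show ?thesis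
    using that[of "\<lambda>x. \<Sum>b\<in>Basis. G b x *\<^sub>R b"] G(1) by (simp add: AE_completion_iff)
qed

context mixed_operator
begin

lemma conv_solution_continuous:
  fixes u :: "'a::euclidean_space \<Rightarrow> real"
  assumes \<alpha>: "0 < \<alpha>" "\<alpha> < real DIM('a)" and u: "\<forall>x\<in>exterior. u x > 0" "continuous_on exterior u" "conv_integrable \<alpha> p u"
  shows "continuous_on exterior (\<lambda>x. conv \<alpha> p u x * u x powr q)"
    and "x \<in> exterior \<Longrightarrow> conv \<alpha> p u x * u x powr q \<ge> 0"
proof -
  interpret P: riesz_potential \<alpha> "dens p u" "exterior :: 'a set"
    by (rule riesz_potential_dens(1)[OF \<alpha> u(2,1,3)])
  note cp = riesz_potential_dens(2)[OF \<alpha> u(2,1,3)]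
  have "\<forall>x\<in>exterior. u x \<noteq> 0" using u(1) by force
  then show "continuous_on exterior (\<lambda>x. conv \<alpha> p u x * u x powr q)"
    unfolding cp using P.pot_continuous u(2) by (intro continuous_on_mult continuous_on_powr continuous_on_const) auto
  show "x \<in> exterior \<Longrightarrow> conv \<alpha> p u x * u x powr q \<ge> 0"
    unfolding cp using P.pot_nonneg by simp
qed

text \<open>\<open>V\<close> is a Borel version of the weak gradient cut off to the exterior. All
  test functions vanish off a compact subset of the exterior, so every integral in the definitions
  agrees with its counterpart over the whole space.\<close>

lemma exterior_supersolution_of_solution:
  fixes u :: "'a::euclidean_space \<Rightarrow> real"
  assumes \<alpha>: "0 < \<alpha>" "\<alpha> < real DIM('a)" and sN: "s < real DIM('a)"
    and u: "positive_solution_ineq \<alpha> p q m s g u"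
  shows "\<exists>V. exterior_supersolution m s g u (\<lambda>x. conv \<alpha> p u x * u x powr q) V (real DIM('a))"
proof -
  have pos: "\<forall>x\<in>exterior. u x > 0" and uc: "continuous_on exterior u" and ci: "conv_integrable \<alpha> p u"
    using u by (auto simp: positive_solution_ineq_def)
  obtain Du where Du: "W1_loc m exterior u Du" and ineq: "\<And>\<phi>. \<phi> \<in> test_functions exterior \<Longrightarrow> (\<forall>x. \<phi> x \<ge> 0) \<Longrightarrow>
      weak_lhs m s g Du \<phi> \<ge> weak_rhs \<alpha> p q u \<phi>"
    using u by (auto simp: positive_solution_ineq_def)
  let ?f = "\<lambda>x. conv \<alpha> p u x * u x powr q"
  note fc = conv_solution_continuous[OF \<alpha> pos uc ci, where q=q]
  have "(\<lambda>x. indicator exterior x *\<^sub>R Du x) \<in> borel_measurable lebesgue"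
    using Du by (auto simp: W1_loc_def L_loc_def set_borel_measurable_def)
  then obtain V where V[measurable]: "V \<in> borel_measurable borel" and AEV: "AE x in lebesgue. indicator exterior x *\<^sub>R Du x = V x"
    using borel_version_exists by metis
  have "exterior_supersolution m s g u ?f V (real DIM('a))"
  proof unfold_locales
    show "open (exterior :: 'a set)" by (intro open_Compl closed_cball)
    show "continuous_on exterior u" by (rule uc)
    show "continuous_on exterior ?f" by (rule fc)
    show "V \<in> borel_measurable borel" by (rule V)
    show "integrable lborel (\<lambda>x. indicator K x * norm (V x) powr m)" if K: "compact K" "K \<subseteq> exterior" for K
    proof -
      have [measurable]: "K \<in> sets borel" using K(1) by (rule borel_compact)
      have "integrable lebesgue (\<lambda>x. indicator K x *\<^sub>R (norm (Du x) powr m))"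
        using Du K by (auto simp: W1_loc_def L_loc_def set_integrable_def)
      moreover have "AE x in lebesgue. indicator K x *\<^sub>R (norm (Du x) powr m) = indicator K x * norm (V x) powr m"
        using AEV by eventually_elim (use K in \<open>auto simp: indicator_def split: if_splits\<close>)
      ultimately show ?thesis
        using lebesgue_AE_eq(2)[of "\<lambda>x. indicator K x * norm (V x) powr m"] by simp
    qed
    show "(\<integral>x. u x *\<^sub>R grad \<phi> x \<partial>lborel) = - (\<integral>x. \<phi> x *\<^sub>R V x \<partial>lborel)" if \<phi>: "\<phi> \<in> test_functions exterior" for \<phi>
    proof -
      obtain K where K: "compact K" "K \<subseteq> exterior" "C1c K \<phi> (grad \<phi>)" using test_functionD[OF \<phi>] by metis
      note C = C1cD[OF K(3)]
      have [measurable]: "\<phi> \<in> borel_measurable borel" using C(4) borel_measurable_continuous_onI by blast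
      have "continuous_on K (\<lambda>x. u x *\<^sub>R grad \<phi> x)"
        using continuous_on_subset[OF uc K(2)] C(3) by (intro continuous_intros) (auto intro: continuous_on_subset)
      then have "integrable lborel (\<lambda>x. u x *\<^sub>R grad \<phi> x)"
        using C(6) by (intro borel_integrable_off_compact[OF K(1)]) auto
      then have b1: "(\<lambda>x. u x *\<^sub>R grad \<phi> x) \<in> borel_measurable borel" by auto
      have "(LINT x:exterior|lebesgue. u x *\<^sub>R grad \<phi> x) = (\<integral>x. u x *\<^sub>R grad \<phi> x \<partial>lborel)"
        unfolding set_lebesgue_integral_def
      proof (rule lebesgue_AE_eq(1)[OF b1], intro AE_I2)
        fix x
        show "indicator exterior x *\<^sub>R (u x *\<^sub>R grad \<phi> x) = u x *\<^sub>R grad \<phi> x" using C(6)[of x] K(2) by (cases "x \<in> K") auto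
      qed
      moreover have "(LINT x:exterior|lebesgue. \<phi> x *\<^sub>R Du x) = (\<integral>x. \<phi> x *\<^sub>R V x \<partial>lborel)"
        unfolding set_lebesgue_integral_def
      proof (rule lebesgue_AE_eq(1))
        show "AE x in lebesgue. indicator exterior x *\<^sub>R (\<phi> x *\<^sub>R Du x) = \<phi> x *\<^sub>R V x"
          using AEV
        proof eventually_elim
          case (elim x)
          then show ?case by (cases "x \<in> exterior") auto
        qed
      qed measurable
      ultimately show ?thesis using Du \<phi> by (simp add: W1_loc_def has_weak_gradient_def)
    qed
    show "(\<integral>x. ?f x * \<phi> x \<partial>lborel) \<le> (\<integral>x. A (V x) \<bullet> grad \<phi> x \<partial>lborel)"
      if \<phi>: "\<phi> \<in> test_functions exterior" and p0: "\<And>x. 0 \<le> \<phi> x" for \<phi>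
    proof -
      obtain K where K: "compact K" "K \<subseteq> exterior" "C1c K \<phi> (grad \<phi>)" using test_functionD[OF \<phi>] by metis
      note C = C1cD[OF K(3)]
      have [measurable]: "grad \<phi> \<in> borel_measurable borel" using C(3) borel_measurable_continuous_onI by blast
      have inK: "indicator (- ball 0 1) x = (1::real)" if "x \<in> K" for x using that K(2) by auto
      have "continuous_on K (\<lambda>x. ?f x * \<phi> x)"
        by (intro continuous_on_mult continuous_on_subset[OF fc(1) K(2)] continuous_on_subset[OF C(4) subset_UNIV])
      then have "integrable lborel (\<lambda>x. ?f x * \<phi> x)"
        using C(5) by (intro borel_integrable_off_compact[OF K(1)]) auto
      then have "(\<lambda>x. ?f x * \<phi> x) \<in> borel_measurable borel" by auto
      then have "weak_rhs \<alpha> p q u \<phi> = (\<integral>x. ?f x * \<phi> x \<partial>lborel)"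
        unfolding weak_rhs_def set_lebesgue_integral_def
      proof (rule lebesgue_AE_eq(1), intro AE_I2)
        fix x
        show "indicator (- ball 0 1) x *\<^sub>R (conv \<alpha> p u x * u x powr q * \<phi> x) = conv \<alpha> p u x * u x powr q * \<phi> x"
          using C(5)[of x] inK[of x] by (cases "x \<in> K") auto
      qed
      moreover have "weak_lhs m s g Du \<phi> = (\<integral>x. A (V x) \<bullet> grad \<phi> x \<partial>lborel)"
        unfolding weak_lhs_def set_lebesgue_integral_def flux_def[symmetric]
      proof (rule lebesgue_AE_eq(1))
        show "AE x in lebesgue. indicator (- ball 0 1) x *\<^sub>R (A (Du x) \<bullet> grad \<phi> x) = A (V x) \<bullet> grad \<phi> x"
          using AEV
        proof eventually_elim
          case (elim x)
          then show ?case using C(6)[of x] inK[of x] K(2) by (cases "x \<in> K") auto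
        qed
      qed measurable
      ultimately show ?thesis using ineq[OF \<phi>] p0 by simp
    qed
    show "0 \<le> ?f x" if "x \<in> exterior" for x by (rule fc(2)[OF that])
  qed (use sN pos in auto)
  then show ?thesis by blast
qed

text \<open>The classical gradient is a weak gradient because the gradient of \<open>u\<close> times
  a test function has integral 0; continuity gives the local integrability.\<close>

lemma solution_eq_imp_ineq:
  fixes u :: "'a::euclidean_space \<Rightarrow> real"
  assumes "positive_C1_solution_eq \<alpha> p q m s g u"
  shows "positive_solution_ineq \<alpha> p q m s g u"
proof -
  have u: "\<forall>x\<in>exterior. u x > 0" "conv_integrable \<alpha> p u" "continuous_on exterior (grad u)"
    "\<And>x. x \<in> exterior \<Longrightarrow> GDERIV u x :> grad u x"
    "\<And>\<phi>. \<phi> \<in> test_functions exterior \<Longrightarrow> weak_lhs m s g (grad u) \<phi> = weak_rhs \<alpha> p q u \<phi>"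
    using assms by (auto simp: positive_C1_solution_eq_def C1_on_def differentiable_imp_GDERIV)
  have uc: "continuous_on exterior u"
    using u(4) GDERIV_continuous by (intro continuous_at_imp_continuous_on) blast
  have L: "L_loc r exterior h" if h: "continuous_on exterior h" and r: "r > 0" for r and h :: "'a \<Rightarrow> 'b::euclidean_space"
    unfolding L_loc_def
  proof (intro conjI allI impI)
    have "(\<lambda>x. indicator exterior x *\<^sub>R h x) \<in> borel_measurable borel"
      by (rule borel_measurable_continuous_on_indicator[OF _ h]) (simp add: borel_closed)
    then show "set_borel_measurable lebesgue exterior h"
      unfolding set_borel_measurable_def by (intro measurable_completion) simp
    fix K :: "'a set" assume K: "compact K \<and> K \<subseteq> exterior"
    then have "continuous_on K (\<lambda>x. norm (h x) powr r)"
      using r by (intro continuous_on_powr' continuous_on_norm continuous_on_const continuous_on_subset[OF h]) auto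
    from borel_integrable_compact[OF _ this] K
    have i: "integrable lborel (\<lambda>x. indicator K x *\<^sub>R (norm (h x) powr r))" by blast
    then have "(\<lambda>x. indicator K x *\<^sub>R (norm (h x) powr r)) \<in> borel_measurable lborel" by (rule borel_measurable_integrable)
    from integrable_completion[OF this] i show "set_integrable lebesgue K (\<lambda>x. norm (h x) powr r)"
      unfolding set_integrable_def by blast
  qed
  have "(LINT x:exterior|lebesgue. u x *\<^sub>R grad \<phi> x) = - (LINT x:exterior|lebesgue. \<phi> x *\<^sub>R grad u x)"
    if \<phi>: "\<phi> \<in> test_functions exterior" for \<phi>
  proof -
    obtain K where K: "compact K" "K \<subseteq> exterior" "C1c K \<phi> (grad \<phi>)" using test_functionD[OF \<phi>] by metis
    note C = C1cD[OF K(3)]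
    have "continuous_on K (\<lambda>x. u x *\<^sub>R grad \<phi> x)"
      using continuous_on_subset[OF uc K(2)] C(3) by (intro continuous_intros) (auto intro: continuous_on_subset)
    then have i1: "integrable lborel (\<lambda>x. u x *\<^sub>R grad \<phi> x)"
      using C(6) by (intro borel_integrable_off_compact[OF K(1)]) auto
    have "continuous_on K (\<lambda>x. \<phi> x *\<^sub>R grad u x)"
      using continuous_on_subset[OF u(3) K(2)] C(4) by (intro continuous_intros) (auto intro: continuous_on_subset)
    then have i2: "integrable lborel (\<lambda>x. \<phi> x *\<^sub>R grad u x)"
      using C(5) by (intro borel_integrable_off_compact[OF K(1)]) auto
    have e1: "(LINT x:exterior|lebesgue. u x *\<^sub>R grad \<phi> x) = (\<integral>x. u x *\<^sub>R grad \<phi> x \<partial>lborel)"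
      unfolding set_lebesgue_integral_def
    proof (rule lebesgue_AE_eq(1), use i1 in simp, intro AE_I2)
      fix x
      show "indicator exterior x *\<^sub>R (u x *\<^sub>R grad \<phi> x) = u x *\<^sub>R grad \<phi> x" using C(6)[of x] K(2) by (cases "x \<in> K") auto
    qed
    have e2: "(LINT x:exterior|lebesgue. \<phi> x *\<^sub>R grad u x) = (\<integral>x. \<phi> x *\<^sub>R grad u x \<partial>lborel)"
      unfolding set_lebesgue_integral_def
    proof (rule lebesgue_AE_eq(1), use i2 in simp, intro AE_I2)
      fix x
      show "indicator exterior x *\<^sub>R (\<phi> x *\<^sub>R grad u x) = \<phi> x *\<^sub>R grad u x" using C(5)[of x] K(2) by (cases "x \<in> K") auto
    qed
    have "0 = (\<integral>x. (if x \<in> exterior then u x *\<^sub>R grad \<phi> x + \<phi> x *\<^sub>R grad u x else 0) \<partial>lborel)"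
      by (rule integral_grad_C1c[OF C1c_prod[OF K(3) _ K(2) u(4) u(3)], symmetric]) auto
    also have "\<dots> = (\<integral>x. u x *\<^sub>R grad \<phi> x + \<phi> x *\<^sub>R grad u x \<partial>lborel)"
    proof (intro Bochner_Integration.integral_cong refl)
      fix x
      show "(if x \<in> exterior then u x *\<^sub>R grad \<phi> x + \<phi> x *\<^sub>R grad u x else 0) = u x *\<^sub>R grad \<phi> x + \<phi> x *\<^sub>R grad u x"
        using C(5,6)[of x] K(2) by (cases "x \<in> K") auto
    qed
    also have "\<dots> = (\<integral>x. u x *\<^sub>R grad \<phi> x \<partial>lborel) + (\<integral>x. \<phi> x *\<^sub>R grad u x \<partial>lborel)"
      by (rule Bochner_Integration.integral_add[OF i1 i2])
    finally show ?thesis unfolding e1 e2 by (simp add: eq_neg_iff_add_eq_0)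
  qed
  then have "W1_loc m exterior u (grad u)"
    using L[OF uc] L[OF u(3)] m1 by (simp add: W1_loc_def has_weak_gradient_def)
  then show ?thesis unfolding positive_solution_ineq_def using u uc by (metis order_refl)
qed

end

section \<open>Existence\<close>

lemma integrable_on_dominated:
  fixes f h :: "real \<Rightarrow> real"
  assumes f: "f \<in> borel_measurable (lebesgue_on S)" "S \<in> sets lebesgue" and h: "h integrable_on S"
    and fh: "\<And>x. x \<in> S \<Longrightarrow> 0 \<le> f x \<and> f x \<le> h x"
  shows "f integrable_on S"
  by (rule measurable_bounded_by_integrable_imp_integrable[OF f(1) h _ f(2)]) (use fh in auto)

text \<open>\<open>a'\<close> is the decay exponent used for the density, \<open>C1\<close> the
  constant of \<open>riesz_composition\<close> for it, and \<open>e\<close> a fixed direction along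
  which radial functions are evaluated. \<open>\<nu>\<close> expresses that the right-hand side
  built from the barrier \<open>w\<close> has finite mass, and the second condition on
  \<open>\<kappa>\<close> keeps the iteration below \<open>w\<close>.\<close>

locale radial_existence = mixed_operator m s g for m s :: real and g :: "real \<Rightarrow> real" +
  fixes N \<alpha> p q a' C1 \<kappa> \<gamma> :: real and e :: "'a::euclidean_space"
  assumes N: "N = real DIM('a)" and sN: "s < N" and \<alpha>: "0 < \<alpha>" "\<alpha> < N" and pq: "p > 0" "q > 0"
    and \<gamma>: "\<gamma> = (N - s) / (s - 1)"
    and a': "a' \<le> \<gamma> * p" "N - \<alpha> < \<gamma> * p"
    and C1: "C1 > 0" "\<And>x::'a. x \<noteq> 0 \<Longrightarrow>
      (\<integral>\<^sup>+y. ennreal (norm y powr (-a') * norm (x - y) powr (-\<alpha>)) \<partial>lborel) \<le> ennreal (C1 * norm x powr (N - \<alpha> - a'))"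
    and \<nu>: "a' + \<alpha> - N + \<gamma> * q > N"
    and e: "norm e = 1"
    and \<kappa>: "\<kappa> > 0" "(2 * (\<kappa> powr (p + q) * C1 / (a' + \<alpha> - N + \<gamma> * q - N))) powr (1 / (s - 1)) / \<gamma> \<le> \<kappa>"
begin

lemma N1: "N > 1" using sN ms by simp
lemma \<gamma>0: "\<gamma> > 0" using sN ms by (simp add: \<gamma>)

text \<open>Cutting the radius at 1 makes the barrier a bounded antitone function on all
  reals.\<close>

definition w :: "real \<Rightarrow> real" where "w r = \<kappa> * (max 1 r) powr (-\<gamma>)"

text \<open>Monotonicity is demanded for the sake of measurability: it implies that admissible
  profiles are Borel and is inherited by the infimum of an arbitrary family, as
  \<open>fixed_point\<close> requires.\<close>

definition adm :: "(real \<Rightarrow> real) \<Rightarrow> bool" where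
  "adm U \<longleftrightarrow> antimono U \<and> (\<forall>r. 0 \<le> U r \<and> U r \<le> w r)"

definition v :: "(real \<Rightarrow> real) \<Rightarrow> 'a \<Rightarrow> real" where "v U = dens p (\<lambda>y. U (norm y))"

definition J :: "(real \<Rightarrow> real) \<Rightarrow> 'a \<Rightarrow> real" where
  "J U x = (\<integral>y. v U y * norm (x - y) powr (-\<alpha>) \<partial>lborel)"

definition F :: "(real \<Rightarrow> real) \<Rightarrow> real \<Rightarrow> real" where
  "F U \<tau> = J U (\<tau> *\<^sub>R e) * U \<tau> powr q"

text \<open>By \<open>F_bounds\<close>, \<open>M * \<tau> powr (- \<nu>')\<close> dominates the
  radial mass density of every admissible profile; \<open>\<nu>'\<close> collects the decay
  exponents.\<close>

definition M :: real where "M = \<kappa> powr (p + q) * C1"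
definition \<nu>' :: real where "\<nu>' = a' + \<alpha> - N + \<gamma> * q - N + 1"
text \<open>The integral of that dominating density over radii from 1 to infinity. Used also as the
  constant part of the flux, it keeps \<open>Hf U\<close> between \<open>c\<close> and
  \<open>2 * c\<close>: the lower bound makes the fixed point positive and the upper one gives the
  decay.\<close>

definition c :: real where "c = M / (\<nu>' - 1)"

lemma \<nu>'1: "\<nu>' > 1" using \<nu> by (simp add: \<nu>'_def)
lemma M0: "M > 0" using C1 \<kappa> by (simp add: M_def)
lemma c0: "c > 0" using M0 \<nu>'1 by (simp add: c_def)

definition Hf :: "(real \<Rightarrow> real) \<Rightarrow> real \<Rightarrow> real" where
  "Hf U t = c + integral {1..t} (\<lambda>\<tau>. \<tau> powr (N - 1) * F U \<tau>)"

definition k :: "(real \<Rightarrow> real) \<Rightarrow> real \<Rightarrow> real" where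
  "k U t = b (t powr (1 - N) * Hf U t)"

text \<open>The radial equation integrated twice: a fixed point has slope \<open>- k U r\<close>,
  hence inward flux density \<open>r powr (1 - N) * Hf U r\<close>, and tends to 0 at
  infinity.\<close>

definition T :: "(real \<Rightarrow> real) \<Rightarrow> real \<Rightarrow> real" where
  "T U r = integral {max 1 r..} (k U)"

lemma adm_w: "adm w"
proof -
  have "w y \<le> w x" if "x \<le> y" for x y
    unfolding w_def using that \<gamma>0 \<kappa> by (intro mult_left_mono powr_mono2') auto
  then show ?thesis using \<kappa> by (auto simp: adm_def antimono_def w_def)
qed

lemma adm_borel: assumes "adm U" shows "U \<in> borel_measurable borel"
proof -
  have "mono (\<lambda>r. - U r)" using assms by (auto simp: adm_def antimono_def mono_def)
  from borel_measurable_mono[OF this] have "(\<lambda>r. - (- U r)) \<in> borel_measurable borel" by measurable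
  then show ?thesis by simp
qed

lemma v_borel: assumes "adm U" shows "v U \<in> borel_measurable borel"
proof -
  have [measurable]: "U \<in> borel_measurable borel" by (rule adm_borel[OF assms])
  have [measurable]: "(exterior :: 'a set) \<in> sets borel" by simp
  show ?thesis unfolding v_def dens_def[abs_def] by measurable
qed

lemma v_bounds:
  assumes "adm U" shows "0 \<le> v U y" "v U y \<le> \<kappa> powr p * (indicator (- ball 0 1) y * norm y powr (-\<gamma> * p))"
proof -
  show "0 \<le> v U y" by (simp add: v_def dens_def)
  show "v U y \<le> \<kappa> powr p * (indicator (- ball 0 1) y * norm y powr (-\<gamma> * p))"
  proof (cases "norm y > 1")
    case True
    have "U (norm y) powr p \<le> (\<kappa> * norm y powr (-\<gamma>)) powr p"
      using assms True pq by (intro powr_mono2) (auto simp: adm_def w_def max_def dest: spec[of _ "norm y"] split: if_splits)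
    then show ?thesis using True by (simp add: v_def dens_def powr_mult powr_powr)
  qed (simp add: v_def dens_def)
qed

lemma riesz: assumes "adm U" shows "riesz_potential \<alpha> (v U) exterior"
proof
  show "v U \<in> borel_measurable borel" by (rule v_borel[OF assms])
  then have [measurable]: "v U \<in> borel_measurable borel" .
  show "0 \<le> v U y" for y by (rule v_bounds(1)[OF assms])
  have b: "N < \<gamma> * p + \<alpha>" using a' by simp
  obtain C where C: "C > 0" "\<And>R. R > 0 \<Longrightarrow>
    (\<integral>\<^sup>+x. ennreal (indicator (- ball 0 R) x * norm x powr (-(\<gamma> * p + \<alpha>))) \<partial>(lborel::'a measure)) \<le> ennreal (C * R powr (real DIM('a) - (\<gamma> * p + \<alpha>)))"
    by (rule riesz_far[OF b[unfolded N]]) (rule that, assumption+)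
  have "integrable lborel (\<lambda>x::'a. indicator (- ball 0 1) x * norm x powr (-(\<gamma> * p + \<alpha>)))"
    using C(2)[of 1] by (intro integrableI_nonneg) (auto intro: le_less_trans)
  then have i: "integrable lborel (\<lambda>x::'a. \<kappa> powr p * (indicator (- ball 0 1) x * norm x powr (-(\<gamma> * p + \<alpha>))))"
    by (rule integrable_mult_right)
  show "integrable lborel (\<lambda>y. v U y / (1 + norm y powr \<alpha>))"
  proof (rule Bochner_Integration.integrable_bound[OF i])
    show "AE y in lborel. norm (v U y / (1 + norm y powr \<alpha>)) \<le> norm (\<kappa> powr p * (indicator (- ball 0 1) y * norm y powr (-(\<gamma> * p + \<alpha>))))"
    proof (intro AE_I2)
      fix y :: 'a
      show "norm (v U y / (1 + norm y powr \<alpha>)) \<le> norm (\<kappa> powr p * (indicator (- ball 0 1) y * norm y powr (-(\<gamma> * p + \<alpha>))))"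
      proof (cases "norm y \<ge> 1")
        case True
        then have pos: "norm y powr \<alpha> > 0" by auto
        have "v U y / (1 + norm y powr \<alpha>) \<le> (\<kappa> powr p * norm y powr (-\<gamma> * p)) / norm y powr \<alpha>"
          using v_bounds[OF assms, of y] True pos by (intro frac_le) auto
        also have "\<dots> = \<kappa> powr p * norm y powr (-(\<gamma> * p + \<alpha>))"
          using powr_diff[of "norm y" "-\<gamma> * p" \<alpha>] by simp
        finally show ?thesis using True v_bounds(1)[OF assms, of y] pos by (simp add: abs_of_nonneg)
      next
        case False
        then show ?thesis by (simp add: v_def dens_def)
      qed
    qed
  qed measurable
  show "\<exists>M. \<forall>y\<in>K. v U y \<le> M" if "compact K" "K \<subseteq> exterior" for K
  proof (intro exI[of _ "\<kappa> powr p"] ballI)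
    fix y assume "y \<in> K"
    then have "norm y \<ge> 1" using that by force
    then have "norm y powr (-\<gamma> * p) \<le> 1" using \<gamma>0 pq powr_mono[of "-\<gamma> * p" 0 "norm y"] by (auto split: if_splits)
    then have "\<kappa> powr p * (indicator (- ball 0 1) y * norm y powr (-\<gamma> * p)) \<le> \<kappa> powr p * 1"
      by (intro mult_left_mono) (auto simp: indicator_def)
    then show "v U y \<le> \<kappa> powr p" using v_bounds(2)[OF assms, of y] by simp
  qed
qed (use \<alpha> N in auto)

lemma J_pot: "adm U \<Longrightarrow> J U = riesz_potential.pot \<alpha> (v U)"
  using riesz_potential.pot_def[OF riesz] by (auto simp: J_def)

lemma J_nn:
  assumes "adm U" "norm x \<ge> 1"
  shows "(\<integral>\<^sup>+y. ennreal (v U y * norm (x - y) powr (-\<alpha>)) \<partial>lborel) \<le> ennreal (\<kappa> powr p * (C1 * norm x powr (N - \<alpha> - a')))"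
proof -
  have "(\<integral>\<^sup>+y. ennreal (v U y * norm (x - y) powr (-\<alpha>)) \<partial>lborel)
     \<le> (\<integral>\<^sup>+y. ennreal (\<kappa> powr p) * ennreal (norm y powr (-a') * norm (x - y) powr (-\<alpha>)) \<partial>lborel)"
  proof (rule nn_integral_mono)
    fix y :: 'a
    have "v U y \<le> \<kappa> powr p * norm y powr (-a')"
    proof (cases "norm y \<ge> 1")
      case True
      then have "norm y powr (-\<gamma> * p) \<le> norm y powr (-a')" using a' by (intro powr_mono) auto
      then have "\<kappa> powr p * norm y powr (-\<gamma> * p) \<le> \<kappa> powr p * norm y powr (-a')" by (intro mult_left_mono) auto
      then show ?thesis using v_bounds(2)[OF assms(1), of y] True by simp
    qed (simp add: v_def dens_def)
    then have "v U y * norm (x - y) powr (-\<alpha>) \<le> \<kappa> powr p * norm y powr (-a') * norm (x - y) powr (-\<alpha>)"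
      by (intro mult_right_mono) auto
    then show "ennreal (v U y * norm (x - y) powr (-\<alpha>)) \<le> ennreal (\<kappa> powr p) * ennreal (norm y powr (-a') * norm (x - y) powr (-\<alpha>))"
      by (simp add: ennreal_mult[symmetric] mult.assoc ennreal_leI)
  qed
  also have "\<dots> = ennreal (\<kappa> powr p) * (\<integral>\<^sup>+y. ennreal (norm y powr (-a') * norm (x - y) powr (-\<alpha>)) \<partial>lborel)"
    by (rule nn_integral_cmult) measurable
  also have "\<dots> \<le> ennreal (\<kappa> powr p) * ennreal (C1 * norm x powr (N - \<alpha> - a'))"
    using assms(2) by (intro mult_left_mono C1(2)) auto
  also have "\<dots> = ennreal (\<kappa> powr p * (C1 * norm x powr (N - \<alpha> - a')))" by (simp add: ennreal_mult')
  finally show ?thesis .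
qed

lemma J_integrable:
  assumes "adm U" "norm x \<ge> 1"
  shows "integrable lborel (\<lambda>y. v U y * norm (x - y) powr (-\<alpha>))"
proof -
  have [measurable]: "v U \<in> borel_measurable borel" by (rule v_borel[OF assms(1)])
  show ?thesis
    using J_nn[OF assms] v_bounds(1)[OF assms(1)] by (intro integrableI_nonneg) (auto intro: le_less_trans)
qed

lemma J_bounds:
  assumes "adm U" "norm x \<ge> 1"
  shows "0 \<le> J U x" "J U x \<le> \<kappa> powr p * (C1 * norm x powr (N - \<alpha> - a'))"
proof -
  interpret P: riesz_potential \<alpha> "v U" "exterior :: 'a set" by (rule riesz[OF assms(1)])
  show "0 \<le> J U x" using P.pot_nonneg J_pot[OF assms(1)] by simp
  show "J U x \<le> \<kappa> powr p * (C1 * norm x powr (N - \<alpha> - a'))"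
    using P.pot_upper[OF J_nn[OF assms]] C1(1) J_pot[OF assms(1)] by simp
qed

lemma F_bounds:
  assumes "adm U" "\<tau> \<ge> 1"
  shows "0 \<le> \<tau> powr (N - 1) * F U \<tau> \<and> \<tau> powr (N - 1) * F U \<tau> \<le> M * \<tau> powr (-\<nu>')"
proof
  have n: "norm (\<tau> *\<^sub>R e) = \<tau>" using e assms by simp
  have J: "0 \<le> J U (\<tau> *\<^sub>R e)" "J U (\<tau> *\<^sub>R e) \<le> \<kappa> powr p * (C1 * \<tau> powr (N - \<alpha> - a'))"
    using J_bounds[OF assms(1), of "\<tau> *\<^sub>R e"] n assms(2) by auto
  show "0 \<le> \<tau> powr (N - 1) * F U \<tau>" using J by (simp add: F_def)
  have "U \<tau> powr q \<le> (\<kappa> * \<tau> powr (-\<gamma>)) powr q"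
    using assms pq by (intro powr_mono2) (auto simp: adm_def w_def max_def dest: spec[of _ \<tau>] split: if_splits)
  then have "F U \<tau> \<le> (\<kappa> powr p * (C1 * \<tau> powr (N - \<alpha> - a'))) * (\<kappa> * \<tau> powr (-\<gamma>)) powr q"
    unfolding F_def using J by (intro mult_mono) auto
  then have "\<tau> powr (N - 1) * F U \<tau> \<le> \<tau> powr (N - 1) * ((\<kappa> powr p * (C1 * \<tau> powr (N - \<alpha> - a'))) * (\<kappa> * \<tau> powr (-\<gamma>)) powr q)"
    by (intro mult_left_mono) auto
  also have "\<dots> = M * (\<tau> powr (N - 1) * \<tau> powr (N - \<alpha> - a') * \<tau> powr (-\<gamma> * q))"
    by (simp add: M_def powr_mult powr_powr powr_add)
  also have "\<tau> powr (N - 1) * \<tau> powr (N - \<alpha> - a') * \<tau> powr (-\<gamma> * q) = \<tau> powr (-\<nu>')"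
    by (simp add: powr_add[symmetric] \<nu>'_def algebra_simps)
  finally show "\<tau> powr (N - 1) * F U \<tau> \<le> M * \<tau> powr (-\<nu>')" .
qed

lemma F_integrable:
  assumes "adm U" "t \<ge> 1"
  shows "(\<lambda>\<tau>. \<tau> powr (N - 1) * F U \<tau>) integrable_on {1..t}"
proof (rule integrable_on_dominated)
  have [measurable]: "U \<in> borel_measurable borel" by (rule adm_borel[OF assms(1)])
  have [measurable]: "J U \<in> borel_measurable borel"
    unfolding J_pot[OF assms(1)] by (rule riesz_potential.pot_borel[OF riesz[OF assms(1)]])
  have "(\<lambda>\<tau>. \<tau> powr (N - 1) * F U \<tau>) \<in> borel_measurable borel"
    unfolding F_def[abs_def] by measurable
  then show "(\<lambda>\<tau>. \<tau> powr (N - 1) * F U \<tau>) \<in> borel_measurable (lebesgue_on {1..t})"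
    by (intro measurable_restrict_space1 measurable_completion) simp
  show "(\<lambda>\<tau>. M * \<tau> powr (-\<nu>')) integrable_on {1..t}"
    by (intro integrable_on_mult_right integral_powr_tail_le(2)) (use \<nu>'1 assms in auto)
qed (use F_bounds[OF assms(1)] in auto)

lemma Hf_bounds:
  assumes "adm U" "t \<ge> 1" shows "c \<le> Hf U t" "Hf U t \<le> 2 * c"
proof -
  have "0 \<le> integral {1..t} (\<lambda>\<tau>. \<tau> powr (N - 1) * F U \<tau>)"
    using F_bounds[OF assms(1)] by (intro Henstock_Kurzweil_Integration.integral_nonneg F_integrable[OF assms]) auto
  then show "c \<le> Hf U t" by (simp add: Hf_def)
  have "integral {1..t} (\<lambda>\<tau>. \<tau> powr (N - 1) * F U \<tau>) \<le> integral {1..t} (\<lambda>\<tau>. M * \<tau> powr (-\<nu>'))"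
    using F_bounds[OF assms(1)] integral_powr_tail_le(2)[OF \<nu>'1 _ assms(2)]
    by (intro integral_le F_integrable[OF assms] integrable_on_mult_right) auto
  also have "\<dots> = M * integral {1..t} (\<lambda>\<tau>. \<tau> powr (-\<nu>'))" by simp
  also have "\<dots> \<le> M * (1 / (\<nu>' - 1))"
    using integral_powr_tail_le(1)[OF \<nu>'1 _ assms(2)] M0 by (intro mult_left_mono) auto
  finally show "Hf U t \<le> 2 * c" by (simp add: Hf_def c_def)
qed

lemma Hf_cont: assumes "adm U" shows "continuous_on {1..} (Hf U)"
  unfolding continuous_on_eq_continuous_within
proof
  fix t :: real assume t: "t \<in> {1..}"
  have "continuous_on {1..t+1} (Hf U)"
    unfolding Hf_def[abs_def]
    using indefinite_integral_continuous_1[OF F_integrable[OF assms, of "t+1"]] t by (intro continuous_intros) auto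
  then have "continuous (at t within {1..t+1}) (Hf U)" using t by (auto simp: continuous_on_eq_continuous_within)
  moreover have "at t within {1..} = at t within {1..t+1}"
    by (rule at_within_nhd[of _ "{..<t+1}"]) auto
  ultimately show "continuous (at t within {1..}) (Hf U)" by (simp add: continuous_within)
qed

lemma arg_nonneg: "adm U \<Longrightarrow> t \<ge> 1 \<Longrightarrow> 0 \<le> t powr (1 - N) * Hf U t"
  using Hf_bounds(1)[of U t] c0 by simp

lemma k_cont: assumes "adm U" shows "continuous_on {1..} (k U)"
  unfolding k_def[abs_def]
  by (rule continuous_on_compose2[OF b_cont])
    (use Hf_cont[OF assms] arg_nonneg[OF assms] in \<open>auto intro!: continuous_intros\<close>)

lemma k_bounds:
  assumes "adm U" "t \<ge> 1"
  shows "0 \<le> k U t \<and> k U t \<le> (2 * c) powr (1 / (s - 1)) * t powr (-(1 + \<gamma>))"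
proof
  show "0 \<le> k U t" unfolding k_def by (rule b_nonneg[OF arg_nonneg[OF assms]])
  have s1: "s - 1 > 0" using ms by simp
  have "k U t \<le> (t powr (1 - N) * Hf U t) powr (1 / (s - 1))" unfolding k_def by (rule b_le[OF arg_nonneg[OF assms]])
  also have "\<dots> \<le> (t powr (1 - N) * (2 * c)) powr (1 / (s - 1))"
    using Hf_bounds[OF assms] arg_nonneg[OF assms] s1 by (intro powr_mono2 mult_left_mono) auto
  also have "\<dots> = (2 * c) powr (1 / (s - 1)) * t powr ((1 - N) * (1 / (s - 1)))" by (simp only: powr_mult powr_powr mult.commute)
  also have "(1 - N) * (1 / (s - 1)) = -(1 + \<gamma>)" using s1 by (simp add: \<gamma> field_simps)
  finally show "k U t \<le> (2 * c) powr (1 / (s - 1)) * t powr (-(1 + \<gamma>))" .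
qed

lemma tail_integral:
  assumes "r \<ge> 1"
  shows "((\<lambda>t. t powr (-(1 + \<gamma>))) has_integral r powr (-\<gamma>) / \<gamma>) {r..}"
  using has_integral_powr_to_inf[of "-(1 + \<gamma>)" r] \<gamma>0 assms by simp

lemma k_integrable:
  assumes "adm U" "r \<ge> 1" shows "k U integrable_on {r..}"
proof (rule integrable_on_dominated)
  have "continuous_on {r..} (k U)" by (rule continuous_on_subset[OF k_cont[OF assms(1)]]) (use assms in auto)
  then show "k U \<in> borel_measurable (lebesgue_on {r..})"
    by (intro continuous_imp_measurable_on_sets_lebesgue) auto
  show "(\<lambda>t. (2 * c) powr (1 / (s - 1)) * t powr (-(1 + \<gamma>))) integrable_on {r..}"
    using tail_integral[OF assms(2)] by (intro integrable_on_mult_right) (rule has_integral_integrable)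
qed (use k_bounds[OF assms(1)] assms(2) in auto)

lemma T_adm: assumes "adm U" shows "adm (T U)"
  unfolding adm_def
proof (intro conjI allI)
  show "antimono (T U)"
  proof (rule antimonoI)
    fix x y :: real assume "x \<le> y"
    then show "T U y \<le> T U x"
      unfolding T_def using k_bounds[OF assms]
      by (intro integral_subset_le k_integrable[OF assms]) auto
  qed
  fix r
  show "0 \<le> T U r" unfolding T_def using k_bounds[OF assms]
    by (intro Henstock_Kurzweil_Integration.integral_nonneg k_integrable[OF assms]) auto
  let ?r = "max 1 r"
  have "T U r \<le> integral {?r..} (\<lambda>t. (2 * c) powr (1 / (s - 1)) * t powr (-(1 + \<gamma>)))"
    unfolding T_def using k_bounds[OF assms] tail_integral[of ?r]
    by (intro integral_le k_integrable[OF assms] integrable_on_mult_right) (auto intro: has_integral_integrable)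
  also have "\<dots> = (2 * c) powr (1 / (s - 1)) / \<gamma> * ?r powr (-\<gamma>)"
    using tail_integral[of ?r] by (simp add: integral_unique)
  \<comment> \<open>This inequality between constants is the smallness condition on
    \<open>\<kappa>\<close> in the locale.\<close>
  also have "\<dots> \<le> \<kappa> * ?r powr (-\<gamma>)"
    using \<kappa>(2) by (intro mult_right_mono) (auto simp: c_def M_def \<nu>'_def)
  finally show "T U r \<le> w r" by (simp add: w_def)
qed

lemma T_mono:
  assumes U: "adm U" "adm U'" and le: "\<And>r. U r \<le> U' r"
  shows "T U r \<le> T U' r"
proof -
  have U0: "0 \<le> U r" for r using U(1) by (simp add: adm_def)
  have vle: "v U y \<le> v U' y" for y
    unfolding v_def dens_def using le U0 pq by (intro mult_left_mono powr_mono2) auto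
  have Fle: "F U \<tau> \<le> F U' \<tau>" if "\<tau> \<ge> 1" for \<tau>
  proof -
    have n: "norm (\<tau> *\<^sub>R e) \<ge> 1" using e that by simp
    have "J U (\<tau> *\<^sub>R e) \<le> J U' (\<tau> *\<^sub>R e)"
      unfolding J_def by (intro integral_mono J_integrable U n mult_right_mono vle) auto
    then show ?thesis unfolding F_def using J_bounds(1)[OF U(1) n] le U0 pq by (intro mult_mono powr_mono2) auto
  qed
  have Hle: "Hf U t \<le> Hf U' t" if "t \<ge> 1" for t
    unfolding Hf_def using Fle that by (intro add_left_mono integral_le F_integrable U mult_left_mono) auto
  have "k U t \<le> k U' t" if "t \<ge> 1" for t
    unfolding k_def using Hle[OF that] that by (intro b_mono arg_nonneg U mult_left_mono) auto
  then show ?thesis unfolding T_def by (intro integral_le k_integrable U) auto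
qed

text \<open>The infimum of all admissible supersolutions of \<open>T\<close> is a fixed point, as in the
  Knaster--Tarski theorem.\<close>

lemma fixed_point: obtains U where "adm U" "T U = U"
proof -
  define S where "S = {U. adm U \<and> (\<forall>r. T U r \<le> U r)}"
  have wS: "w \<in> S" using adm_w T_adm[OF adm_w] by (auto simp: S_def adm_def)
  define u where "u = (\<lambda>r. INF U\<in>S. U r)"
  have bdd: "bdd_below ((\<lambda>U. U r) ` S)" for r by (rule bdd_belowI[of _ 0]) (auto simp: S_def adm_def)
  have ule: "u r \<le> U r" if "U \<in> S" for U r unfolding u_def by (rule cINF_lower[OF bdd that])
  have uge: "z \<le> u r" if "\<And>U. U \<in> S \<Longrightarrow> z \<le> U r" for z r unfolding u_def using wS that by (intro cINF_greatest) auto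
  have au: "adm u"
    unfolding adm_def
  proof (intro conjI allI)
    show "antimono u"
    proof (rule antimonoI)
      fix x y :: real assume xy: "x \<le> y"
      show "u y \<le> u x"
      proof (rule uge)
        fix U assume U: "U \<in> S"
        then have "U y \<le> U x" using xy by (auto simp: S_def adm_def antimono_def)
        then show "u y \<le> U x" using ule[OF U, of y] by simp
      qed
    qed
    show "0 \<le> u r" for r by (rule uge) (auto simp: S_def adm_def)
    show "u r \<le> w r" for r by (rule ule[OF wS])
  qed
  have Tu: "T u r \<le> u r" for r
  proof (rule uge)
    fix U assume U: "U \<in> S"
    then have "T u r \<le> T U r" using au ule[OF U] by (intro T_mono) (auto simp: S_def)
    then show "T u r \<le> U r" using U by (auto simp: S_def intro: order_trans)
  qed
  have "T u \<in> S" unfolding S_def using T_adm[OF au] T_mono[OF T_adm[OF au] au Tu] by simp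
  then have "u r \<le> T u r" for r by (rule ule)
  then show ?thesis using that[OF au] Tu by (metis ext order_antisym)
qed

text \<open>A fixed point is a priori only monotone. Since \<open>k U\<close> is continuous,
  \<open>U = T U\<close> is C^1; then the potential and \<open>F U\<close> are continuous, so
  \<open>Hf U\<close> is C^1 and the divergence identity applies to the flux field.\<close>

theorem C1_solution_exists: "\<exists>u::'a \<Rightarrow> real. positive_C1_solution_eq \<alpha> p q m s g u"
proof -
  obtain U where U: "adm U" and TU: "T U = U" by (rule fixed_point)
  have Ueq: "U r = integral {r..} (k U)" if "r \<ge> 1" for r
    using fun_cong[OF TU, of r] that by (simp add: T_def max_def)
  have kpos: "k U t > 0" if "t \<ge> 1" for t
    unfolding k_def using Hf_bounds(1)[OF U that] c0 that by (intro b_pos mult_pos_pos) auto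
  have Upos: "U r > 0" if r: "r \<ge> 1" for r
  proof -
    have kc: "continuous_on {r..r+1} (k U)" by (rule continuous_on_subset[OF k_cont[OF U]]) (use r in auto)
    obtain t0 where t0: "t0 \<in> {r..r+1}" "\<And>t. t \<in> {r..r+1} \<Longrightarrow> k U t0 \<le> k U t"
      using continuous_attains_inf[OF compact_Icc _ kc] by auto
    have ki: "k U integrable_on {r..r+1}" using kc by (rule integrable_continuous_interval)
    have "k U t0 = integral {r..r+1} (\<lambda>t. k U t0)" by simp
    also have "\<dots> \<le> integral {r..r+1} (k U)" using t0 ki by (intro integral_le) auto
    also have "\<dots> \<le> integral {r..} (k U)"
      using kpos r by (intro integral_subset_le ki k_integrable[OF U]) (auto intro: less_imp_le)
    finally have "k U t0 \<le> U r" using Ueq[OF r] by simp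
    then show ?thesis using kpos[of t0] t0(1) r by auto
  qed
  have Ud: "DERIV U r :> - k U r" if r: "r > 1" for r
  proof -
    have sp: "U \<rho> = integral {1..} (k U) - integral {1..\<rho>} (k U)" if "\<rho> \<ge> 1" for \<rho>
    proof -
      have i1: "k U integrable_on {1..\<rho>}"
        by (intro integrable_continuous_interval continuous_on_subset[OF k_cont[OF U]]) auto
      have "{1..\<rho>} \<inter> {\<rho>..} = {\<rho>}" "{1..\<rho>} \<union> {\<rho>..} = {1..}" using that by auto
      then have "integral {1..} (k U) = integral {1..\<rho>} (k U) + integral {\<rho>..} (k U)"
        using integral_Un[OF i1 k_integrable[OF U that]] by simp
      then show ?thesis using Ueq[OF that] by simp
    qed
    have "((\<lambda>x. integral {1..x} (k U)) has_real_derivative k U r) (at r within {1..r+1})"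
      by (rule integral_has_real_derivative) (use r in \<open>auto intro: continuous_on_subset[OF k_cont[OF U]]\<close>)
    then have "DERIV (\<lambda>x. integral {1..x} (k U)) r :> k U r" using r by (simp add: at_within_Icc_at)
    from DERIV_diff[OF DERIV_const this]
    have "DERIV (\<lambda>x. integral {1..} (k U) - integral {1..x} (k U)) r :> - k U r" by simp
    then show ?thesis
      by (rule has_field_derivative_transform_within_open[of _ _ _ "{1<..}"]) (use r sp in auto)
  qed
  interpret P: riesz_potential \<alpha> "v U" "exterior :: 'a set" by (rule riesz[OF U])
  have Uc: "continuous_on {1<..} U" using Ud DERIV_isCont by (force intro: continuous_at_imp_continuous_on)
  have Fc: "continuous_on {1<..} (F U)"
  proof -
    have "continuous_on {1<..} (\<lambda>\<tau>. J U (\<tau> *\<^sub>R e))"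
      unfolding J_pot[OF U]
      by (rule continuous_on_compose2[OF P.pot_continuous]) (use e in \<open>auto intro!: continuous_intros\<close>)
    moreover have "\<forall>r\<in>{1<..}. U r \<noteq> 0"
    proof
      fix r :: real assume "r \<in> {1<..}"
      then show "U r \<noteq> 0" using Upos[of r] by auto
    qed
    ultimately show ?thesis unfolding F_def[abs_def] using Uc
      by (intro continuous_on_mult continuous_on_powr continuous_on_const) auto
  qed
  define H' where "H' = (\<lambda>\<tau>. \<tau> powr (N - 1) * F U \<tau>)"
  have H'c: "continuous_on {1<..} H'" unfolding H'_def using Fc by (intro continuous_intros) auto
  have Hd: "DERIV (Hf U) t :> H' t" if t: "t > 1" for t
  proof -
    \<comment> \<open>The integrand is known to be continuous only on the open half-line beyond 1,
      so the differentiated integral starts at a point between 1 and \<open>t\<close>.\<close>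
    define t0 where "t0 = (1 + t) / 2"
    have t0: "1 < t0" "t0 < t" using t by (auto simp: t0_def)
    have "((\<lambda>x. integral {t0..x} H') has_real_derivative H' t) (at t within {t0..t+1})"
      by (rule integral_has_real_derivative) (use t0 in \<open>auto intro: continuous_on_subset[OF H'c]\<close>)
    then have "DERIV (\<lambda>x. integral {t0..x} H') t :> H' t" using t0 by (simp add: at_within_Icc_at)
    from DERIV_add[OF DERIV_const this]
    have "DERIV (\<lambda>x. Hf U t0 + integral {t0..x} H') t :> H' t" by simp
    then show ?thesis
    proof (rule has_field_derivative_transform_within_open[of _ _ _ "{t0<..}"])
      fix x assume x: "x \<in> {t0<..}"
      then have "integral {1..t0} H' + integral {t0..x} H' = integral {1..x} H'"
        unfolding H'_def using t0 by (intro Henstock_Kurzweil_Integration.integral_combine F_integrable U) auto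
      then show "Hf U t0 + integral {t0..x} H' = Hf U x" by (simp add: Hf_def H'_def)
    qed (use t0 in auto)
  qed
  define u where "u = (\<lambda>x::'a. U (norm x))"
  have gu: "GDERIV u x :> - k U (norm x) *\<^sub>R sgn x" if "x \<in> exterior" for x
  proof -
    have "x \<noteq> 0" "norm x > 1" using that by auto
    then show ?thesis unfolding u_def by (intro GDERIV_DERIV_compose GDERIV_norm Ud)
  qed
  have grad_u: "grad u x = - k U (norm x) *\<^sub>R sgn x" if "x \<in> exterior" for x by (rule grad_eq[OF gu[OF that]])
  have "continuous_on exterior (\<lambda>x::'a. - k U (norm x) *\<^sub>R sgn x)"
    by (intro continuous_intros continuous_on_compose2[OF k_cont[OF U]]) auto
  then have "continuous_on exterior (grad u)" by (rule continuous_on_eq) (simp only: grad_u)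
  then have C1u: "C1_on exterior u" unfolding C1_on_def using gu GDERIV_imp_differentiable by blast
  have dens: "dens p u = v U" by (simp add: v_def u_def)
  have bor: "dens p u \<in> borel_measurable borel" unfolding dens by (rule v_borel[OF U])
  have ci: "conv_integrable \<alpha> p u" unfolding conv_integrable_dens[OF bor] dens by (rule P.v_int)
  \<comment> \<open>Rotation invariance of the potential moves every point to the ray through
    \<open>e\<close>, on which \<open>F\<close> is defined.\<close>
  have cJ: "conv \<alpha> p u x = J U (norm x *\<^sub>R e)" for x
  proof -
    have "conv \<alpha> p u x = P.pot x" unfolding conv_dens[OF bor] dens P.pot_def ..
    also have "\<dots> = P.pot (norm x *\<^sub>R e)"
      by (rule P.pot_radial) (use e in \<open>auto simp: v_def dens_def indicator_def\<close>)
    finally show ?thesis by (simp add: J_pot[OF U])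
  qed
  have eq: "weak_lhs m s g (grad u) \<phi> = weak_rhs \<alpha> p q u \<phi>" if \<phi>: "\<phi> \<in> test_functions exterior" for \<phi>
  proof -
    obtain K where K: "compact K" "K \<subseteq> exterior" "C1c K \<phi> (grad \<phi>)" using test_functionD[OF \<phi>] by metis
    note C = C1cD[OF K(3)]
    let ?G = "\<lambda>x::'a. - (norm x powr (-N) * Hf U (norm x)) *\<^sub>R x"
    let ?E = "\<lambda>b x::'a. - (norm x powr (-N) * Hf U (norm x)) *\<^sub>R b - ((x \<bullet> b) * (norm x powr (-N) * H' (norm x) - N * norm x powr (-N-1) * Hf U (norm x))) *\<^sub>R sgn x"
    have ext: "x \<noteq> 0" "norm x > 1" if "x \<in> exterior" for x :: 'a using that by auto
    have G: "A (grad u x) = ?G x" if x: "x \<in> exterior" for x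
    proof -
      have "A (grad u x) = - (norm x powr (1 - N) * Hf U (norm x)) *\<^sub>R sgn x"
        unfolding grad_u[OF x] k_def using ext[OF x] arg_nonneg[OF U, of "norm x"] by (intro flux_inverse) (auto simp: norm_sgn)
      then show ?thesis using ext[OF x] powr_add[of "norm x" 1 "-N"] by (simp add: sgn_div_norm)
    qed
    have Gd: "GDERIV (\<lambda>x. ?G x \<bullet> b) x :> ?E b x" if "x \<in> exterior" for x b
      using ext[OF that] by (intro radial_field_gradient Hd N)
    have Hc: "continuous_on {1<..} (Hf U)" by (rule continuous_on_subset[OF Hf_cont[OF U]]) auto
    have Ec: "continuous_on exterior (?E b)" for b
      using ext by (intro continuous_intros continuous_on_compose2[OF Hc] continuous_on_compose2[OF H'c]) auto
    have rhs: "- (\<Sum>b\<in>Basis. ?E b x \<bullet> b) = conv \<alpha> p u x * u x powr q" if x: "x \<in> exterior" for x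
    proof -
      have "- (\<Sum>b\<in>Basis. ?E b x \<bullet> b) = norm x powr (1 - N) * H' (norm x)"
        using radial_field_divergence[OF ext(1)[OF x] N] by simp
      also have "\<dots> = (norm x powr (1 - N) * norm x powr (N - 1)) * F U (norm x)" by (simp add: H'_def)
      also have "norm x powr (1 - N) * norm x powr (N - 1) = 1" using ext[OF x] by (simp add: powr_add[symmetric])
      finally show ?thesis unfolding cJ by (simp add: F_def u_def)
    qed
    have inK: "indicator (- ball 0 1) x = (1::real)" if "x \<in> K" for x using that K(2) by auto
    have cG: "continuous_on K ?G"
      using K(2) ext by (intro continuous_intros continuous_on_compose2[OF Hc]) auto
    have "continuous_on K (\<lambda>x. ?G x \<bullet> grad \<phi> x)"
      by (intro continuous_on_inner cG continuous_on_subset[OF C(3) subset_UNIV])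
    from borel_measurable_integrable[OF borel_integrable_compact[OF K(1) this]]
    have m1: "(\<lambda>x. indicator K x * (?G x \<bullet> grad \<phi> x)) \<in> borel_measurable borel" by simp
    have "continuous_on K (\<lambda>x. (\<Sum>b\<in>Basis. ?E b x \<bullet> b) * \<phi> x)"
      by (intro continuous_on_mult continuous_on_sum continuous_on_inner continuous_on_const
          continuous_on_subset[OF Ec K(2)] continuous_on_subset[OF C(4) subset_UNIV])
    from borel_measurable_uminus[OF borel_measurable_integrable[OF borel_integrable_compact[OF K(1) this]]]
    have m2: "(\<lambda>x. - (indicator K x * ((\<Sum>b\<in>Basis. ?E b x \<bullet> b) * \<phi> x))) \<in> borel_measurable borel"
      by (simp only: real_scaleR_def measurable_lborel2)
    have "weak_lhs m s g (grad u) \<phi> = (\<integral>x. indicator K x * (?G x \<bullet> grad \<phi> x) \<partial>lborel)"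
      unfolding weak_lhs_def set_lebesgue_integral_def flux_def[symmetric]
    proof (rule lebesgue_AE_eq(1)[OF m1], intro AE_I2)
      fix x
      show "indicator (- ball 0 1) x *\<^sub>R (A (grad u x) \<bullet> grad \<phi> x) = indicator K x * (?G x \<bullet> grad \<phi> x)"
        using C(6)[of x] inK[of x] G[of x] K(2) by (cases "x \<in> K") auto
    qed
    also have "\<dots> = - (\<integral>x. indicator K x * ((\<Sum>b\<in>Basis. ?E b x \<bullet> b) * \<phi> x) \<partial>lborel)"
      by (rule divergence_test[OF K(3) _ K(2) Gd Ec]) auto
    also have "\<dots> = (\<integral>x. - (indicator K x * ((\<Sum>b\<in>Basis. ?E b x \<bullet> b) * \<phi> x)) \<partial>lborel)" by simp
    also have "\<dots> = weak_rhs \<alpha> p q u \<phi>"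
      unfolding weak_rhs_def set_lebesgue_integral_def
    proof (rule lebesgue_AE_eq(1)[OF m2, symmetric], intro AE_I2)
      fix x
      show "indicator (- ball 0 1) x *\<^sub>R (conv \<alpha> p u x * u x powr q * \<phi> x) = - (indicator K x * ((\<Sum>b\<in>Basis. ?E b x \<bullet> b) * \<phi> x))"
      proof (cases "x \<in> K")
        case True
        then have "conv \<alpha> p u x * u x powr q = - (\<Sum>b\<in>Basis. ?E b x \<bullet> b)" using rhs[of x] K(2) by (simp add: subset_iff)
        then show ?thesis using True inK[OF True] by simp
      qed (use C(5) in simp)
    qed
    finally show ?thesis .
  qed
  have "\<forall>x\<in>exterior. u x > 0" unfolding u_def using Upos by auto
  then show ?thesis unfolding positive_C1_solution_eq_def using C1u ci eq by blast
qed

end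

section \<open>Choice of the parameters and the equivalence\<close>

lemma (in mixed_operator) existence:
  fixes \<alpha> p q N \<gamma> :: real
  assumes N: "N = real DIM('a::euclidean_space)" and sN: "s < N" and \<alpha>: "0 < \<alpha>" "\<alpha> < N"
    and p: "p > m - 1" and q: "q > m - 1" and \<gamma>: "\<gamma> = (N - s) / (s - 1)"
    and c: "\<gamma> * p > N - \<alpha>" "\<gamma> * q > N - \<alpha>" "\<gamma> * (p + q) > 2 * N - \<alpha>"
  shows "\<exists>u::'a \<Rightarrow> real. positive_C1_solution_eq \<alpha> p q m s g u"
proof -
  have \<gamma>0: "\<gamma> > 0" using sN ms by (simp add: \<gamma>)
  have pq: "p > 0" "q > 0" using p q m1 by auto
  \<comment> \<open>The four inequalities hidden here are the three exponent conditions and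
    \<open>\<alpha> > 0\<close>. An exponent in this gap is small enough for
    \<open>riesz_composition\<close> and the decay of the density, and large enough for finite
    mass.\<close>
  have "max (N - \<alpha>) (2 * N - \<alpha> - \<gamma> * q) < min (\<gamma> * p) N" using c \<alpha> by (simp add: algebra_simps)
  then obtain a' where a': "max (N - \<alpha>) (2 * N - \<alpha> - \<gamma> * q) < a'" "a' < min (\<gamma> * p) N" using dense by blast
  then have a'': "0 < a'" "a' < real DIM('a)" "real DIM('a) < a' + \<alpha>" "\<alpha> < real DIM('a)" using \<alpha> N by auto
  obtain C1 where C1: "C1 > 0" "\<And>x::'a. x \<noteq> 0 \<Longrightarrow>
    (\<integral>\<^sup>+y. ennreal (norm y powr (-a') * norm (x - y) powr (-\<alpha>)) \<partial>lborel) \<le> ennreal (C1 * norm x powr (real DIM('a) - \<alpha> - a'))"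
    by (rule riesz_composition[OF \<alpha>(1) a''(4) a''(1-3)]) (rule that, assumption+)
  have \<nu>: "a' + \<alpha> - N + \<gamma> * q > N" using a' by simp
  define Y where "Y = 2 * (C1 / (a' + \<alpha> - N + \<gamma> * q - N))"
  define D where "D = Y powr (1 / (s - 1)) / \<gamma>"
  have D: "D > 0" using C1 \<nu> \<gamma>0 by (simp add: D_def Y_def)
  \<comment> \<open>Positive because \<open>p + q > s - 1\<close>: the right-hand side is
    superlinear relative to the operator at small sizes.\<close>
  define \<sigma> where "\<sigma> = (p + q) / (s - 1) - 1"
  have \<sigma>: "\<sigma> > 0" using p q ms by (simp add: \<sigma>_def field_simps)
  \<comment> \<open>The left-hand side of the smallness condition equals
    \<open>D * \<kappa> powr (\<sigma> + 1)\<close>, so this value turns the condition into an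
    equality.\<close>
  define \<kappa> where "\<kappa> = (1 / D) powr (1 / \<sigma>)"
  have \<kappa>: "\<kappa> > 0" "\<kappa> powr \<sigma> = 1 / D" using D \<sigma> by (auto simp: \<kappa>_def powr_powr)
  have "(2 * (\<kappa> powr (p + q) * C1 / (a' + \<alpha> - N + \<gamma> * q - N))) powr (1 / (s - 1)) / \<gamma> = \<kappa>"
  proof -
    have "2 * (\<kappa> powr (p + q) * C1 / (a' + \<alpha> - N + \<gamma> * q - N)) = \<kappa> powr (p + q) * Y" by (simp add: Y_def)
    then have "(2 * (\<kappa> powr (p + q) * C1 / (a' + \<alpha> - N + \<gamma> * q - N))) powr (1 / (s - 1)) / \<gamma> = (\<kappa> powr (p + q)) powr (1 / (s - 1)) * D"
      by (simp add: powr_mult D_def)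
    also have "(\<kappa> powr (p + q)) powr (1 / (s - 1)) = \<kappa> powr (\<sigma> + 1)" by (simp add: powr_powr \<sigma>_def)
    also have "\<dots> = 1 / D * \<kappa>" using \<kappa> by (simp add: powr_add)
    finally show ?thesis using D by simp
  qed
  moreover obtain e :: 'a where "norm e = 1" using vector_choose_size[of 1] by auto
  ultimately have "radial_existence m s g N \<alpha> p q a' C1 \<kappa> \<gamma> e"
    using a' C1 \<nu> \<kappa> N sN \<alpha> pq \<gamma> c by unfold_locales auto
  then show ?thesis by (rule radial_existence.C1_solution_exists)
qed

theorem theorem1p3:
  fixes N :: nat and \<alpha> p q m s :: real and g :: "real \<Rightarrow> real"
  assumes N: "N = CARD('n::finite)"
    and \<alpha>: "0 < \<alpha>" "\<alpha> < real N"
    and pq: "p > 0" "q > 0"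
    and ms: "m > s" "s > 1" "s < real N"
    and q\<alpha>: "q \<ge> \<alpha> - 1"
    and pqm: "min p q > m - 1"
    and g_pos: "\<forall>t\<ge>0. g t > 0"
    and g_antimono: "antimono_on {0..} g"
    and g_C1: "g C1_differentiable_on {0<..}"
    and g_cont: "continuous_on {0..} g"
    and g_lim: "((\<lambda>t. t * deriv g t / g t) \<longlongrightarrow> 0) (at_right 0)"
    and g_lower: "\<forall>t>0. t * deriv g t / g t + m - 1 \<ge> 0"
  shows "((\<exists>u :: real ^ 'n \<Rightarrow> real. positive_solution_ineq \<alpha> p q m s g u) \<longleftrightarrow>
          (\<exists>u :: real ^ 'n \<Rightarrow> real. positive_C1_solution_eq \<alpha> p q m s g u)) \<and>
         ((\<exists>u :: real ^ 'n \<Rightarrow> real. positive_C1_solution_eq \<alpha> p q m s g u) \<longleftrightarrow>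
          (min p q > (s - 1) * (real N - \<alpha>) / (real N - s) \<and>
           p + q > (s - 1) * (2 * real N - \<alpha>) / (real N - s)))"
proof -
  have sN: "s < real N" by (rule ms(3))
  interpret mixed_operator m s g
    using ms g_pos g_antimono g_C1 g_cont g_lower by unfold_locales
  define \<gamma> where "\<gamma> = (real N - s) / (s - 1)"
  have dim: "real DIM(real ^ 'n) = real N" using N by simp
  \<comment> \<open>Multiplication by \<open>\<gamma> = (N - s) / (s - 1)\<close> rewrites the
    thresholds in (iii) as the three conditions of the nonexistence and existence parts.\<close>
  have iff: "x > (s - 1) * y / (real N - s) \<longleftrightarrow> \<gamma> * x > y" for x y
  proof -
    have "real N - s > 0" "s - 1 > 0" using ms sN by auto
    then show ?thesis by (simp add: \<gamma>_def pos_divide_less_eq pos_less_divide_eq mult.commute)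
  qed
  let ?iii = "min p q > (s - 1) * (real N - \<alpha>) / (real N - s) \<and> p + q > (s - 1) * (2 * real N - \<alpha>) / (real N - s)"
  have iii: "?iii \<longleftrightarrow> \<gamma> * p > real N - \<alpha> \<and> \<gamma> * q > real N - \<alpha> \<and> \<gamma> * (p + q) > 2 * real N - \<alpha>"
    by (simp only: min_less_iff_conj iff conj_assoc)
  have "?iii" if u: "positive_solution_ineq \<alpha> p q m s g u" for u :: "real ^ 'n \<Rightarrow> real"
  proof -
    obtain V where V: "exterior_supersolution m s g u (\<lambda>x. conv \<alpha> p u x * u x powr q) V (real N)"
      using exterior_supersolution_of_solution[OF \<alpha>(1) _ _ u] \<alpha> sN dim by auto
    have ci: "conv_integrable \<alpha> p u" using u by (simp add: positive_solution_ineq_def)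
    note ec = exterior_supersolution.exponent_conditions[OF V \<alpha> pq(1) _ ci refl]
    show ?thesis
      unfolding iii using ec pqm by (simp add: exterior_supersolution.\<gamma>_def[OF V] \<gamma>_def)
  qed
  moreover have "\<exists>u :: real ^ 'n \<Rightarrow> real. positive_C1_solution_eq \<alpha> p q m s g u" if "?iii"
    using that pqm unfolding iii by (intro existence[OF dim[symmetric] sN \<alpha> _ _ \<gamma>_def]) auto
  moreover have "positive_C1_solution_eq \<alpha> p q m s g u \<Longrightarrow> positive_solution_ineq \<alpha> p q m s g u" for u :: "real ^ 'n \<Rightarrow> real"
    by (rule solution_eq_imp_ineq)
  ultimately show ?thesis by blast
qed

end
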